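(* Let $M$ be a smooth finite-dimensional manifold, $(\psi,U)$ a gauge on $M$, $F:W\to\Gamma(TM)$, $w\mapsto F_w$, a linear map into smooth vector fields, and $I_0=[0,T]$ or $[0,T)$. Let $\mathbf y=(y,y^\dagger)$ on $I_0$ be a pair of continuous functions with $y_s\in M$, $y_s^\dagger\in L(W,T_{y_s}M)$. Then $\mathbf y$ solves $d\mathbf y_t=F_{d\mathbf X_t}(y_t)$ if and only if $y_s^\dagger=F_{(\cdot)}(y_s)$ for all $s\in I_0$ and for all $[a,b]\subseteq I_0$ there exists $\delta>0$ such that for $a\le s\le t\le b$ with $|t-s|\le\delta$, $$\psi(y_s,y_t)\approx_3F_{x_{s,t}}(y_s)+\left(-S^{\psi_*,U}_{y_s}\left[F_w(y_s)\otimes F_{\tilde w}(y_s)\right]+F_w(y_s)\left[U(y_s,\cdot)F_{\tilde w}\right]\right)\Big|_{w\otimes\tilde w=\mathbb X_{s,t}}.$$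
   Context: Rough paths. $W=\mathbb R^k$, $T>0$, $1\le p<3$, $\Delta_{[0,T]}=\{(s,t):0\le s\le t\le T\}$. A control is a continuous $\omega:\Delta_{[0,T]}\to[0,\infty)$ with $\omega(s,s)=0$ and $\omega(s,t)+\omega(t,u)\le\omega(s,u)$ for $s\le t\le u$. $\mathbf X=(x,\mathbb X)$ is a fixed weak-geometric $p$-rough path with control $\omega$: $x:[0,T]\to W$ and $\mathbb X:\Delta_{[0,T]}\to W\otimes W$ are continuous and, with $x_{s,t}:=x_t-x_s$, one has $\mathbb X_{s,u}=\mathbb X_{s,t}+\mathbb X_{t,u}+x_{s,t}\otimes x_{t,u}$ for $s\le t\le u$, $|x_{s,t}|\le\omega(s,t)^{1/p}$, $|\mathbb X_{s,t}|\le\omega(s,t)^{2/p}$, and the symmetric part of $\mathbb X_{s,t}$ equals $\frac12x_{s,t}\otimes x_{s,t}$. $A_{s,t}\approx_3B_{s,t}$ for $a\le s\le t\le b$, $t-s\le\delta$ means: there is $C<\infty$ with $|A_{s,t}-B_{s,t}|\le C\omega(s,t)^{3/p}$ for all such $s,t$ ($\delta$ small enough that everything is defined); for $T_{y_s}M$-valued quantities the norm comes from any fixed Riemannian metric. Notation $|_{w\otimes\tilde w=\mathbb W}$: for a bilinear $\Xi$ on $W\times W$ and $\mathbb W=\sum_iw_i\otimes\tilde w_i$, $\Xi(w,\tilde w)|_{w\otimes\tilde w=\mathbb W}:=\sum_i\Xi(w_i,\tilde w_i)$. Gauges. A diagonal domain is an open $\mathcal D\subseteq M\times M$ containing the diagonal.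 A logarithm is a smooth $\psi:\mathcal D\to TM$ with $\psi(m,n)\in T_mM$, $\psi(m,m)=0_m$, and differential of $\psi(m,\cdot)$ at $m$ equal to the identity of $T_mM$. A parallelism is a smooth map $(n,m)\in\mathcal D\mapsto U(n,m)\in L(T_mM,T_nM)$ with $U(m,m)=I$. A gauge is a pair $(\psi,U)$ of these with common domain $\mathcal D$. Compatibility tensor: $S_m^{\psi_*,U}[v\otimes u]:=v\left[n\mapsto U(n,m)^{-1}\psi(n,\cdot)_{*m}u\right]$ for $v,u\in T_mM$ (derivative at $m$ in direction $v$ of a $T_mM$-valued function), where $\psi(n,\cdot)_{*m}:T_mM\to T_nM$ is the differential of $\psi(n,\cdot)$ at $m$. Also $F_w(m)[U(m,\cdot)F_{\tilde w}]$ is the derivative at $m$, in direction $F_w(m)$, of the $T_mM$-valued function $n\mapsto U(m,n)F_{\tilde w}(n)$. Solution: $\mathbf y=(y,y^\dagger)$ on $I_0$ solves $d\mathbf y_t=F_{d\mathbf X_t}(y_t)$ if $y_s^\dagger=F_{(\cdot)}(y_s)$ and for every $f\in C^\infty(M)$ and every $[a,b]\subseteq I_0$ there are $C<\infty$, $\delta>0$ with $\left|f(y_t)-f(y_s)-(F_{x_{s,t}}f)(y_s)-(F_wF_{\tilde w}f)(y_s)|_{w\otimes\tilde w=\mathbb X_{s,t}}\right|\le C\omega(s,t)^{3/p}$ for all $a\le s\le t\le b$ with $t-s\le\delta$. *)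

theory Defs
  imports "HOL-Analysis.Analysis"
begin

section \<open>Smooth maps between Euclidean spaces\<close>

primrec Ck_on ::
  "nat \<Rightarrow> 'a::euclidean_space set \<Rightarrow> ('a \<Rightarrow> 'b::real_normed_vector) \<Rightarrow> bool" where
  "Ck_on 0 S f \<longleftrightarrow> continuous_on S f"
| "Ck_on (Suc k) S f \<longleftrightarrow>
     (\<forall>x\<in>S. f differentiable (at x)) \<and>
     (\<forall>v. Ck_on k S (\<lambda>x. frechet_derivative f (at x) v))"

text \<open>Only used for open \<open>S\<close>.\<close>

definition smooth_on :: "'a::euclidean_space set \<Rightarrow> ('a \<Rightarrow> 'b::real_normed_vector) \<Rightarrow> bool" where
  "smooth_on S f \<longleftrightarrow> (\<forall>k. Ck_on k S f)"


section \<open>Smooth manifolds\<close>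

text \<open>
  The manifold is a whole Hausdorff, second countable type \<open>'m\<close> with a smooth (not necessarily
  maximal) atlas modelled on the Euclidean space \<open>'e\<close>.  A chart is a pair of its domain and its
  coordinate map; the values of the coordinate map outside the domain are irrelevant.
\<close>

type_synonym ('m, 'e) chart = "'m set \<times> ('m \<Rightarrow> 'e)"

abbreviation cdom :: "('m, 'e) chart \<Rightarrow> 'm set" where "cdom \<equiv> fst"
abbreviation cmap :: "('m, 'e) chart \<Rightarrow> 'm \<Rightarrow> 'e" where "cmap \<equiv> snd"

definition cinv :: "('m, 'e) chart \<Rightarrow> 'e \<Rightarrow> 'm" where
  "cinv c = inv_into (cdom c) (cmap c)"

definition is_chart :: "('m::topological_space, 'e::euclidean_space) chart \<Rightarrow> bool" where
  "is_chart c \<longleftrightarrow> open (cdom c) \<and> open (cmap c ` cdom c) \<and>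
     homeomorphism (cdom c) (cmap c ` cdom c) (cmap c) (cinv c)"

definition smooth_atlas ::
  "('m::{t2_space, second_countable_topology}, 'e::euclidean_space) chart set \<Rightarrow> bool" where
  "smooth_atlas A \<longleftrightarrow>
     (\<forall>c\<in>A. is_chart c) \<and> (\<Union>c\<in>A. cdom c) = UNIV \<and>
     (\<forall>c\<in>A. \<forall>d\<in>A. smooth_on (cmap c ` (cdom c \<inter> cdom d)) (cmap d \<circ> cinv c))"

definition smooth_fun_on ::
  "('m::topological_space, 'e::euclidean_space) chart set \<Rightarrow> 'm set \<Rightarrow>
    ('m \<Rightarrow> 'b::real_normed_vector) \<Rightarrow> bool" where
  "smooth_fun_on A V f \<longleftrightarrow> (\<forall>c\<in>A. smooth_on (cmap c ` (V \<inter> cdom c)) (f \<circ> cinv c))"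

text \<open>
  A tangent vector at \<open>m\<close> assigns to every chart around \<open>m\<close> a coordinate vector, these being
  related by the differentials of the chart transitions.  To make the representation unique, the
  value is 0 at all other arguments.  All linear operations on tangent vectors are pointwise.
\<close>

type_synonym ('m, 'e) tvec = "('m, 'e) chart \<Rightarrow> 'e"

definition tangent_space ::
  "('m::topological_space, 'e::euclidean_space) chart set \<Rightarrow> 'm \<Rightarrow> ('m, 'e) tvec set" where
  "tangent_space A m = {v.
     (\<forall>c\<in>A. \<forall>d\<in>A. m \<in> cdom c \<inter> cdom d \<longrightarrow>
        v d = frechet_derivative (cmap d \<circ> cinv c) (at (cmap c m)) (v c)) \<and>
     (\<forall>c. \<not> (c \<in> A \<and> m \<in> cdom c) \<longrightarrow> v c = 0)}"

text \<open>The tangent vector at \<open>m\<close> whose coordinate vector in the chart \<open>c\<close> is \<open>e\<close>.\<close>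

definition coord_vec ::
  "('m::topological_space, 'e::euclidean_space) chart set \<Rightarrow> ('m, 'e) chart \<Rightarrow> 'm \<Rightarrow> 'e \<Rightarrow>
    ('m, 'e) tvec" where
  "coord_vec A c m e = (\<lambda>d. if d \<in> A \<and> m \<in> cdom d
     then frechet_derivative (cmap d \<circ> cinv c) (at (cmap c m)) e else 0)"

definition lincomb ::
  "real \<Rightarrow> ('m, 'e::real_vector) tvec \<Rightarrow> real \<Rightarrow> ('m, 'e) tvec \<Rightarrow> ('m, 'e) tvec" where
  "lincomb a u b v = (\<lambda>c. a *\<^sub>R u c + b *\<^sub>R v c)"

text \<open>
  The derivative \<open>v[n \<mapsto> f n]\<close> of a vector valued function at \<open>m\<close> in direction \<open>v\<close>.  It does not
  depend on the choice of the chart, see \<open>dirderiv_eq\<close> below.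
\<close>

definition dirderiv ::
  "('m::topological_space, 'e::euclidean_space) chart set \<Rightarrow> ('m \<Rightarrow> 'b::real_normed_vector) \<Rightarrow>
    'm \<Rightarrow> ('m, 'e) tvec \<Rightarrow> 'b" where
  "dirderiv A f m v =
     (let c = (SOME c. c \<in> A \<and> m \<in> cdom c)
      in frechet_derivative (f \<circ> cinv c) (at (cmap c m)) (v c))"

text \<open>
  The same derivative for a function \<open>G\<close> all of whose values, for arguments near \<open>m\<close>, lie in one
  fixed tangent space.  That tangent space need not be the one at \<open>m\<close>.
\<close>

definition tderiv ::
  "('m::topological_space, 'e::euclidean_space) chart set \<Rightarrow> ('m \<Rightarrow> ('m, 'e) tvec) \<Rightarrow>
    'm \<Rightarrow> ('m, 'e) tvec \<Rightarrow> ('m, 'e) tvec" where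
  "tderiv A G m v = (\<lambda>c. dirderiv A (\<lambda>n. G n c) m v)"

definition smooth_vector_field ::
  "('m::topological_space, 'e::euclidean_space) chart set \<Rightarrow> ('m \<Rightarrow> ('m, 'e) tvec) \<Rightarrow> bool" where
  "smooth_vector_field A Y \<longleftrightarrow> (\<forall>m. Y m \<in> tangent_space A m) \<and>
     (\<forall>c\<in>A. smooth_on (cmap c ` cdom c) (\<lambda>z. Y (cinv c z) c))"

definition lie_deriv ::
  "('m::topological_space, 'e::euclidean_space) chart set \<Rightarrow> ('m \<Rightarrow> ('m, 'e) tvec) \<Rightarrow>
    ('m \<Rightarrow> real) \<Rightarrow> 'm \<Rightarrow> real" where
  "lie_deriv A Y f = (\<lambda>m. dirderiv A f m (Y m))"

definition riemannian_metric ::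
  "('m::topological_space, 'e::euclidean_space) chart set \<Rightarrow>
    ('m \<Rightarrow> ('m, 'e) tvec \<Rightarrow> ('m, 'e) tvec \<Rightarrow> real) \<Rightarrow> bool" where
  "riemannian_metric A g \<longleftrightarrow>
     (\<forall>m. \<forall>u\<in>tangent_space A m. \<forall>v\<in>tangent_space A m. \<forall>w\<in>tangent_space A m. \<forall>a b.
        g m u v = g m v u \<and> g m (lincomb a u b v) w = a * g m u w + b * g m v w) \<and>
     (\<forall>m. \<forall>v\<in>tangent_space A m. v \<noteq> (\<lambda>_. 0) \<longrightarrow> g m v v > 0) \<and>
     (\<forall>c\<in>A. \<forall>e e'. smooth_fun_on A (cdom c)
        (\<lambda>m. g m (coord_vec A c m e) (coord_vec A c m e')))"

definition metric_norm ::
  "('m \<Rightarrow> ('m, 'e) tvec \<Rightarrow> ('m, 'e) tvec \<Rightarrow> real) \<Rightarrow> 'm \<Rightarrow> ('m, 'e) tvec \<Rightarrow> real" where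
  "metric_norm g m v = sqrt (g m v v)"


section \<open>Gauges\<close>

definition diagonal_domain :: "('m::topological_space \<times> 'm) set \<Rightarrow> bool" where
  "diagonal_domain D \<longleftrightarrow> open D \<and> (\<forall>m. (m, m) \<in> D)"

text \<open>The image of \<open>D\<close> under the product chart \<open>c \<times> d\<close>.\<close>

definition chart_image2 ::
  "('m \<times> 'm) set \<Rightarrow> ('m, 'e) chart \<Rightarrow> ('m, 'e) chart \<Rightarrow> ('e \<times> 'e) set" where
  "chart_image2 D c d = map_prod (cmap c) (cmap d) ` (D \<inter> cdom c \<times> cdom d)"

text \<open>
  Since \<open>\<psi> m n\<close> is tangent at \<open>m\<close>, smoothness of \<open>\<psi>\<close> as a map into the tangent bundle means
  smoothness of its fibre coordinates in every chart around the first argument.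
\<close>

definition logarithm ::
  "('m::topological_space, 'e::euclidean_space) chart set \<Rightarrow> ('m \<times> 'm) set \<Rightarrow>
    ('m \<Rightarrow> 'm \<Rightarrow> ('m, 'e) tvec) \<Rightarrow> bool" where
  "logarithm A D \<psi> \<longleftrightarrow>
     (\<forall>(m, n)\<in>D. \<psi> m n \<in> tangent_space A m) \<and>
     (\<forall>c\<in>A. \<forall>d\<in>A. smooth_on (chart_image2 D c d) (\<lambda>(z, z'). \<psi> (cinv c z) (cinv d z') c)) \<and>
     (\<forall>m. \<psi> m m = (\<lambda>_. 0)) \<and>
     (\<forall>m. \<forall>u\<in>tangent_space A m. tderiv A (\<psi> m) m u = u)"

text \<open>\<open>U n m\<close> maps the tangent space at \<open>m\<close> to the one at \<open>n\<close>.\<close>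

definition parallelism ::
  "('m::topological_space, 'e::euclidean_space) chart set \<Rightarrow> ('m \<times> 'm) set \<Rightarrow>
    ('m \<Rightarrow> 'm \<Rightarrow> ('m, 'e) tvec \<Rightarrow> ('m, 'e) tvec) \<Rightarrow> bool" where
  "parallelism A D U \<longleftrightarrow>
     (\<forall>(n, m)\<in>D. \<forall>u\<in>tangent_space A m. \<forall>v\<in>tangent_space A m.
        U n m u \<in> tangent_space A n \<and>
        (\<forall>a b. U n m (lincomb a u b v) = lincomb a (U n m u) b (U n m v))) \<and>
     (\<forall>c\<in>A. \<forall>d\<in>A. \<forall>e. smooth_on (chart_image2 D c d)
        (\<lambda>(z, z'). U (cinv c z) (cinv d z') (coord_vec A d (cinv d z') e) c)) \<and>
     (\<forall>m. \<forall>u\<in>tangent_space A m. U m m u = u)"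

definition gauge_on ::
  "('m::topological_space, 'e::euclidean_space) chart set \<Rightarrow> ('m \<times> 'm) set \<Rightarrow>
    ('m \<Rightarrow> 'm \<Rightarrow> ('m, 'e) tvec) \<Rightarrow> ('m \<Rightarrow> 'm \<Rightarrow> ('m, 'e) tvec \<Rightarrow> ('m, 'e) tvec) \<Rightarrow> bool" where
  "gauge_on A D \<psi> U \<longleftrightarrow> diagonal_domain D \<and> logarithm A D \<psi> \<and> parallelism A D U"

text \<open>
  \<open>compat_tensor A \<psi> U m v u\<close> is \<open>S\<^sub>m[v \<otimes> u]\<close>.  The inner \<open>tderiv\<close> is the differential at \<open>m\<close> of
  \<open>\<psi>(n, \<cdot>)\<close>, which takes values in the tangent space at \<open>n\<close>.  The inverse of \<open>U n m\<close> is a genuine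
  inverse for \<open>n\<close> near \<open>m\<close>, which is all that the outer derivative depends on.
\<close>

definition compat_tensor ::
  "('m::topological_space, 'e::euclidean_space) chart set \<Rightarrow>
    ('m \<Rightarrow> 'm \<Rightarrow> ('m, 'e) tvec) \<Rightarrow> ('m \<Rightarrow> 'm \<Rightarrow> ('m, 'e) tvec \<Rightarrow> ('m, 'e) tvec) \<Rightarrow>
    'm \<Rightarrow> ('m, 'e) tvec \<Rightarrow> ('m, 'e) tvec \<Rightarrow> ('m, 'e) tvec" where
  "compat_tensor A \<psi> U m v u =
     tderiv A (\<lambda>n. inv_into (tangent_space A m) (U n m) (tderiv A (\<psi> n) m u)) m v"


section \<open>Rough paths\<close>

text \<open>\<open>W = \<real>\<^sup>k\<close> is \<open>real^'k\<close>, and \<open>W \<otimes> W\<close> is the space of \<open>k \<times> k\<close> matrices.\<close>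

definition tensor :: "real^'k \<Rightarrow> real^'k \<Rightarrow> real^'k^'k" where
  "tensor u v = (\<chi> i j. u $ i * v $ j)"

text \<open>
  \<open>\<Xi>(w, w')\<close> evaluated at \<open>w \<otimes> w' = Z\<close>, computed from the representation of \<open>Z\<close> in the
  standard basis; for the independence of the representation see \<open>contract_sum_tensor\<close> below.
\<close>

definition contract ::
  "(real^'k \<Rightarrow> real^'k \<Rightarrow> 'b::real_vector) \<Rightarrow> real^'k^'k \<Rightarrow> 'b" where
  "contract \<Xi> Z = (\<Sum>i\<in>UNIV. \<Sum>j\<in>UNIV. (Z $ i $ j) *\<^sub>R \<Xi> (axis i 1) (axis j 1))"

definition simplex2 :: "real \<Rightarrow> (real \<times> real) set" where
  "simplex2 T = {(s, t). 0 \<le> s \<and> s \<le> t \<and> t \<le> T}"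

definition rp_control :: "real \<Rightarrow> (real \<Rightarrow> real \<Rightarrow> real) \<Rightarrow> bool" where
  "rp_control T \<omega> \<longleftrightarrow>
     continuous_on (simplex2 T) (\<lambda>(s, t). \<omega> s t) \<and>
     (\<forall>(s, t)\<in>simplex2 T. 0 \<le> \<omega> s t) \<and>
     (\<forall>s\<in>{0..T}. \<omega> s s = 0) \<and>
     (\<forall>s t u. 0 \<le> s \<and> s \<le> t \<and> t \<le> u \<and> u \<le> T \<longrightarrow> \<omega> s t + \<omega> t u \<le> \<omega> s u)"

definition weak_geometric_rough_path ::
  "real \<Rightarrow> real \<Rightarrow> (real \<Rightarrow> real \<Rightarrow> real) \<Rightarrow> (real \<Rightarrow> real^'k) \<Rightarrow> (real \<Rightarrow> real \<Rightarrow> real^'k^'k) \<Rightarrow>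
    bool" where
  "weak_geometric_rough_path p T \<omega> x X \<longleftrightarrow>
     continuous_on {0..T} x \<and>
     continuous_on (simplex2 T) (\<lambda>(s, t). X s t) \<and>
     (\<forall>s t u. 0 \<le> s \<and> s \<le> t \<and> t \<le> u \<and> u \<le> T \<longrightarrow>
        X s u = X s t + X t u + tensor (x t - x s) (x u - x t)) \<and>
     (\<forall>(s, t)\<in>simplex2 T. norm (x t - x s) \<le> \<omega> s t powr (1 / p)) \<and>
     (\<forall>(s, t)\<in>simplex2 T. norm (X s t) \<le> \<omega> s t powr (2 / p)) \<and>
     (\<forall>(s, t)\<in>simplex2 T. (1 / 2) *\<^sub>R (X s t + transpose (X s t)) =
        (1 / 2) *\<^sub>R tensor (x t - x s) (x t - x s))"


section \<open>Rough differential equations\<close>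

text \<open>
  A continuous pair \<open>(y, y\<^sup>\<dagger>)\<close> over \<open>I\<close>.  As \<open>W\<close> is finite-dimensional, continuity of \<open>y\<^sup>\<dagger>\<close> in the
  bundle of linear maps from \<open>W\<close> to the tangent spaces is continuity, for each \<open>w\<close>, of the fibre
  coordinates of \<open>y\<^sup>\<dagger>\<^sub>s w\<close>.
\<close>

definition continuous_pair ::
  "('m::topological_space, 'e::euclidean_space) chart set \<Rightarrow> real set \<Rightarrow> (real \<Rightarrow> 'm) \<Rightarrow>
    (real \<Rightarrow> real^'k \<Rightarrow> ('m, 'e) tvec) \<Rightarrow> bool" where
  "continuous_pair A I y yd \<longleftrightarrow>
     continuous_on I y \<and>
     (\<forall>s\<in>I. (\<forall>w. yd s w \<in> tangent_space A (y s)) \<and>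
        (\<forall>a b w w'. yd s (a *\<^sub>R w + b *\<^sub>R w') = lincomb a (yd s w) b (yd s w'))) \<and>
     (\<forall>w. \<forall>c\<in>A. continuous_on {s\<in>I. y s \<in> cdom c} (\<lambda>s. yd s w c))"

definition linear_vector_fields ::
  "('m::topological_space, 'e::euclidean_space) chart set \<Rightarrow>
    (real^'k \<Rightarrow> 'm \<Rightarrow> ('m, 'e) tvec) \<Rightarrow> bool" where
  "linear_vector_fields A F \<longleftrightarrow> (\<forall>w. smooth_vector_field A (F w)) \<and>
     (\<forall>a b w w' m. F (a *\<^sub>R w + b *\<^sub>R w') m = lincomb a (F w m) b (F w' m))"

definition rde_solution ::
  "('m::topological_space, 'e::euclidean_space) chart set \<Rightarrow> real \<Rightarrow> (real \<Rightarrow> real \<Rightarrow> real) \<Rightarrow>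
    (real \<Rightarrow> real^'k) \<Rightarrow> (real \<Rightarrow> real \<Rightarrow> real^'k^'k) \<Rightarrow>
    (real^'k \<Rightarrow> 'm \<Rightarrow> ('m, 'e) tvec) \<Rightarrow> real set \<Rightarrow> (real \<Rightarrow> 'm) \<Rightarrow>
    (real \<Rightarrow> real^'k \<Rightarrow> ('m, 'e) tvec) \<Rightarrow> bool" where
  "rde_solution A p \<omega> x X F I y yd \<longleftrightarrow>
     (\<forall>s\<in>I. \<forall>w. yd s w = F w (y s)) \<and>
     (\<forall>f. smooth_fun_on A UNIV f \<longrightarrow>
       (\<forall>a b. {a..b} \<subseteq> I \<longrightarrow>
         (\<exists>C. \<exists>\<delta>>0. \<forall>s t. a \<le> s \<and> s \<le> t \<and> t \<le> b \<and> t - s \<le> \<delta> \<longrightarrow>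
           \<bar>f (y t) - f (y s) - lie_deriv A (F (x t - x s)) f (y s)
             - contract (\<lambda>w w'. lie_deriv A (F w) (lie_deriv A (F w') f) (y s)) (X s t)\<bar>
           \<le> C * \<omega> s t powr (3 / p))))"

text \<open>
  \<open>P s t \<approx>\<^sub>3 Q s t\<close> for \<open>a \<le> s \<le> t \<le> b\<close>, \<open>t - s \<le> \<delta>\<close>, where \<open>P s t\<close> and \<open>Q s t\<close> are tangent
  at \<open>y s\<close>.
\<close>

definition approx3 ::
  "('m \<Rightarrow> ('m, 'e::real_vector) tvec \<Rightarrow> ('m, 'e) tvec \<Rightarrow> real) \<Rightarrow> real \<Rightarrow>
    (real \<Rightarrow> real \<Rightarrow> real) \<Rightarrow> (real \<Rightarrow> 'm) \<Rightarrow> real \<Rightarrow> real \<Rightarrow> real \<Rightarrow>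
    (real \<Rightarrow> real \<Rightarrow> ('m, 'e) tvec) \<Rightarrow> (real \<Rightarrow> real \<Rightarrow> ('m, 'e) tvec) \<Rightarrow> bool" where
  "approx3 g p \<omega> y a b \<delta> P Q \<longleftrightarrow>
     (\<exists>C. \<forall>s t. a \<le> s \<and> s \<le> t \<and> t \<le> b \<and> t - s \<le> \<delta> \<longrightarrow>
        metric_norm g (y s) (lincomb 1 (P s t) (-1) (Q s t)) \<le> C * \<omega> s t powr (3 / p))"


section \<open>Independence of the choices made in the definitions\<close>

lemma contract_sum_tensor:
  fixes u v :: "'i \<Rightarrow> real^'k" and \<Xi> :: "real^'k \<Rightarrow> real^'k \<Rightarrow> 'b::real_vector"
  assumes l: "\<And>v. linear (\<lambda>u. \<Xi> u v)" and r: "\<And>u. linear (\<Xi> u)"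
  shows "contract \<Xi> (\<Sum>l\<in>L. tensor (u l) (v l)) = (\<Sum>l\<in>L. \<Xi> (u l) (v l))"
proof -
  have exp: "w = (\<Sum>i\<in>UNIV. w $ i *\<^sub>R axis i 1)" for w :: "real^'k"
    using basis_expansion[of w] by (simp add: scalar_mult_eq_scaleR)
  have one: "\<Xi> a b = (\<Sum>i\<in>UNIV. \<Sum>j\<in>UNIV. (a $ i * b $ j) *\<^sub>R \<Xi> (axis i 1) (axis j 1))" for a b
  proof -
    have "\<Xi> a b = \<Xi> (\<Sum>i\<in>UNIV. a $ i *\<^sub>R axis i 1) (\<Sum>j\<in>UNIV. b $ j *\<^sub>R axis j 1)"
      using exp[of a] exp[of b] by simp
    also have "\<dots> = (\<Sum>i\<in>UNIV. a $ i *\<^sub>R \<Xi> (axis i 1) (\<Sum>j\<in>UNIV. b $ j *\<^sub>R axis j 1))"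
      by (simp add: linear_sum[OF l] linear_scale[OF l])
    also have "\<dots> = (\<Sum>i\<in>UNIV. \<Sum>j\<in>UNIV. (a $ i * b $ j) *\<^sub>R \<Xi> (axis i 1) (axis j 1))"
      by (simp add: linear_sum[OF r] linear_scale[OF r] scaleR_sum_right)
    finally show ?thesis .
  qed
  have "contract \<Xi> (\<Sum>l\<in>L. tensor (u l) (v l)) =
      (\<Sum>i\<in>UNIV. \<Sum>j\<in>UNIV. \<Sum>l\<in>L. (u l $ i * v l $ j) *\<^sub>R \<Xi> (axis i 1) (axis j 1))"
    by (simp add: contract_def tensor_def scaleR_sum_left)
  also have "\<dots> = (\<Sum>i\<in>UNIV. \<Sum>l\<in>L. \<Sum>j\<in>UNIV. (u l $ i * v l $ j) *\<^sub>R \<Xi> (axis i 1) (axis j 1))"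
    by (intro sum.cong refl sum.swap)
  also have "\<dots> = (\<Sum>l\<in>L. \<Sum>i\<in>UNIV. \<Sum>j\<in>UNIV. (u l $ i * v l $ j) *\<^sub>R \<Xi> (axis i 1) (axis j 1))"
    by (rule sum.swap)
  also have "\<dots> = (\<Sum>l\<in>L. \<Xi> (u l) (v l))"
    by (simp add: one[symmetric])
  finally show ?thesis .
qed

lemma dirderiv_eq:
  fixes A :: "('m::{t2_space, second_countable_topology}, 'e::euclidean_space) chart set"
    and f :: "'m \<Rightarrow> 'b::real_normed_vector"
  assumes A: "smooth_atlas A" and c: "c \<in> A" "m \<in> cdom c" and v: "v \<in> tangent_space A m"
    and f: "(f \<circ> cinv c) differentiable (at (cmap c m))"
  shows "dirderiv A f m v = frechet_derivative (f \<circ> cinv c) (at (cmap c m)) (v c)"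
proof -
  define d where "d = (SOME c. c \<in> A \<and> m \<in> cdom c)"
  have d: "d \<in> A" "m \<in> cdom d"
    using someI[of "\<lambda>c. c \<in> A \<and> m \<in> cdom c" c] c by (auto simp: d_def)
  have chart: "is_chart c" "is_chart d"
    using A c d by (auto simp: smooth_atlas_def)
  have inv: "cinv c (cmap c n) = n" if "n \<in> cdom c" for n
    using chart(1) that by (auto simp: is_chart_def homeomorphism_def)
  have invd: "cinv d (cmap d n) = n" if "n \<in> cdom d" for n
    using chart(2) that by (auto simp: is_chart_def homeomorphism_def)
  define S where "S = cmap d ` (cdom c \<inter> cdom d)"
  have "S = (cmap d ` cdom d) \<inter> cinv d -` (cdom c)"
    using invd by (auto simp: S_def)
  moreover have "open (cmap d ` cdom d \<inter> cinv d -` (cdom c))"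
    using chart by (intro continuous_open_preimage) (auto simp: is_chart_def homeomorphism_def)
  ultimately have "open S" by simp
  have "smooth_on S (cmap c \<circ> cinv d)"
    using A c d unfolding smooth_atlas_def S_def by (metis Int_commute)
  then have "Ck_on (Suc 0) S (cmap c \<circ> cinv d)"
    unfolding smooth_on_def by blast
  then have tr: "(cmap c \<circ> cinv d) differentiable (at (cmap d m))"
    using c d by (auto simp: S_def)
  let ?D = "frechet_derivative (cmap c \<circ> cinv d) (at (cmap d m))"
  let ?E = "frechet_derivative (f \<circ> cinv c) (at (cmap c m))"
  have 1: "((cmap c \<circ> cinv d) has_derivative ?D) (at (cmap d m))"
    using tr frechet_derivative_works by blast
  have e: "(cmap c \<circ> cinv d) (cmap d m) = cmap c m"
    using invd[OF d(2)] by simp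
  have "((f \<circ> cinv c) has_derivative ?E) (at ((cmap c \<circ> cinv d) (cmap d m)))"
    unfolding e by (rule f[unfolded frechet_derivative_works])
  from diff_chain_at[OF 1 this]
  have "((f \<circ> cinv c) \<circ> (cmap c \<circ> cinv d) has_derivative ?E \<circ> ?D) (at (cmap d m))" .
  then have "((f \<circ> cinv d) has_derivative ?E \<circ> ?D) (at (cmap d m))"
    by (rule has_derivative_transform_within_open[OF _ \<open>open S\<close>])
       (use c d in \<open>auto simp: S_def inv invd\<close>)
  then have "frechet_derivative (f \<circ> cinv d) (at (cmap d m)) = ?E \<circ> ?D"
    by (rule frechet_derivative_at[symmetric])
  moreover have "v c = ?D (v d)"
    using v c d unfolding tangent_space_def by blast
  ultimately show ?thesis
    by (simp add: dirderiv_def d_def[symmetric])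
qed

end

theory Submission
  imports Defs
begin

text \<open>
  Everything is local near a time \<open>\<tau>\<close>, in a chart around \<open>y\<^sub>\<tau>\<close>.  Write \<open>z\<close> for the coordinates of
  \<open>y\<close>, \<open>h = z\<^sub>t - z\<^sub>s\<close>, and \<open>V\<^sub>w\<close> for those of \<open>F\<^sub>w\<close>.  Both sides of the equivalence amount to
  \<open>h \<approx>\<^sub>3 V\<^sub>x + (DV\<^sub>w\<^sub>'[V\<^sub>w])|\<^sub>X\<close>, the chart estimate.

  For test functions, one direction is Taylor's formula to second order, where the symmetric part of
  \<open>X\<close> turns \<open>D\<^sup>2f[V\<^sub>w, V\<^sub>w\<^sub>']|\<^sub>X\<close> into \<open>1/2 D\<^sup>2f[V\<^sub>x, V\<^sub>x]\<close>; the other tests with the coordinate functions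
  multiplied by a bump function.

  For the gauge, \<open>U(m, m) = I\<close> makes the derivatives of \<open>U\<close> cancel and \<open>\<partial>\<^sub>2\<psi>(m, m) = I\<close> gives
  \<open>\<partial>\<^sub>1\<partial>\<^sub>2\<psi> = - \<partial>\<^sub>2\<partial>\<^sub>2\<psi>\<close> on the diagonal, so the right-hand side is
  \<open>V\<^sub>x + DV\<^sub>w\<^sub>'[V\<^sub>w]|\<^sub>X + 1/2 \<partial>\<^sub>2\<^sup>2\<psi>[V\<^sub>x, V\<^sub>x]\<close> in coordinates, to be compared with
  \<open>\<psi>(z\<^sub>s, z\<^sub>t) = h + 1/2 \<partial>\<^sub>2\<^sup>2\<psi>[h, h] + O(|h|\<^sup>3)\<close>.  Compactness of \<open>[a, b]\<close> makes the local estimates uniform.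
\<close>

section \<open>Calculus of \<open>C\<^sup>k\<close> maps\<close>

text \<open>The chart estimate is the meeting point because both notions become statements about the
  single vector h there. Sizes are counted in powers of \<open>q = \<omega> powr (1 / p)\<close>:
  the first-order term has weight 1, the correction weight 2, and weight 3 is error; surplus powers
  are absorbed by \<open>q 0 T\<close>. The delicate direction leads from the gauge back to the
  chart. Its Taylor remainder is a multiple of |h|^3, but nothing yet says that h has weight 1.
  Continuity of y makes h small, and near the diagonal \<psi> is so close to the increment that |h|
  <= 2 |\<psi>|; this is the missing a priori bound. A second obstacle is the inverse of U inside S,
  which is only a chosen preimage. Its derivative is read off from the linear equation that it
  solves, so matrix inversion is never differentiated. Constants must not depend on s and t. They
  are extracted from a compact convex coordinate ball before any pair of times is fixed, and
  closeness of times is expressed by a filter.\<close>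

abbreviation ddir :: "'a::real_normed_vector \<Rightarrow> ('a \<Rightarrow> 'b::real_normed_vector) \<Rightarrow> 'a \<Rightarrow> 'b" where
  "ddir v f \<equiv> (\<lambda>x. frechet_derivative f (at x) v)"

lemma ddir_eq: "(f has_derivative f') (at x) \<Longrightarrow> ddir v f x = f' v"
  using frechet_derivative_at[of f f' x] by simp

text \<open>By definition \<open>Ck_on (Suc k)\<close> does not mention continuity of
  \<open>f\<close> itself, so the inclusion of the classes has to be proved: the base case is that
  differentiability implies continuity, and above it the claim passes to the derivatives.\<close>

lemma Ck_on_Suc_imp: "Ck_on (Suc k) S f \<Longrightarrow> Ck_on k S f"
proof (induction k arbitrary: f)
  case 0
  then show ?case
    by (auto intro!: continuous_at_imp_continuous_on differentiable_imp_continuous_within)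
next
  case (Suc k)
  have "Ck_on k S (\<lambda>x. frechet_derivative f (at x) v)" for v
    using Suc.prems by (intro Suc.IH) (simp del: Ck_on.simps add: Ck_on.simps(2)[of "Suc k"])
  then show ?case using Suc.prems by simp
qed

lemma Ck_on_continuous: "Ck_on k S f \<Longrightarrow> continuous_on S f"
  by (induction k) (auto dest: Ck_on_Suc_imp simp del: Ck_on.simps(2))

lemma Ck_on_subset: "Ck_on k S f \<Longrightarrow> T \<subseteq> S \<Longrightarrow> Ck_on k T f"
proof (induction k arbitrary: f)
  case 0
  then show ?case by (auto intro: continuous_on_subset)
next
  case (Suc k)
  then show ?case by (simp, blast)
qed

text \<open>Openness is essential: a Frechet derivative at \<open>x\<close> sees the function on a
  whole neighbourhood, so agreement on \<open>S\<close> transfers to derivatives only at interior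
  points.\<close>

lemma Ck_on_cong:
  assumes "open S" "\<And>x. x \<in> S \<Longrightarrow> f x = g x" "Ck_on k S f"
  shows "Ck_on k S g"
  using assms(2,3)
proof (induction k arbitrary: f g)
  case 0
  then show ?case by (metis Ck_on.simps(1) continuous_on_cong)
next
  case (Suc k)
  have d: "f differentiable at x" if "x \<in> S" for x
    using Suc.prems that by simp
  have "g differentiable at x" if "x \<in> S" for x
    using d[OF that] has_derivative_transform_within_open[of f _ x UNIV S g] \<open>open S\<close> that Suc.prems(1)
    unfolding differentiable_def by blast
  moreover have "Ck_on k S (\<lambda>x. frechet_derivative g (at x) v)" for v
  proof (rule Suc.IH)
    show "Ck_on k S (\<lambda>x. frechet_derivative f (at x) v)"
      using Suc.prems by simp
    show "frechet_derivative f (at x) v = frechet_derivative g (at x) v" if "x \<in> S" for x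
      using frechet_derivative_transform_within_open[OF d[OF that] \<open>open S\<close> that Suc.prems(1)]
      by simp
  qed
  ultimately show ?case by simp
qed

text \<open>Differentiability is a pointwise condition; openness serves the continuity at level 0.
  The lemma glues the two local formulas of a function that is cut off inside a chart.\<close>

lemma Ck_on_Un:
  assumes "open S" "open T" "Ck_on k S f" "Ck_on k T f"
  shows "Ck_on k (S \<union> T) f"
  using assms(3,4)
proof (induction k arbitrary: f)
  case 0
  then show ?case using assms by (auto intro: continuous_on_open_Un)
qed auto

lemma Ck_on_const: "Ck_on k S (\<lambda>x. c)"
proof (induction k arbitrary: c)
  case (Suc k)
  show ?case using Suc.IH[of 0] by simp
qed simp

lemma Ck_on_linear:
  assumes "bounded_linear L" "open S" "Ck_on k S f"
  shows "Ck_on k S (\<lambda>x. L (f x))"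
  using assms(3)
proof (induction k arbitrary: f)
  case 0
  then show ?case
    using assms(1) by (auto intro: bounded_linear.continuous_on)
next
  case (Suc k)
  have D: "((\<lambda>x. L (f x)) has_derivative (\<lambda>v. L (frechet_derivative f (at x) v))) (at x)"
    if "x \<in> S" for x
    using Suc.prems that
    by (intro bounded_linear.has_derivative[OF assms(1)]) (simp add: frechet_derivative_works[symmetric])
  have "(\<lambda>x. L (f x)) differentiable at x" if "x \<in> S" for x
    using D[OF that] unfolding differentiable_def by blast
  moreover have "Ck_on k S (\<lambda>x. frechet_derivative (\<lambda>x. L (f x)) (at x) v)" for v
  proof (rule Ck_on_cong[OF assms(2)])
    show "Ck_on k S (\<lambda>x. L (frechet_derivative f (at x) v))"
      using Suc by simp
    show "L (frechet_derivative f (at x) v) = frechet_derivative (\<lambda>x. L (f x)) (at x) v"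
      if "x \<in> S" for x
      by (rule ddir_eq[OF D[OF that], symmetric])
  qed
  ultimately show ?case by simp
qed

lemma Ck_on_add:
  assumes "open S" "Ck_on k S f" "Ck_on k S g"
  shows "Ck_on k S (\<lambda>x. f x + g x)"
  using assms(2,3)
proof (induction k arbitrary: f g)
  case 0
  then show ?case by (auto intro: continuous_on_add)
next
  case (Suc k)
  have D: "((\<lambda>x. f x + g x) has_derivative
      (\<lambda>v. frechet_derivative f (at x) v + frechet_derivative g (at x) v)) (at x)"
    if "x \<in> S" for x
    using Suc.prems that
    by (intro has_derivative_add) (simp_all add: frechet_derivative_works[symmetric])
  have "(\<lambda>x. f x + g x) differentiable at x" if "x \<in> S" for x
    using D[OF that] unfolding differentiable_def by blast
  moreover have "Ck_on k S (\<lambda>x. frechet_derivative (\<lambda>x. f x + g x) (at x) v)" for v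
  proof (rule Ck_on_cong[OF assms(1)])
    show "Ck_on k S (\<lambda>x. frechet_derivative f (at x) v + frechet_derivative g (at x) v)"
      using Suc by simp
    show "frechet_derivative f (at x) v + frechet_derivative g (at x) v =
        frechet_derivative (\<lambda>x. f x + g x) (at x) v" if "x \<in> S" for x
      by (rule ddir_eq[OF D[OF that], symmetric])
  qed
  ultimately show ?case by simp
qed

lemma Ck_on_sum:
  assumes "open S" "finite B" "\<And>b. b \<in> B \<Longrightarrow> Ck_on k S (f b)"
  shows "Ck_on k S (\<lambda>x. \<Sum>b\<in>B. f b x)"
  using assms(2,3)
proof (induction B rule: finite_induct)
  case (insert b B)
  then show ?case
    using Ck_on_add[OF assms(1), of k "f b" "\<lambda>x. \<Sum>b\<in>B. f b x"] by simp
qed (simp add: Ck_on_const)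

lemma Ck_on_scaleR:
  assumes "open S" "Ck_on k S \<alpha>" "Ck_on k S f"
  shows "Ck_on k S (\<lambda>x. \<alpha> x *\<^sub>R f x)"
  using assms(2,3)
proof (induction k arbitrary: \<alpha> f)
  case 0
  then show ?case by (auto intro: continuous_on_scaleR)
next
  case (Suc k)
  let ?D = "\<lambda>x v. \<alpha> x *\<^sub>R frechet_derivative f (at x) v + frechet_derivative \<alpha> (at x) v *\<^sub>R f x"
  have D: "((\<lambda>x. \<alpha> x *\<^sub>R f x) has_derivative ?D x) (at x)" if "x \<in> S" for x
    using Suc.prems that
    by (intro has_derivative_scaleR) (simp_all add: frechet_derivative_works[symmetric])
  have "(\<lambda>x. \<alpha> x *\<^sub>R f x) differentiable at x" if "x \<in> S" for x
    using D[OF that] unfolding differentiable_def by blast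
  moreover have "Ck_on k S (\<lambda>x. frechet_derivative (\<lambda>x. \<alpha> x *\<^sub>R f x) (at x) v)" for v
  proof (rule Ck_on_cong[OF assms(1)])
    show "Ck_on k S (\<lambda>x. ?D x v)"
      using Suc Ck_on_Suc_imp[OF Suc.prems(1)] Ck_on_Suc_imp[OF Suc.prems(2)]
      by (intro Ck_on_add[OF assms(1)]) simp_all
    show "?D x v = frechet_derivative (\<lambda>x. \<alpha> x *\<^sub>R f x) (at x) v" if "x \<in> S" for x
      by (rule ddir_eq[OF D[OF that], symmetric])
  qed
  ultimately show ?case by simp
qed

lemma linear_expand_Basis:
  assumes "linear L"
  shows "L (v::'a::euclidean_space) = (\<Sum>b\<in>Basis. (v \<bullet> b) *\<^sub>R L b)"
proof -
  have "L v = L (\<Sum>b\<in>Basis. (v \<bullet> b) *\<^sub>R b)"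
    by (simp add: euclidean_representation)
  also have "\<dots> = (\<Sum>b\<in>Basis. (v \<bullet> b) *\<^sub>R L b)"
    by (simp only: linear_sum[OF assms] linear_scale[OF assms])
  finally show ?thesis .
qed

text \<open>The chain rule writes the derivative as a finite sum of products of a scalar derivative
  of \<open>f\<close> with a partial derivative of \<open>g\<close> composed with \<open>f\<close>.
  Each factor is one class lower, so the induction closes; \<open>g\<close> is generalised because
  its partial derivatives take its place.\<close>

lemma Ck_on_compose:
  fixes g :: "'b::euclidean_space \<Rightarrow> 'c::real_normed_vector"
  assumes "open S" "f ` S \<subseteq> T" "Ck_on k S f" "Ck_on k T g"
  shows "Ck_on k S (\<lambda>x. g (f x))"
  using assms(2-)
proof (induction k arbitrary: g)
  case 0
  then show ?case by (metis Ck_on.simps(1) continuous_on_compose2)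
next
  case (Suc k)
  let ?D = "\<lambda>x v. \<Sum>b\<in>Basis. (frechet_derivative f (at x) v \<bullet> b) *\<^sub>R frechet_derivative g (at (f x)) b"
  have D: "((\<lambda>x. g (f x)) has_derivative ?D x) (at x)" if "x \<in> S" for x
  proof -
    have f: "(f has_derivative frechet_derivative f (at x)) (at x)"
      using Suc.prems that by (simp add: frechet_derivative_works[symmetric])
    have dg: "g differentiable at (f x)"
      using Suc.prems that by auto
    then have g: "(g has_derivative frechet_derivative g (at (f x))) (at (f x))"
      by (simp add: frechet_derivative_works[symmetric])
    have "((\<lambda>x. g (f x)) has_derivative (\<lambda>v. frechet_derivative g (at (f x)) (frechet_derivative f (at x) v))) (at x)"
      using diff_chain_at[OF f g] by (simp add: o_def)
    moreover have "(\<lambda>v. frechet_derivative g (at (f x)) (frechet_derivative f (at x) v)) = ?D x"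
      by (intro ext linear_expand_Basis linear_frechet_derivative dg)
    ultimately show ?thesis by simp
  qed
  have "(\<lambda>x. g (f x)) differentiable at x" if "x \<in> S" for x
    using D[OF that] unfolding differentiable_def by blast
  moreover have "Ck_on k S (\<lambda>x. frechet_derivative (\<lambda>x. g (f x)) (at x) v)" for v
  proof (rule Ck_on_cong[OF assms(1)])
    show "Ck_on k S (\<lambda>x. ?D x v)"
    proof (intro Ck_on_sum Ck_on_scaleR assms(1) finite_Basis)
      fix b :: 'b
      show "Ck_on k S (\<lambda>x. frechet_derivative f (at x) v \<bullet> b)"
        using Suc.prems by (intro Ck_on_linear[OF bounded_linear_inner_left] assms(1)) simp
      show "Ck_on k S (\<lambda>x. frechet_derivative g (at (f x)) b)"
        using Suc.prems Ck_on_Suc_imp[OF Suc.prems(2)] by (intro Suc.IH) auto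
    qed
    show "?D x v = frechet_derivative (\<lambda>x. g (f x)) (at x) v" if "x \<in> S" for x
      by (rule ddir_eq[OF D[OF that], symmetric])
  qed
  ultimately show ?case by simp
qed

lemma Ck_on_id: "Ck_on k S (\<lambda>x. x)"
  by (cases k) (auto intro: Ck_on_const)

section \<open>Flat functions and smooth cutoffs\<close>

definition exp_flat :: "nat \<Rightarrow> real \<Rightarrow> real" where
  "exp_flat n t = (if t > 0 then (1 / t) ^ n * exp (- (1 / t)) else 0)"

text \<open>Substituting u = 1/t turns the right-hand limit into the decay of u^n exp(-u); to the
  left of 0 the function vanishes.\<close>

lemma exp_flat_tendsto_0: "(exp_flat n \<longlongrightarrow> 0) (at 0)"
proof -
  have "((\<lambda>u. u ^ n / exp u) \<longlongrightarrow> 0) (at_top :: real filter)"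
    by (rule tendsto_power_div_exp_0)
  from filterlim_compose[OF this filterlim_inverse_at_top_right]
  have "((\<lambda>t::real. inverse t ^ n / exp (inverse t)) \<longlongrightarrow> 0) (at_right 0)" .
  then have r: "(exp_flat n \<longlongrightarrow> 0) (at_right 0)"
    by (rule tendsto_cong[THEN iffD1, rotated])
      (auto simp: eventually_at_right_field exp_flat_def exp_minus field_simps intro!: exI[of _ 1])
  have l: "(exp_flat n \<longlongrightarrow> 0) (at_left 0)"
    by (rule tendsto_eventually) (auto simp: eventually_at_left_field exp_flat_def intro!: exI[of _ "-1"])
  show ?thesis
    using l r by (rule filterlim_split_at)
qed

text \<open>The powers \<open>n\<close> are carried along so that the family is closed under
  differentiation up to linear combinations; smoothness of all members then follows by one
  induction. The case \<open>n = 0\<close> is the classical flat function exp(-1/t).\<close>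

lemma exp_flat_DERIV:
  "(exp_flat n has_real_derivative (exp_flat (n + 2) t - n * exp_flat (n + 1) t)) (at t)"
proof (cases t "0::real" rule: linorder_cases)
  case less
  have "((\<lambda>t. 0) has_real_derivative 0) (at t)" by simp
  then have "(exp_flat n has_real_derivative 0) (at t)"
    by (rule has_field_derivative_transform_within_open[where S="{..<0}"])
      (use less in \<open>auto simp: exp_flat_def\<close>)
  then show ?thesis using less by (simp add: exp_flat_def)
next
  case equal
  \<comment> \<open>Dividing by \<open>h\<close> in the difference quotient at 0 just raises the
    power: \<open>exp_flat n h / h = exp_flat (n + 1) h\<close> on both sides of 0.\<close>
  have "((\<lambda>h. exp_flat (Suc n) h) \<longlongrightarrow> 0) (at 0)" by (rule exp_flat_tendsto_0)
  then have "((\<lambda>h. (exp_flat n h) / h) \<longlongrightarrow> 0) (at 0)"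
    by (rule tendsto_cong[THEN iffD1, rotated])
      (auto simp: exp_flat_def intro!: eventuallyI)
  then show ?thesis
    using equal by (simp add: DERIV_def exp_flat_def)
next
  case greater
  define u where "u = 1 / t"
  have "((\<lambda>u. u ^ n * exp (- u)) has_real_derivative
      (n * u ^ (n - 1) * exp (- u) - u ^ n * exp (- u))) (at (1 / t))"
    unfolding u_def by (auto intro!: derivative_eq_intros)
  moreover have "((\<lambda>t. 1 / t) has_real_derivative - u\<^sup>2) (at t)"
    using greater by (auto intro!: derivative_eq_intros simp: u_def power2_eq_square)
  ultimately have "((\<lambda>t. (1 / t) ^ n * exp (- (1 / t))) has_real_derivative
      ((n * u ^ (n - 1) * exp (- u) - u ^ n * exp (- u)) * - u\<^sup>2)) (at t)"
    by (rule DERIV_chain2)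
  moreover have "(n * u ^ (n - 1) * exp (- u) - u ^ n * exp (- u)) * - u\<^sup>2 =
      exp_flat (n + 2) t - n * exp_flat (n + 1) t"
    using greater unfolding exp_flat_def u_def[symmetric]
    by (cases n) (simp_all add: algebra_simps power2_eq_square)
  ultimately have "((\<lambda>t. (1 / t) ^ n * exp (- (1 / t))) has_real_derivative
      (exp_flat (n + 2) t - n * exp_flat (n + 1) t)) (at t)"
    by metis
  then show ?thesis
    by (rule has_field_derivative_transform_within_open[where S="{0<..}"])
      (use greater in \<open>auto simp: exp_flat_def\<close>)
qed

lemma Ck_on_exp_flat: "Ck_on k UNIV (exp_flat n)"
proof (induction k arbitrary: n)
  case 0
  show ?case
    using exp_flat_DERIV by (auto intro!: continuous_at_imp_continuous_on DERIV_isCont)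
next
  case (Suc k)
  have d: "(exp_flat n has_derivative (\<lambda>v. (exp_flat (n + 2) t - n * exp_flat (n + 1) t) * v)) (at t)"
    for t using exp_flat_DERIV[of n t] by (simp add: has_field_derivative_def)
  have "Ck_on k UNIV (\<lambda>t. v *\<^sub>R exp_flat (n + 2) t + (- (v * n)) *\<^sub>R exp_flat (n + 1) t)" for v
    using Suc by (intro Ck_on_add Ck_on_scaleR Ck_on_const) auto
  moreover have "frechet_derivative (exp_flat n) (at t) v =
      v *\<^sub>R exp_flat (n + 2) t + (- (v * n)) *\<^sub>R exp_flat (n + 1) t" for t v
    unfolding frechet_derivative_at[OF d, symmetric] by (simp add: algebra_simps)
  moreover have "exp_flat n differentiable (at t)" for t
    using d differentiable_def by blast
  ultimately show ?case
    by simp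
qed

lemma smooth_bump:
  fixes p :: "'e::euclidean_space"
  assumes "r > 0"
  obtains \<beta> :: "'e \<Rightarrow> real" where "smooth_on UNIV \<beta>" "\<And>z. z \<in> ball p r \<Longrightarrow> \<beta> z = 1"
    "\<And>z. z \<notin> cball p (2 * r) \<Longrightarrow> \<beta> z = 0"
proof
  define s where "s z = (norm (z - p))\<^sup>2 / r\<^sup>2" for z
  \<comment> \<open>Two nested flat functions avoid a quotient. The inner term vanishes for
    \<open>s z \<le> 1\<close>, where the outer one gives \<open>exp 1 * exp (-1) = 1\<close>; it is
    at least 1 once \<open>s z \<ge> 2\<close>, where the outer argument is nonpositive. Outside the
    double ball even \<open>s z \<ge> 4\<close> holds.\<close>
  define \<beta> where "\<beta> z = exp 1 * exp_flat 0 (1 - exp 1 * exp_flat 0 (s z - 1))" for z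
  show "\<beta> z = 1" if "z \<in> ball p r" for z
  proof -
    have "(norm (z - p))\<^sup>2 \<le> r\<^sup>2"
      using that by (intro power_mono) (auto simp: dist_norm norm_minus_commute)
    then have "s z \<le> 1" using assms by (simp add: s_def)
    then show ?thesis by (simp add: \<beta>_def exp_flat_def exp_minus)
  qed
  show "\<beta> z = 0" if "z \<notin> cball p (2 * r)" for z
  proof -
    have "(2 * r)\<^sup>2 \<le> (norm (z - p))\<^sup>2"
      using that assms by (intro power_mono) (auto simp: dist_norm norm_minus_commute)
    then have "s z \<ge> 4" using assms by (simp add: s_def field_simps)
    then have "1 \<le> exp 1 * exp_flat 0 (s z - 1)"
      by (simp add: exp_flat_def exp_add[symmetric] field_simps)
    then show ?thesis by (simp add: \<beta>_def exp_flat_def)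
  qed
  \<comment> \<open>A sum of products of coordinates, to which the closure rules apply; the norm
    itself is not smooth at 0.\<close>
  have *: "s z = (1 / r\<^sup>2) *\<^sub>R (\<Sum>b\<in>Basis. ((z + -p) \<bullet> b) *\<^sub>R ((z + -p) \<bullet> b))" for z
    using euclidean_inner[of "z - p" "z - p"] by (simp add: s_def power2_norm_eq_inner)
  have s: "Ck_on k UNIV s" for k
    unfolding *[abs_def]
    by (intro Ck_on_scaleR Ck_on_sum Ck_on_const Ck_on_linear[OF bounded_linear_inner_left]
        Ck_on_add Ck_on_id) auto
  have "Ck_on k UNIV (\<lambda>z. s z + -1)" for k
    by (intro Ck_on_add s Ck_on_const) simp
  then have 1: "Ck_on k UNIV (\<lambda>z. exp_flat 0 (s z + -1))" for k
    by (rule Ck_on_compose[OF open_UNIV _ _ Ck_on_exp_flat, rotated]) simp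
  have "Ck_on k UNIV (\<lambda>z. 1 + (- exp 1) *\<^sub>R exp_flat 0 (s z + -1))" for k
    by (intro Ck_on_add Ck_on_scaleR 1 Ck_on_const open_UNIV)
  then have 2: "Ck_on k UNIV (\<lambda>z. exp_flat 0 (1 + (- exp 1) *\<^sub>R exp_flat 0 (s z + -1)))" for k
    by (rule Ck_on_compose[OF open_UNIV _ _ Ck_on_exp_flat, rotated]) simp
  have "Ck_on k UNIV (\<lambda>z. exp 1 *\<^sub>R exp_flat 0 (1 + (- exp 1) *\<^sub>R exp_flat 0 (s z + -1)))" for k
    by (intro Ck_on_scaleR 2 Ck_on_const open_UNIV)
  then show "smooth_on UNIV \<beta>"
    by (simp add: smooth_on_def \<beta>_def[abs_def])
qed

section \<open>Expansion and bounds of iterated directional derivatives\<close>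

lemma Ck_on_ddir: "Ck_on (Suc k) S f \<Longrightarrow> Ck_on k S (ddir v f)"
  by simp

lemma Ck_on_has_derivative:
  assumes "Ck_on (Suc k) S f" "x \<in> S"
  shows "(f has_derivative (\<lambda>v. ddir v f x)) (at x)"
  using assms by (simp add: frechet_derivative_works[symmetric])

lemma linear_ddir: "Ck_on (Suc k) S f \<Longrightarrow> x \<in> S \<Longrightarrow> linear (\<lambda>v. ddir v f x)"
  by (rule has_derivative_linear[OF Ck_on_has_derivative])

lemma ddir_expand:
  assumes "Ck_on (Suc k) S f" "x \<in> S"
  shows "ddir v f x = (\<Sum>b\<in>Basis. (v \<bullet> b) *\<^sub>R ddir b f x)"
  by (rule linear_expand_Basis[OF linear_ddir[OF assms]])

text \<open>An expansion valid on an open set can be differentiated term by term. This moves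
  expansions in \<open>Basis\<close> through further derivatives.\<close>

lemma ddir_lincomb:
  assumes "open S" "x \<in> S" "\<And>x. x \<in> S \<Longrightarrow> G x = (\<Sum>b\<in>I. a b *\<^sub>R H b x)"
    "\<And>b. b \<in> I \<Longrightarrow> H b differentiable (at x)"
  shows "ddir w G x = (\<Sum>b\<in>I. a b *\<^sub>R ddir w (H b) x)"
proof -
  have "((\<lambda>x. \<Sum>b\<in>I. a b *\<^sub>R H b x) has_derivative (\<lambda>w. \<Sum>b\<in>I. a b *\<^sub>R ddir w (H b) x)) (at x)"
    using assms(4) by (intro has_derivative_sum has_derivative_scaleR_right)
      (simp add: frechet_derivative_works[symmetric])
  then have "(G has_derivative (\<lambda>w. \<Sum>b\<in>I. a b *\<^sub>R ddir w (H b) x)) (at x)"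
    by (rule has_derivative_transform_within_open[OF _ assms(1,2)]) (simp add: assms(3))
  then show ?thesis by (rule ddir_eq)
qed

lemma ddir2_expand:
  assumes "open S" "Ck_on (Suc (Suc k)) S f" "x \<in> S"
  shows "ddir w (ddir v f) x = (\<Sum>b\<in>Basis. (v \<bullet> b) *\<^sub>R ddir w (ddir b f) x)"
  using assms by (intro ddir_lincomb[where S=S] ddir_expand[where k="Suc k" and S=S]) auto

lemma ddir3_expand:
  assumes "open S" "Ck_on (Suc (Suc (Suc k))) S f" "x \<in> S"
  shows "ddir u (ddir w (ddir v f)) x = (\<Sum>b\<in>Basis. (v \<bullet> b) *\<^sub>R ddir u (ddir w (ddir b f)) x)"
proof (rule ddir_lincomb[where S=S])
  show "ddir w (ddir v f) x = (\<Sum>b\<in>Basis. (v \<bullet> b) *\<^sub>R ddir w (ddir b f) x)" if "x \<in> S" for x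
    by (rule ddir2_expand[OF assms(1,2) that])
qed (use assms in auto)

text \<open>In the outer direction linearity is that of a Frechet derivative; the inner direction
  sits under another derivative, so it goes through the basis expansion.\<close>

lemma linear_ddir_ddir:
  assumes "open S" "Ck_on (Suc (Suc k)) S f" "x \<in> S"
  shows "linear (\<lambda>v. ddir w (ddir v f) x)"
proof (rule linearI)
  show "ddir w (ddir (u + v) f) x = ddir w (ddir u f) x + ddir w (ddir v f) x" for u v
    by (simp only: ddir2_expand[OF assms, of "u + v"] ddir2_expand[OF assms, of u]
        ddir2_expand[OF assms, of v] inner_add_left scaleR_add_left sum.distrib)
  show "ddir w (ddir (r *\<^sub>R v) f) x = r *\<^sub>R ddir w (ddir v f) x" for r v
    by (simp only: ddir2_expand[OF assms, of "r *\<^sub>R v"] ddir2_expand[OF assms, of v]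
        inner_scaleR_left scaleR_sum_right scaleR_scaleR)
qed

lemma norm_sum_Basis_le:
  fixes v :: "'a::euclidean_space"
  assumes "\<And>b. b \<in> Basis \<Longrightarrow> norm (L b) \<le> C b"
  shows "norm (\<Sum>b\<in>Basis. (v \<bullet> b) *\<^sub>R L b) \<le> (\<Sum>b\<in>Basis. C b) * norm v"
proof -
  have "norm (\<Sum>b\<in>Basis. (v \<bullet> b) *\<^sub>R L b) \<le> (\<Sum>b\<in>Basis. C b * norm v)"
  proof (rule sum_norm_le)
    fix b :: 'a assume b: "b \<in> Basis"
    have "norm ((v \<bullet> b) *\<^sub>R L b) \<le> norm v * C b"
      unfolding norm_scaleR using b assms[OF b] Basis_le_norm[OF b, of v] by (intro mult_mono) auto
    then show "norm ((v \<bullet> b) *\<^sub>R L b) \<le> C b * norm v" by (simp add: mult.commute)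
  qed
  then show ?thesis by (simp add: sum_distrib_right)
qed

lemma continuous_on_compact_bound:
  fixes f :: "'a::topological_space \<Rightarrow> 'b::real_normed_vector"
  assumes "compact K" "continuous_on K f"
  obtains B where "B \<ge> 0" "\<And>x. x \<in> K \<Longrightarrow> norm (f x) \<le> B"
proof -
  have "bounded (f ` K)"
    using assms by (intro compact_imp_bounded compact_continuous_image)
  then obtain B where "\<forall>x\<in>f ` K. norm x \<le> B" unfolding bounded_iff by blast
  then show ?thesis by (intro that[of "max 0 B"]) auto
qed

text \<open>Compactness bounds the finitely many partial derivatives along \<open>Basis\<close>;
  uniformity in the direction comes from linearity. The bounds of order two and three apply the
  preceding one to \<open>ddir b f\<close> for each basis vector \<open>b\<close>.\<close>

lemma ddir_bound:
  fixes f :: "'a::euclidean_space \<Rightarrow> 'b::real_normed_vector"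
  assumes "Ck_on (Suc 0) S f" "compact K" "K \<subseteq> S"
  obtains B where "B \<ge> 0" "\<And>x v. x \<in> K \<Longrightarrow> norm (ddir v f x) \<le> B * norm v"
proof -
  have "\<exists>B\<ge>0. \<forall>x\<in>K. norm (ddir b f x) \<le> B" for b
  proof -
    have "continuous_on K (ddir b f)"
      by (rule continuous_on_subset[OF _ assms(3)]) (use assms(1) in simp)
    from continuous_on_compact_bound[OF assms(2) this] show ?thesis by metis
  qed
  then obtain C where C: "\<And>b. C b \<ge> 0" "\<And>b x. x \<in> K \<Longrightarrow> norm (ddir b f x) \<le> C b"
    by metis
  show ?thesis
  proof (rule that[of "sum C Basis"])
    show "norm (ddir v f x) \<le> sum C Basis * norm v" if "x \<in> K" for x v
      unfolding ddir_expand[OF assms(1) subsetD[OF assms(3) that], of v]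
      by (rule norm_sum_Basis_le) (rule C(2)[OF that])
  qed (simp add: C sum_nonneg)
qed

lemma ddir2_bound:
  fixes f :: "'a::euclidean_space \<Rightarrow> 'b::real_normed_vector"
  assumes "open S" "Ck_on (Suc (Suc 0)) S f" "compact K" "K \<subseteq> S"
  obtains B where "B \<ge> 0" "\<And>x v w. x \<in> K \<Longrightarrow> norm (ddir w (ddir v f) x) \<le> B * norm v * norm w"
proof -
  have "\<exists>B\<ge>0. \<forall>x\<in>K. \<forall>w. norm (ddir w (ddir b f) x) \<le> B * norm w" for b
    using ddir_bound[OF Ck_on_ddir[OF assms(2)] assms(3,4)] by metis
  then obtain C where C: "\<And>b. C b \<ge> 0" "\<And>b x w. x \<in> K \<Longrightarrow> norm (ddir w (ddir b f) x) \<le> C b * norm w"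
    by metis
  show ?thesis
  proof (rule that[of "sum C Basis"])
    show "norm (ddir w (ddir v f) x) \<le> sum C Basis * norm v * norm w" if "x \<in> K" for x v w
    proof -
      have "norm (ddir w (ddir v f) x) \<le> (\<Sum>b\<in>Basis. C b * norm w) * norm v"
        unfolding ddir2_expand[OF assms(1,2) subsetD[OF assms(4) that], where v=v and w=w]
        by (rule norm_sum_Basis_le) (rule C(2)[OF that])
      then show ?thesis by (simp add: sum_distrib_right[symmetric] mult_ac)
    qed
  qed (simp add: C sum_nonneg)
qed

lemma ddir3_bound:
  fixes f :: "'a::euclidean_space \<Rightarrow> 'b::real_normed_vector"
  assumes "open S" "Ck_on (Suc (Suc (Suc 0))) S f" "compact K" "K \<subseteq> S"
  obtains B where "B \<ge> 0"
    "\<And>x v w u. x \<in> K \<Longrightarrow> norm (ddir u (ddir w (ddir v f)) x) \<le> B * norm v * norm w * norm u"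
proof -
  have "\<exists>B\<ge>0. \<forall>x\<in>K. \<forall>w u. norm (ddir u (ddir w (ddir b f)) x) \<le> B * norm w * norm u" for b
    using ddir2_bound[OF assms(1) Ck_on_ddir[OF assms(2)] assms(3,4)] by metis
  then obtain C where C: "\<And>b. C b \<ge> 0"
    "\<And>b x w u. x \<in> K \<Longrightarrow> norm (ddir u (ddir w (ddir b f)) x) \<le> C b * norm w * norm u"
    by metis
  show ?thesis
  proof (rule that[of "sum C Basis"])
    show "norm (ddir u (ddir w (ddir v f)) x) \<le> sum C Basis * norm v * norm w * norm u"
      if "x \<in> K" for x v w u
    proof -
      have "norm (ddir u (ddir w (ddir v f)) x) \<le> (\<Sum>b\<in>Basis. C b * norm w * norm u) * norm v"
        unfolding ddir3_expand[OF assms(1,2) subsetD[OF assms(4) that], where v=v and w=w and u=u]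
        by (rule norm_sum_Basis_le) (rule C(2)[OF that])
      then show ?thesis by (simp add: sum_distrib_right[symmetric] mult_ac)
    qed
  qed (simp add: C sum_nonneg)
qed

section \<open>Second-order Taylor expansion\<close>

lemma has_vector_derivative_line:
  assumes "G differentiable (at (p + t *\<^sub>R h))"
  shows "((\<lambda>t. G (p + t *\<^sub>R h)) has_vector_derivative ddir h G (p + t *\<^sub>R h)) (at t within T)"
proof -
  have G: "(G has_derivative (\<lambda>v. ddir v G (p + t *\<^sub>R h))) (at (p + t *\<^sub>R h))"
    using assms by (simp add: frechet_derivative_works[symmetric])
  have "((\<lambda>t. p + t *\<^sub>R h) has_derivative (\<lambda>s. s *\<^sub>R h)) (at t within T)"
    by (auto intro!: derivative_eq_intros)
  from has_derivative_compose[OF this G]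
  have "((\<lambda>t. G (p + t *\<^sub>R h)) has_derivative (\<lambda>s. ddir (s *\<^sub>R h) G (p + t *\<^sub>R h))) (at t within T)" .
  then show ?thesis
    unfolding has_vector_derivative_def
    by (simp add: linear_scale[OF has_derivative_linear[OF G]])
qed

text \<open>Along the segment from \<open>p\<close> to \<open>q\<close> this is Taylor's formula in
  one variable with integral remainder, which also serves vector values, where no mean value form
  exists. Convexity keeps the segment in \<open>K\<close>, where the third derivative is
  bounded.\<close>

lemma taylor3:
  fixes f :: "'a::euclidean_space \<Rightarrow> 'b::banach"
  assumes "open S" "Ck_on 3 S f" "compact K" "convex K" "K \<subseteq> S"
  obtains B where "B \<ge> 0" "\<And>p q. p \<in> K \<Longrightarrow> q \<in> K \<Longrightarrow>
    norm (f q - f p - ddir (q - p) f p - (1 / 2) *\<^sub>R ddir (q - p) (ddir (q - p) f) p)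
      \<le> B * norm (q - p) ^ 3"
proof -
  have C3: "Ck_on (Suc (Suc (Suc 0))) S f" using assms(2) by (simp add: numeral_3_eq_3)
  obtain B where B: "B \<ge> 0"
    "\<And>x v w u. x \<in> K \<Longrightarrow> norm (ddir u (ddir w (ddir v f)) x) \<le> B * norm v * norm w * norm u"
    using ddir3_bound[OF assms(1) C3 assms(3,5)] by metis
  show ?thesis
  proof (rule that[OF B(1)])
    fix p q assume p: "p \<in> K" and q: "q \<in> K"
    define h where "h = q - p"
    define G where "G i = (ddir h ^^ i) f" for i
    define g where "g i t = G i (p + t *\<^sub>R h)" for i t
    have inK: "p + t *\<^sub>R h \<in> K" if "t \<in> {0..1}" for t
    proof -
      have "p + t *\<^sub>R h = (1 - t) *\<^sub>R p + t *\<^sub>R q" by (simp add: h_def algebra_simps)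
      then show ?thesis using convexD_alt[OF assms(4) p q, of t] that by simp
    qed
    have CkG: "Ck_on (3 - i) S (G i)" if "i \<le> 3" for i
      using that unfolding G_def
    proof (induction i)
      case 0 then show ?case using assms(2) by simp
    next
      case (Suc i)
      then have "Ck_on (3 - i) S ((ddir h ^^ i) f)" by simp
      moreover have "3 - i = Suc (3 - Suc i)" using Suc.prems by arith
      ultimately have "Ck_on (Suc (3 - Suc i)) S ((ddir h ^^ i) f)" by (simp only:)
      then show ?case by (simp only: funpow.simps o_def) (rule Ck_on_ddir)
    qed
    have Gd: "G i differentiable (at x)" if "i < 3" "x \<in> S" for i x
    proof -
      have "Ck_on (3 - i) S (G i)" using that CkG[of i] by simp
      moreover have "3 - i = Suc (2 - i)" using that(1) by arith
      ultimately have "Ck_on (Suc (2 - i)) S (G i)" by (simp only:)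
      then show ?thesis using that(2) by simp
    qed
    have der: "(g m has_vector_derivative g (Suc m) t) (at t within {0..1})"
      if "m < 3" "0 \<le> t" "t \<le> 1" for m t
    proof -
      have "G (Suc m) = ddir h (G m)" by (simp add: G_def)
      then show ?thesis
        unfolding g_def using has_vector_derivative_line[of "G m" p t h] Gd[OF that(1)] inK[of t] that assms(5)
        by auto
    qed
    have int: "((\<lambda>x. ((1 - x) ^ (3 - 1) / fact (3 - 1)) *\<^sub>R g 3 x) has_integral
        g 0 1 - (\<Sum>i<3. ((1 - 0) ^ i / fact i) *\<^sub>R g i 0)) {0..1}"
      by (rule Taylor_has_integral[of 3 g "g 0" 0 1]) (auto intro: der)
    have "norm (g 0 1 - (\<Sum>i<3. ((1 - 0) ^ i / fact i) *\<^sub>R g i 0)) \<le> (B * norm h ^ 3) * measure lborel {0..1::real}"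
    proof (rule has_integral_bound_real[OF _ finite.emptyI int])
      fix t :: real assume "t \<in> {0..1} - {}"
      then have t: "0 \<le> t" "t \<le> 1" by auto
      have "g 3 t = ddir h (ddir h (ddir h f)) (p + t *\<^sub>R h)"
        by (simp add: g_def G_def numeral_3_eq_3)
      then have 1: "norm (g 3 t) \<le> B * norm h ^ 3"
        using B(2)[OF inK[of t], of h h h] t by (simp add: power3_eq_cube mult.assoc)
      \<comment> \<open>The kernel is at most 1/2; the cruder 1 keeps the bound of the third
        derivative as the constant.\<close>
      have "(1 - t)^2 / 2 \<le> 1" using t power_le_one[of "1 - t" 2] by simp
      then have "norm (((1 - t) ^ (3 - 1) / fact (3 - 1)) *\<^sub>R g 3 t) \<le> 1 * norm (g 3 t)"
        unfolding norm_scaleR by (intro mult_right_mono) (auto simp: fact_numeral)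
      then show "norm (((1 - t) ^ (3 - 1) / fact (3 - 1)) *\<^sub>R g 3 t) \<le> B * norm h ^ 3"
        using 1 by simp
    qed (use B in simp)
    moreover have "g 0 1 - (\<Sum>i<3. ((1 - 0) ^ i / fact i) *\<^sub>R g i 0) =
        f q - f p - ddir h f p - (1 / 2) *\<^sub>R ddir h (ddir h f) p"
      by (simp add: g_def G_def h_def numeral_3_eq_3 algebra_simps)
    ultimately show "norm (f q - f p - ddir (q - p) f p - (1 / 2) *\<^sub>R ddir (q - p) (ddir (q - p) f) p)
        \<le> B * norm (q - p) ^ 3"
      by (simp add: h_def[symmetric])
  qed
qed

section \<open>Symmetry of second derivatives\<close>

lemma second_difference:
  fixes f :: "'a::euclidean_space \<Rightarrow> real"
  assumes "Ck_on 2 S f" "s > 0"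
    and S: "\<And>\<sigma> \<tau>. 0 \<le> \<sigma> \<Longrightarrow> \<sigma> \<le> s \<Longrightarrow> 0 \<le> \<tau> \<Longrightarrow> \<tau> \<le> s \<Longrightarrow> x + \<sigma> *\<^sub>R u + \<tau> *\<^sub>R v \<in> S"
  obtains \<sigma> \<tau> where "0 \<le> \<sigma>" "\<sigma> \<le> s" "0 \<le> \<tau>" "\<tau> \<le> s"
    "f (x + s *\<^sub>R u + s *\<^sub>R v) - f (x + s *\<^sub>R u) - f (x + s *\<^sub>R v) + f x =
      s * (s * ddir v (ddir u f) (x + \<sigma> *\<^sub>R u + \<tau> *\<^sub>R v))"
proof -
  have C2: "Ck_on (Suc (Suc 0)) S f" using assms(1) by (simp add: numeral_2_eq_2)
  define \<phi> where "\<phi> \<sigma> = f (x + \<sigma> *\<^sub>R u + s *\<^sub>R v) - f (x + \<sigma> *\<^sub>R u)" for \<sigma>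
  have line: "DERIV (\<lambda>t. G (p + t *\<^sub>R h)) t :> ddir h G (p + t *\<^sub>R h)"
    if "Ck_on (Suc 0) S G" "p + t *\<^sub>R h \<in> S" for G :: "'a \<Rightarrow> real" and p h t
    using has_vector_derivative_line[of G p t h UNIV] that
    by (simp add: has_real_derivative_iff_has_vector_derivative)
  have "DERIV \<phi> \<sigma> :> ddir u f (x + \<sigma> *\<^sub>R u + s *\<^sub>R v) - ddir u f (x + \<sigma> *\<^sub>R u)"
    if "0 \<le> \<sigma>" "\<sigma> \<le> s" for \<sigma>
    unfolding \<phi>_def
    using line[OF Ck_on_Suc_imp[OF C2], of "x + s *\<^sub>R v" \<sigma> u] line[OF Ck_on_Suc_imp[OF C2], of x \<sigma> u]
      S[of \<sigma> s] S[of \<sigma> 0] that assms(2)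
    by (intro DERIV_diff) (simp_all add: add_ac)
  from MVT2[OF assms(2) this]
  obtain \<sigma> where \<sigma>: "0 < \<sigma>" "\<sigma> < s"
    "\<phi> s - \<phi> 0 = (s - 0) * (ddir u f (x + \<sigma> *\<^sub>R u + s *\<^sub>R v) - ddir u f (x + \<sigma> *\<^sub>R u))"
    by auto
  have "DERIV (\<lambda>\<tau>. ddir u f ((x + \<sigma> *\<^sub>R u) + \<tau> *\<^sub>R v)) \<tau> :> ddir v (ddir u f) (x + \<sigma> *\<^sub>R u + \<tau> *\<^sub>R v)"
    if "0 \<le> \<tau>" "\<tau> \<le> s" for \<tau>
    by (rule line[OF Ck_on_ddir[OF C2]]) (use S[of \<sigma> \<tau>] that \<sigma> in simp)
  from MVT2[OF assms(2) this]
  obtain \<tau> where \<tau>: "0 < \<tau>" "\<tau> < s" "ddir u f (x + \<sigma> *\<^sub>R u + s *\<^sub>R v) - ddir u f (x + \<sigma> *\<^sub>R u) =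
      s * ddir v (ddir u f) (x + \<sigma> *\<^sub>R u + \<tau> *\<^sub>R v)"
    by auto
  show ?thesis
    by (rule that[of \<sigma> \<tau>]) (use \<sigma> \<tau> in \<open>auto simp: \<phi>_def\<close>)
qed

text \<open>The second difference is symmetric in \<open>u\<close> and \<open>v\<close>, while two
  applications of the mean value theorem, in either order, express it by one mixed derivative or the
  other at some point of a small parallelogram. Hence the two take a common value near
  \<open>x\<close>, and continuity excludes a gap at \<open>x\<close>.\<close>

lemma ddir_commute_real:
  fixes f :: "'a::euclidean_space \<Rightarrow> real"
  assumes "open S" "Ck_on 2 S f" "x \<in> S"
  shows "ddir u (ddir v f) x = ddir v (ddir u f) x"
proof (rule ccontr)
  let ?P = "ddir u (ddir v f)" and ?Q = "ddir v (ddir u f)"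
  assume ne: "?P x \<noteq> ?Q x"
  \<comment> \<open>Half the gap: a common value within \<open>e\<close> of both \<open>?P x\<close>
    and \<open>?Q x\<close> would make the gap less than \<open>2 * e\<close>.\<close>
  define e where "e = \<bar>?P x - ?Q x\<bar> / 2"
  have e: "e > 0" using ne by (simp add: e_def)
  have C2: "Ck_on (Suc (Suc 0)) S f" using assms(2) by (simp add: numeral_2_eq_2)
  have "continuous_on S ?P" "continuous_on S ?Q"
    using C2 by auto
  then have "isCont ?P x" "isCont ?Q x"
    using assms continuous_on_eq_continuous_at by blast+
  then obtain d1 d2 where d: "d1 > 0" "\<And>y. dist y x < d1 \<Longrightarrow> dist (?P y) (?P x) < e"
    "d2 > 0" "\<And>y. dist y x < d2 \<Longrightarrow> dist (?Q y) (?Q x) < e"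
    using e unfolding continuous_at_eps_delta by metis
  obtain r where r: "r > 0" "ball x r \<subseteq> S" using assms(1,3) openE by blast
  define d where "d = min r (min d1 d2)"
  have dpos: "d > 0" using d r by (simp add: d_def)
  define N where "N = norm u + norm v + 1"
  have N: "N > 0" by (simp add: N_def add_nonneg_pos)
  \<comment> \<open>The parallelogram then reaches at most \<open>s * N = d / 2\<close> from
    \<open>x\<close>; the summand 1 in \<open>N\<close> guards against
    \<open>u = v = 0\<close>.\<close>
  define s where "s = d / (2 * N)"
  have s: "s > 0" using dpos N by (simp add: s_def)
  have near: "dist (x + \<sigma> *\<^sub>R a + \<tau> *\<^sub>R b) x < d"
    if "0 \<le> \<sigma>" "\<sigma> \<le> s" "0 \<le> \<tau>" "\<tau> \<le> s" "norm a + norm b + 1 = N" for \<sigma> \<tau> a b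
  proof -
    have "dist (x + \<sigma> *\<^sub>R a + \<tau> *\<^sub>R b) x = norm (\<sigma> *\<^sub>R a + \<tau> *\<^sub>R b)"
      by (simp add: dist_norm)
    also have "\<dots> \<le> \<sigma> * norm a + \<tau> * norm b"
      using norm_triangle_ineq[of "\<sigma> *\<^sub>R a" "\<tau> *\<^sub>R b"] that by simp
    also have "\<dots> \<le> s * norm a + s * norm b"
      using that by (intro add_mono mult_right_mono) auto
    also have "\<dots> \<le> s * N"
      using s that(5)[symmetric] by (simp add: algebra_simps)
    also have "\<dots> < d" using N dpos by (simp add: s_def)
    finally show ?thesis .
  qed
  have inS: "x + \<sigma> *\<^sub>R a + \<tau> *\<^sub>R b \<in> S"
    if "0 \<le> \<sigma>" "\<sigma> \<le> s" "0 \<le> \<tau>" "\<tau> \<le> s" "norm a + norm b + 1 = N" for \<sigma> \<tau> a b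
    using near[OF that] r(2) by (auto simp: d_def dist_commute)
  have N': "norm u + norm v + 1 = N" "norm v + norm u + 1 = N" by (simp_all add: N_def)
  obtain \<sigma> \<tau> where 1: "0 \<le> \<sigma>" "\<sigma> \<le> s" "0 \<le> \<tau>" "\<tau> \<le> s"
    "f (x + s *\<^sub>R u + s *\<^sub>R v) - f (x + s *\<^sub>R u) - f (x + s *\<^sub>R v) + f x =
      s * (s * ?Q (x + \<sigma> *\<^sub>R u + \<tau> *\<^sub>R v))"
    by (rule second_difference[OF assms(2) s inS[OF _ _ _ _ N'(1)]])
  obtain \<sigma>' \<tau>' where 2: "0 \<le> \<sigma>'" "\<sigma>' \<le> s" "0 \<le> \<tau>'" "\<tau>' \<le> s"
    "f (x + s *\<^sub>R v + s *\<^sub>R u) - f (x + s *\<^sub>R v) - f (x + s *\<^sub>R u) + f x =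
      s * (s * ?P (x + \<sigma>' *\<^sub>R v + \<tau>' *\<^sub>R u))"
    by (rule second_difference[OF assms(2) s inS[OF _ _ _ _ N'(2)]])
  have "x + s *\<^sub>R v + s *\<^sub>R u = x + s *\<^sub>R u + s *\<^sub>R v" by (simp add: add_ac)
  then have "f (x + s *\<^sub>R v + s *\<^sub>R u) = f (x + s *\<^sub>R u + s *\<^sub>R v)" by (rule arg_cong)
  then have "s * (s * ?P (x + \<sigma>' *\<^sub>R v + \<tau>' *\<^sub>R u)) = s * (s * ?Q (x + \<sigma> *\<^sub>R u + \<tau> *\<^sub>R v))"
    using 1(5) 2(5) by linarith
  then have eq: "?P (x + \<sigma>' *\<^sub>R v + \<tau>' *\<^sub>R u) = ?Q (x + \<sigma> *\<^sub>R u + \<tau> *\<^sub>R v)"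
    using s by simp
  have "dist (?P (x + \<sigma>' *\<^sub>R v + \<tau>' *\<^sub>R u)) (?P x) < e"
    by (rule d(2)) (use near[OF 2(1-4) N'(2)] in \<open>simp add: d_def\<close>)
  moreover have "dist (?Q (x + \<sigma> *\<^sub>R u + \<tau> *\<^sub>R v)) (?Q x) < e"
    by (rule d(4)) (use near[OF 1(1-4) N'(1)] in \<open>simp add: d_def\<close>)
  ultimately show False
    unfolding eq e_def dist_real_def by argo
qed

lemma ddir_bounded_linear:
  assumes "bounded_linear L" "f differentiable (at x)"
  shows "ddir v (\<lambda>x. L (f x)) x = L (ddir v f x)"
proof -
  have "((\<lambda>x. L (f x)) has_derivative (\<lambda>v. L (ddir v f x))) (at x)"
    by (rule bounded_linear.has_derivative[OF assms(1)])
      (use assms(2) in \<open>simp add: frechet_derivative_works[symmetric]\<close>)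
  then show ?thesis by (rule ddir_eq)
qed

lemma ddir2_bounded_linear:
  assumes "open S" "bounded_linear L" "Ck_on (Suc (Suc 0)) S f" "x \<in> S"
  shows "ddir u (ddir v (\<lambda>x. L (f x))) x = L (ddir u (ddir v f) x)"
proof -
  have "ddir u (ddir v (\<lambda>x. L (f x))) x = ddir u (\<lambda>x. L (ddir v f x)) x"
  proof (rule fun_cong[OF frechet_derivative_transform_within_open[OF _ assms(1,4)]])
    have "Ck_on (Suc (Suc 0)) S (\<lambda>x. L (f x))"
      by (rule Ck_on_linear[OF assms(2,1,3)])
    then show "ddir v (\<lambda>x. L (f x)) differentiable (at x)" using assms(4) by simp
    show "ddir v (\<lambda>x. L (f x)) x = L (ddir v f x)" if "x \<in> S" for x
      by (rule ddir_bounded_linear[OF assms(2)]) (use assms(3) that in simp)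
  qed
  also have "\<dots> = L (ddir u (ddir v f) x)"
    by (rule ddir_bounded_linear[OF assms(2)]) (use assms(3,4) in simp)
  finally show ?thesis .
qed

text \<open>By components, since the mean value theorem behind the real case has no vector-valued
  form.\<close>

lemma ddir_commute:
  fixes f :: "'a::euclidean_space \<Rightarrow> 'b::euclidean_space"
  assumes "open S" "Ck_on 2 S f" "x \<in> S"
  shows "ddir u (ddir v f) x = ddir v (ddir u f) x"
proof (rule euclidean_eqI)
  fix b :: 'b
  have C2: "Ck_on (Suc (Suc 0)) S f" using assms(2) by (simp add: numeral_2_eq_2)
  have "ddir u (ddir v (\<lambda>x. f x \<bullet> b)) x = ddir v (ddir u (\<lambda>x. f x \<bullet> b)) x"
    by (rule ddir_commute_real[OF assms(1) Ck_on_linear[OF bounded_linear_inner_left assms(1,2)] assms(3)])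
  then show "ddir u (ddir v f) x \<bullet> b = ddir v (ddir u f) x \<bullet> b"
    by (simp only: ddir2_bounded_linear[OF assms(1) bounded_linear_inner_left C2 assms(3)])
qed

section \<open>Differentiating families of linear maps\<close>

lemma has_derivative_apply:
  fixes L :: "'a::real_normed_vector \<Rightarrow> 'e::euclidean_space \<Rightarrow> 'b::real_normed_vector"
  assumes "open S" "x \<in> S" "\<And>x. x \<in> S \<Longrightarrow> linear (L x)"
    "\<And>b. b \<in> Basis \<Longrightarrow> (\<lambda>x. L x b) differentiable (at x)"
    "(V has_derivative V') (at x)"
  shows "((\<lambda>x. L x (V x)) has_derivative (\<lambda>h. L x (V' h) + ddir h (\<lambda>z. L z (V x)) x)) (at x)"
proof -
  \<comment> \<open>\<open>L\<close> is known only through its columns \<open>L x b\<close>, so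
    \<open>L z (V z)\<close> is written in coordinates and the ordinary product rule is applied to
    each summand.\<close>
  have "((\<lambda>z. \<Sum>b\<in>Basis. (V z \<bullet> b) *\<^sub>R L z b) has_derivative
      (\<lambda>h. \<Sum>b\<in>Basis. ((V x \<bullet> b) *\<^sub>R ddir h (\<lambda>z. L z b) x + (V' h \<bullet> b) *\<^sub>R L x b))) (at x)"
    using assms(4,5) by (intro has_derivative_sum has_derivative_scaleR has_derivative_inner_left)
      (simp_all add: frechet_derivative_works[symmetric])
  then have "((\<lambda>z. L z (V z)) has_derivative
      (\<lambda>h. \<Sum>b\<in>Basis. ((V x \<bullet> b) *\<^sub>R ddir h (\<lambda>z. L z b) x + (V' h \<bullet> b) *\<^sub>R L x b))) (at x)"
    by (rule has_derivative_transform_within_open[OF _ assms(1,2)])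
      (rule linear_expand_Basis[OF assms(3), symmetric])
  moreover have "(\<Sum>b\<in>Basis. ((V x \<bullet> b) *\<^sub>R ddir h (\<lambda>z. L z b) x + (V' h \<bullet> b) *\<^sub>R L x b)) =
      L x (V' h) + ddir h (\<lambda>z. L z (V x)) x" for h
  proof -
    have "ddir h (\<lambda>z. L z (V x)) x = (\<Sum>b\<in>Basis. (V x \<bullet> b) *\<^sub>R ddir h (\<lambda>z. L z b) x)"
      by (rule ddir_lincomb[OF assms(1,2)]) (use assms(4) in \<open>auto intro: linear_expand_Basis[OF assms(3)]\<close>)
    then show ?thesis
      using linear_expand_Basis[OF assms(3)[OF assms(2)], of "V' h"]
      by (simp only: sum.distrib add.commute)
  qed
  ultimately show ?thesis by simp
qed

text \<open>The product rule survives with \<open>\<alpha>\<close> merely continuous because its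
  derivative would be multiplied by \<open>\<beta> x = 0\<close>. This serves for a solution of a
  linear system that is not yet known to be differentiable.\<close>

lemma has_derivative_scaleR_zero:
  fixes \<beta> :: "'a::real_normed_vector \<Rightarrow> 'b::real_normed_vector"
  assumes "isCont \<alpha> x" "(\<beta> has_derivative \<beta>') (at x)" "\<beta> x = 0"
  shows "((\<lambda>z. \<alpha> z *\<^sub>R \<beta> z) has_derivative (\<lambda>h. \<alpha> x *\<^sub>R \<beta>' h)) (at x)"
proof -
  have bl: "bounded_linear \<beta>'" by (rule has_derivative_bounded_linear[OF assms(2)])
  obtain K where K: "K > 0" "\<And>h. norm (\<beta>' h) \<le> norm h * K"
    using bounded_linear.pos_bounded[OF bl] by blast
  show ?thesis
    unfolding has_derivative_at_alt
  proof (intro conjI allI impI)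
    show "bounded_linear (\<lambda>h. \<alpha> x *\<^sub>R \<beta>' h)"
      by (intro bounded_linear_const_scaleR bl)
    fix e :: real assume e: "e > 0"
    define A where "A = \<bar>\<alpha> x\<bar> + 1"
    have A: "A > 0" by (simp add: A_def add_nonneg_pos)
    obtain d1 where d1: "d1 > 0"
      "\<And>z. norm (z - x) < d1 \<Longrightarrow> norm (\<beta> z - \<beta> x - \<beta>' (z - x)) \<le> e / (2 * A) * norm (z - x)"
      using assms(2) e A unfolding has_derivative_at_alt
      by (metis (no_types, lifting) divide_pos_pos mult_pos_pos zero_less_numeral)
    \<comment> \<open>The error splits into \<open>\<alpha> z\<close> times the remainder of
      \<open>\<beta>\<close> and the variation of \<open>\<alpha>\<close> times
      \<open>\<beta>'\<close>; each gets half of \<open>e\<close>. The cap 1 keeps the modulus of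
      \<open>\<alpha> z\<close> below \<open>A\<close>.\<close>
    define \<epsilon> where "\<epsilon> = min 1 (e / (2 * K))"
    have \<epsilon>: "\<epsilon> > 0" using e K by (simp add: \<epsilon>_def)
    obtain d2 where d2: "d2 > 0" "\<And>z. dist z x < d2 \<Longrightarrow> dist (\<alpha> z) (\<alpha> x) < \<epsilon>"
      using assms(1) \<epsilon> unfolding continuous_at_eps_delta by metis
    show "\<exists>d>0. \<forall>z. norm (z - x) < d \<longrightarrow>
        norm (\<alpha> z *\<^sub>R \<beta> z - \<alpha> x *\<^sub>R \<beta> x - \<alpha> x *\<^sub>R \<beta>' (z - x)) \<le> e * norm (z - x)"
    proof (intro exI[of _ "min d1 d2"] conjI allI impI)
      fix z assume z: "norm (z - x) < min d1 d2"
      have a: "\<bar>\<alpha> z - \<alpha> x\<bar> < \<epsilon>" using d2(2)[of z] z by (simp add: dist_norm)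
      then have "\<bar>\<alpha> z - \<alpha> x\<bar> < 1" by (simp add: \<epsilon>_def)
      then have az: "\<bar>\<alpha> z\<bar> \<le> A" unfolding A_def by linarith
      have "\<alpha> z *\<^sub>R \<beta> z - \<alpha> x *\<^sub>R \<beta> x - \<alpha> x *\<^sub>R \<beta>' (z - x) =
          \<alpha> z *\<^sub>R (\<beta> z - \<beta> x - \<beta>' (z - x)) + (\<alpha> z - \<alpha> x) *\<^sub>R \<beta>' (z - x)"
        by (simp add: assms(3) algebra_simps)
      also have "norm \<dots> \<le> \<bar>\<alpha> z\<bar> * norm (\<beta> z - \<beta> x - \<beta>' (z - x)) + \<bar>\<alpha> z - \<alpha> x\<bar> * norm (\<beta>' (z - x))"
        by (metis norm_scaleR norm_triangle_ineq)
      also have "\<dots> \<le> A * (e / (2 * A) * norm (z - x)) + (e / (2 * K)) * (norm (z - x) * K)"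
        using az d1(2)[of z] K(2)[of "z - x"] a z A e K(1)
        by (intro add_mono mult_mono) (auto simp: \<epsilon>_def)
      also have "\<dots> = e * norm (z - x)" using A K by (simp add: field_simps)
      finally show "norm (\<alpha> z *\<^sub>R \<beta> z - \<alpha> x *\<^sub>R \<beta> x - \<alpha> x *\<^sub>R \<beta>' (z - x)) \<le> e * norm (z - x)" .
    qed (use d1 d2 in simp)
  qed
qed

lemma isCont_nhds: "isCont f x \<longleftrightarrow> (f \<longlongrightarrow> f x) (nhds x)"
  by (simp only: isCont_def tendsto_at_iff_tendsto_nhds)

text \<open>The sum of the column errors bounds the operator norm of the difference from the
  identity, so continuity of finitely many columns is enough.\<close>

lemma near_identity:
  fixes Q :: "'a::t2_space \<Rightarrow> 'e::euclidean_space \<Rightarrow> 'e"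
  assumes "open S" "x \<in> S" "\<And>z. z \<in> S \<Longrightarrow> linear (Q z)"
    "\<And>b. b \<in> Basis \<Longrightarrow> isCont (\<lambda>z. Q z b) x" "\<And>e. Q x e = e" "\<epsilon> > 0"
  shows "\<forall>\<^sub>F z in nhds x. z \<in> S \<and> (\<forall>e. norm (Q z e - e) \<le> \<epsilon> * norm e)"
proof -
  have "((\<lambda>z. \<Sum>b\<in>Basis. norm (Q z b - b)) \<longlongrightarrow> (\<Sum>b\<in>Basis. norm (Q x b - b))) (nhds x)"
    using assms(4) by (intro tendsto_sum tendsto_norm tendsto_diff tendsto_const)
      (simp add: isCont_nhds)
  then have "((\<lambda>z. \<Sum>b\<in>Basis. norm (Q z b - b)) \<longlongrightarrow> 0) (nhds x)"
    by (simp add: assms(5))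
  then have "\<forall>\<^sub>F z in nhds x. (\<Sum>b\<in>Basis. norm (Q z b - b)) < \<epsilon>"
    using assms(6) by (rule order_tendstoD)
  moreover have "\<forall>\<^sub>F z in nhds x. z \<in> S"
    using assms(1,2) by (rule eventually_nhds_in_open)
  ultimately show ?thesis
  proof eventually_elim
    case (elim z)
    have "norm (Q z e - e) \<le> \<epsilon> * norm e" for e
    proof -
      have "linear (\<lambda>e. Q z e - e)"
        using assms(3)[OF elim(2)] by (intro linear_compose_sub linear_ident)
      from linear_expand_Basis[OF this, of e]
      have "norm (Q z e - e) \<le> (\<Sum>b\<in>Basis. norm (Q z b - b)) * norm e"
        using norm_sum_Basis_le[of "\<lambda>b. Q z b - b" "\<lambda>b. norm (Q z b - b)" e] by simp
      also have "\<dots> \<le> \<epsilon> * norm e"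
        using elim(1) by (intro mult_right_mono) auto
      finally show ?thesis .
    qed
    then show ?case using elim(2) by blast
  qed
qed

text \<open>Written as \<open>G = B - (Q - I) G\<close>, the equation multiplies the unknown by
  columns of \<open>Q - I\<close>, which vanish at \<open>x\<close>; so continuity of
  \<open>G\<close> already yields its derivative. This replaces differentiating an inverse
  matrix.\<close>

lemma has_derivative_solution:
  fixes Q :: "'a::real_normed_vector \<Rightarrow> 'e::euclidean_space \<Rightarrow> 'e"
  assumes "open S" "x \<in> S" "\<And>z. z \<in> S \<Longrightarrow> linear (Q z)"
    "\<And>b. b \<in> Basis \<Longrightarrow> (\<lambda>z. Q z b) differentiable (at x)" "\<And>e. Q x e = e"
    "(B has_derivative B') (at x)" "\<And>z. z \<in> S \<Longrightarrow> Q z (G z) = B z"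
  shows "(G has_derivative (\<lambda>h. B' h - ddir h (\<lambda>z. Q z (B x)) x)) (at x)"
proof -
  have Gx: "G x = B x" using assms(5)[of "G x"] assms(7)[OF assms(2)] by simp
  have cont: "isCont (\<lambda>z. Q z b) x" if "b \<in> Basis" for b
    using assms(4)[OF that] by (rule differentiable_imp_continuous_within)
  have Bc: "(B \<longlongrightarrow> B x) (nhds x)"
    using has_derivative_continuous[OF assms(6)] by (simp add: isCont_nhds)
  have nhB: "\<forall>\<^sub>F z in nhds x. norm (B z) < norm (B x) + 1"
    using tendsto_norm[OF Bc] by (rule order_tendstoD) simp
  have GB: "((\<lambda>z. G z - B z) \<longlongrightarrow> 0) (nhds x)"
  proof (rule tendstoI)
    fix e :: real assume e: "e > 0"
    \<comment> \<open>With \<open>\<epsilon> \<le> 1 / 2\<close> the equation gives |G| <= 2 |B|,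
      and then |G - B| <= 2 \<epsilon> |B|. Near \<open>x\<close> the norm of \<open>B\<close> is
      below \<open>norm (B x) + 1\<close>, so the factor 4 leaves \<open>e / 2\<close>.\<close>
    define \<epsilon> where "\<epsilon> = min (1 / 2) (e / (4 * (norm (B x) + 1)))"
    have p: "norm (B x) + 1 > 0" by (simp add: add_nonneg_pos)
    have \<epsilon>: "\<epsilon> > 0" using e p by (simp add: \<epsilon>_def)
    have "\<forall>\<^sub>F z in nhds x. z \<in> S \<and> (\<forall>e. norm (Q z e - e) \<le> \<epsilon> * norm e)"
      by (rule near_identity[OF assms(1,2)]) (use assms(3,5) cont \<epsilon> in auto)
    with nhB show "\<forall>\<^sub>F z in nhds x. dist (G z - B z) 0 < e"
    proof eventually_elim
      case (elim z)
      have 1: "norm (G z - B z) \<le> \<epsilon> * norm (G z)"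
        using elim(2) assms(7)[of z] by (metis norm_minus_commute)
      also have "\<dots> \<le> 1 / 2 * norm (G z)"
        unfolding \<epsilon>_def by (intro mult_right_mono min.cobounded1 norm_ge_zero)
      finally have "norm (G z) \<le> 2 * norm (B z)"
        using norm_triangle_ineq2[of "G z" "B z"] by linarith
      then have "\<epsilon> * norm (G z) \<le> (e / (4 * (norm (B x) + 1))) * (2 * (norm (B x) + 1))"
        using elim(1) e p unfolding \<epsilon>_def by (intro mult_mono min.cobounded2) auto
      also have "\<dots> = e / 2" using p by (simp add: field_simps)
      also have "\<dots> < e" using e by simp
      finally show ?case using 1 by simp
    qed
  qed
  have "((\<lambda>z. (G z - B z) + B z) \<longlongrightarrow> 0 + B x) (nhds x)"
    by (intro tendsto_add GB Bc)
  then have Gc: "isCont G x"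
    by (simp add: isCont_nhds Gx)
  have d: "((\<lambda>z. Q z b - b) has_derivative (\<lambda>h. ddir h (\<lambda>z. Q z b) x)) (at x)" if "b \<in> Basis" for b
    using assms(4)[OF that] by (auto intro!: derivative_eq_intros simp: frechet_derivative_works[symmetric])
  have "((\<lambda>z. B z - (\<Sum>b\<in>Basis. (G z \<bullet> b) *\<^sub>R (Q z b - b))) has_derivative
      (\<lambda>h. B' h - (\<Sum>b\<in>Basis. (G x \<bullet> b) *\<^sub>R ddir h (\<lambda>z. Q z b) x))) (at x)"
    by (intro has_derivative_diff has_derivative_sum has_derivative_scaleR_zero d assms(6))
      (auto intro: Gc continuous_intros simp: assms(5))
  then have "(G has_derivative (\<lambda>h. B' h - (\<Sum>b\<in>Basis. (G x \<bullet> b) *\<^sub>R ddir h (\<lambda>z. Q z b) x))) (at x)"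
  proof (rule has_derivative_transform_within_open[OF _ assms(1,2)])
    fix z assume z: "z \<in> S"
    have "linear (\<lambda>e. Q z e - e)"
      using assms(3)[OF z] by (intro linear_compose_sub linear_ident)
    from linear_expand_Basis[OF this, of "G z"]
    show "B z - (\<Sum>b\<in>Basis. (G z \<bullet> b) *\<^sub>R (Q z b - b)) = G z"
      using assms(7)[OF z] by (simp add: algebra_simps)
  qed
  moreover have "ddir h (\<lambda>z. Q z (B x)) x = (\<Sum>b\<in>Basis. (G x \<bullet> b) *\<^sub>R ddir h (\<lambda>z. Q z b) x)" for h
    unfolding Gx
    by (rule ddir_lincomb[OF assms(1,2)]) (use assms(4) in \<open>auto intro: linear_expand_Basis[OF assms(3)]\<close>)
  ultimately show ?thesis by simp
qed

section \<open>Tangent vectors in charts\<close>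

lemma Ck_on_differentiable: "Ck_on (Suc k) S f \<Longrightarrow> x \<in> S \<Longrightarrow> f differentiable (at x)"
  by simp

context
  fixes A :: "('m::{t2_space, second_countable_topology}, 'e::euclidean_space) chart set"
  assumes A: "smooth_atlas A"
begin

lemma atlas_chart: "c \<in> A \<Longrightarrow> is_chart c"
  using A by (simp add: smooth_atlas_def)

lemma atlas_cover: "\<exists>c\<in>A. m \<in> cdom c"
  using A unfolding smooth_atlas_def by blast

lemma open_cdom: "c \<in> A \<Longrightarrow> open (cdom c)"
  using atlas_chart by (simp add: is_chart_def)

lemma open_cimage: "c \<in> A \<Longrightarrow> open (cmap c ` cdom c)"
  using atlas_chart by (simp add: is_chart_def)

lemma cinv_cmap [simp]: "c \<in> A \<Longrightarrow> n \<in> cdom c \<Longrightarrow> cinv c (cmap c n) = n"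
  using atlas_chart[of c] by (simp add: is_chart_def homeomorphism_def)

lemma cmap_cinv: "c \<in> A \<Longrightarrow> z \<in> cmap c ` cdom c \<Longrightarrow> cmap c (cinv c z) = z"
  using atlas_chart[of c] by (auto simp: is_chart_def homeomorphism_def)

lemma cinv_in_cdom: "c \<in> A \<Longrightarrow> z \<in> cmap c ` cdom c \<Longrightarrow> cinv c z \<in> cdom c"
  by auto

lemma continuous_cmap: "c \<in> A \<Longrightarrow> continuous_on (cdom c) (cmap c)"
  using atlas_chart[of c] by (simp add: is_chart_def homeomorphism_def)

lemma continuous_cinv: "c \<in> A \<Longrightarrow> continuous_on (cmap c ` cdom c) (cinv c)"
  using atlas_chart[of c] by (simp add: is_chart_def homeomorphism_def)

lemma open_cmap_image:
  assumes "c \<in> A" "open N" "N \<subseteq> cdom c"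
  shows "open (cmap c ` N)"
proof -
  have "cmap c ` N = cmap c ` cdom c \<inter> cinv c -` N"
    using assms by force
  then show ?thesis
    using continuous_open_preimage[OF continuous_cinv open_cimage] assms by simp
qed

lemma Ck_on_transition:
  assumes "c \<in> A" "d \<in> A"
  shows "Ck_on k (cmap c ` (cdom c \<inter> cdom d)) (cmap d \<circ> cinv c)"
  using A assms unfolding smooth_atlas_def smooth_on_def by blast

abbreviation transition_deriv where
  "transition_deriv c d m \<equiv> frechet_derivative (cmap d \<circ> cinv c) (at (cmap c m))"

lemma transition_has_derivative:
  assumes "c \<in> A" "d \<in> A" "m \<in> cdom c" "m \<in> cdom d"
  shows "((cmap d \<circ> cinv c) has_derivative transition_deriv c d m) (at (cmap c m))"
  by (rule Ck_on_has_derivative[OF Ck_on_transition[OF assms(1,2), of "Suc 0"]])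
    (use assms in auto)

lemma transition_deriv_self:
  assumes "c \<in> A" "m \<in> cdom c"
  shows "transition_deriv c c m e = e"
proof -
  have "((\<lambda>z. z) has_derivative (\<lambda>z. z)) (at (cmap c m))" by simp
  then have "((cmap c \<circ> cinv c) has_derivative (\<lambda>z. z)) (at (cmap c m))"
    by (rule has_derivative_transform_within_open[OF _ open_cimage[OF assms(1)]])
      (use assms in \<open>auto simp: cmap_cinv\<close>)
  then show ?thesis by (rule ddir_eq)
qed

lemma transition_deriv_chain:
  assumes "c \<in> A" "d \<in> A" "e \<in> A" "m \<in> cdom c" "m \<in> cdom d" "m \<in> cdom e"
  shows "transition_deriv c e m v = transition_deriv d e m (transition_deriv c d m v)"
proof -
  let ?N = "cmap c ` (cdom c \<inter> cdom d \<inter> cdom e)"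
  have "open ?N" by (intro open_cmap_image open_Int open_cdom) (use assms in auto)
  have eq: "(cmap d \<circ> cinv c) (cmap c m) = cmap d m" using assms by simp
  have "((cmap e \<circ> cinv d) has_derivative transition_deriv d e m) (at ((cmap d \<circ> cinv c) (cmap c m)))"
    unfolding eq by (rule transition_has_derivative) (use assms in auto)
  from diff_chain_at[OF transition_has_derivative[OF assms(1,2,4,5)] this]
  have "((cmap e \<circ> cinv d) \<circ> (cmap d \<circ> cinv c) has_derivative
      transition_deriv d e m \<circ> transition_deriv c d m) (at (cmap c m))" .
  then have "((cmap e \<circ> cinv c) has_derivative transition_deriv d e m \<circ> transition_deriv c d m)
      (at (cmap c m))"
    by (rule has_derivative_transform_within_open[OF _ \<open>open ?N\<close>]) (use assms in auto)
  from ddir_eq[OF this, of v] show ?thesis by simp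
qed

lemma linear_transition_deriv:
  assumes "c \<in> A" "d \<in> A" "m \<in> cdom c" "m \<in> cdom d"
  shows "linear (transition_deriv c d m)"
  by (rule has_derivative_linear[OF transition_has_derivative[OF assms]])

text \<open>The required relation between two components is the chain rule for chart
  transitions.\<close>

lemma coord_vec_tangent:
  assumes "c \<in> A" "m \<in> cdom c"
  shows "coord_vec A c m e \<in> tangent_space A m"
  unfolding tangent_space_def
proof (intro CollectI conjI ballI allI impI)
  fix d d' assume d: "d \<in> A" "d' \<in> A" "m \<in> cdom d \<inter> cdom d'"
  then have "transition_deriv c d' m e = transition_deriv d d' m (transition_deriv c d m e)"
    by (intro transition_deriv_chain) (use assms in auto)
  then show "coord_vec A c m e d' = transition_deriv d d' m (coord_vec A c m e d)"
    using d unfolding coord_vec_def by simp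
qed (auto simp: coord_vec_def)

lemma coord_vec_self: "c \<in> A \<Longrightarrow> m \<in> cdom c \<Longrightarrow> coord_vec A c m e c = e"
  by (simp add: coord_vec_def transition_deriv_self)

lemma tangent_transition:
  assumes "v \<in> tangent_space A m" "c \<in> A" "d \<in> A" "m \<in> cdom c" "m \<in> cdom d"
  shows "v d = transition_deriv c d m (v c)"
  using assms unfolding tangent_space_def by blast

lemma tangent_outside:
  assumes "v \<in> tangent_space A m" "\<not> (c \<in> A \<and> m \<in> cdom c)"
  shows "v c = 0"
  using assms unfolding tangent_space_def by blast

text \<open>The transition law fixes the components in charts around \<open>m\<close>, and all
  others are 0. Equalities of tangent vectors can therefore be checked in a single chart.\<close>

lemma tangent_eq_coord_vec:
  assumes "c \<in> A" "m \<in> cdom c" "v \<in> tangent_space A m"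
  shows "v = coord_vec A c m (v c)"
proof
  fix d
  show "v d = coord_vec A c m (v c) d"
  proof (cases "d \<in> A \<and> m \<in> cdom d")
    case True
    then have "v d = transition_deriv c d m (v c)"
      using assms by (intro tangent_transition) auto
    then show ?thesis using True by (simp add: coord_vec_def)
  next
    case False
    with assms(3) have "v d = 0" by (rule tangent_outside)
    then show ?thesis using False by (auto simp: coord_vec_def)
  qed
qed

lemma tangent_lincomb:
  assumes "u \<in> tangent_space A m" "v \<in> tangent_space A m"
  shows "lincomb a u b v \<in> tangent_space A m"
proof -
  obtain c where c: "c \<in> A" "m \<in> cdom c" using atlas_cover by blast
  have "lincomb a u b v = coord_vec A c m (a *\<^sub>R u c + b *\<^sub>R v c)"
  proof
    fix d
    have eq: "u d = coord_vec A c m (u c) d" "v d = coord_vec A c m (v c) d"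
      by (rule fun_cong[OF tangent_eq_coord_vec[OF c]], rule assms)+
    show "lincomb a u b v d = coord_vec A c m (a *\<^sub>R u c + b *\<^sub>R v c) d"
    proof (cases "d \<in> A \<and> m \<in> cdom d")
      case True
      then have "linear (transition_deriv c d m)" using c by (intro linear_transition_deriv) auto
      then show ?thesis
        using True unfolding lincomb_def eq by (simp add: coord_vec_def linear_add linear_scale)
    next
      case False
      then have "coord_vec A c m e d = 0" for e by (auto simp: coord_vec_def)
      then show ?thesis unfolding lincomb_def eq by simp
    qed
  qed
  then show ?thesis using coord_vec_tangent[OF c] by metis
qed

lemma lincomb_coord_vec:
  assumes c: "c \<in> A" "m \<in> cdom c"
  shows "lincomb a (coord_vec A c m e) b (coord_vec A c m e') = coord_vec A c m (a *\<^sub>R e + b *\<^sub>R e')"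
  using tangent_eq_coord_vec[OF c tangent_lincomb[OF coord_vec_tangent[OF c] coord_vec_tangent[OF c]]]
  by (simp add: lincomb_def coord_vec_self[OF c])

lemma tangent_zero: "(\<lambda>_. 0) \<in> tangent_space A m"
proof -
  obtain c where c: "c \<in> A" "m \<in> cdom c" using atlas_cover by blast
  from tangent_lincomb[OF coord_vec_tangent[OF c] coord_vec_tangent[OF c], of 0 0 0 0]
  show ?thesis by (simp add: lincomb_def)
qed

lemma tangent_sum:
  assumes "finite I" "\<And>i. i \<in> I \<Longrightarrow> v i \<in> tangent_space A m"
  shows "(\<lambda>c. \<Sum>i\<in>I. a i *\<^sub>R v i c) \<in> tangent_space A m"
  using assms
proof (induction I rule: finite_induct)
  case (insert i I)
  have "lincomb (a i) (v i) 1 (\<lambda>c. \<Sum>i\<in>I. a i *\<^sub>R v i c) \<in> tangent_space A m"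
    using insert by (intro tangent_lincomb) auto
  then show ?case using insert(1,2) by (simp add: lincomb_def)
qed (simp add: tangent_zero)

text \<open>Frees the derivative from the chart that \<open>SOME\<close> picks in its
  definition.\<close>

lemma tderiv_coord:
  assumes "c \<in> A" "m \<in> cdom c" "v \<in> tangent_space A m"
    "(\<lambda>z. G (cinv c z) d) differentiable (at (cmap c m))"
  shows "tderiv A G m v d = ddir (v c) (\<lambda>z. G (cinv c z) d) (cmap c m)"
  using dirderiv_eq[OF A assms(1-3), of "\<lambda>n. G n d"] assms(4)
  by (simp add: tderiv_def o_def)

text \<open>As all values lie in one tangent space, the component in any other chart is a fixed
  linear image of the component in \<open>c\<close>. Differentiability in \<open>c\<close> therefore
  passes to all charts, and the derivative obeys the same transition law. The chart contains both
  the base point \<open>m\<close> and the foot \<open>q\<close> of the vectors.\<close>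

lemma tderiv_tangent:
  assumes c: "c \<in> A" "m \<in> cdom c" "q \<in> cdom c" and v: "v \<in> tangent_space A m"
    and N: "open N" "m \<in> N" "\<And>n. n \<in> N \<Longrightarrow> G n \<in> tangent_space A q"
    and d: "(\<lambda>z. G (cinv c z) c) differentiable (at (cmap c m))"
  shows "tderiv A G m v \<in> tangent_space A q"
proof -
  let ?N = "cmap c ` (N \<inter> cdom c)"
  have N': "open ?N" "cmap c m \<in> ?N"
    by (intro open_cmap_image open_Int open_cdom) (use c N in auto)
  have der: "((\<lambda>z. G (cinv c z) c) has_derivative (\<lambda>e. ddir e (\<lambda>z. G (cinv c z) c) (cmap c m))) (at (cmap c m))"
    using d by (simp add: frechet_derivative_works[symmetric])
  have "tderiv A G m v e = coord_vec A c q (tderiv A G m v c) e" for e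
  proof (cases "e \<in> A \<and> q \<in> cdom e")
    case True
    have bl: "bounded_linear (transition_deriv c e q)"
      by (rule has_derivative_bounded_linear[OF transition_has_derivative]) (use c True in auto)
    have "((\<lambda>z. transition_deriv c e q (G (cinv c z) c)) has_derivative
        (\<lambda>h. transition_deriv c e q (ddir h (\<lambda>z. G (cinv c z) c) (cmap c m)))) (at (cmap c m))"
      by (rule bounded_linear.has_derivative[OF bl der])
    then have D: "((\<lambda>z. G (cinv c z) e) has_derivative
        (\<lambda>h. transition_deriv c e q (ddir h (\<lambda>z. G (cinv c z) c) (cmap c m)))) (at (cmap c m))"
    proof (rule has_derivative_transform_within_open[OF _ N'])
      fix z assume "z \<in> ?N"
      then have "cinv c z \<in> N" using c(1) by auto
      then have "G (cinv c z) \<in> tangent_space A q" by (rule N(3))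
      then show "transition_deriv c e q (G (cinv c z) c) = G (cinv c z) e"
        using True c by (intro tangent_transition[symmetric]) auto
    qed
    have "tderiv A G m v e = ddir (v c) (\<lambda>z. G (cinv c z) e) (cmap c m)"
      by (rule tderiv_coord[OF c(1,2) v]) (use D in \<open>auto simp: differentiable_def\<close>)
    also have "\<dots> = transition_deriv c e q (tderiv A G m v c)"
      by (simp only: ddir_eq[OF D] tderiv_coord[OF c(1,2) v, of G c, OF d])
    finally show ?thesis using True by (simp add: coord_vec_def)
  next
    case False
    \<comment> \<open>Components in charts that miss \<open>q\<close> are identically 0 near
      \<open>m\<close>, hence their derivative there is 0.\<close>
    have "((\<lambda>z. 0) has_derivative (\<lambda>h. 0)) (at (cmap c m))" by simp
    then have D: "((\<lambda>z. G (cinv c z) e) has_derivative (\<lambda>h. 0)) (at (cmap c m))"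
    proof (rule has_derivative_transform_within_open[OF _ N'])
      fix z assume "z \<in> ?N"
      then have "cinv c z \<in> N" using c(1) by auto
      then have "G (cinv c z) \<in> tangent_space A q" by (rule N(3))
      then show "0 = G (cinv c z) e"
        using False by (rule tangent_outside[symmetric])
    qed
    have "tderiv A G m v e = ddir (v c) (\<lambda>z. G (cinv c z) e) (cmap c m)"
      by (rule tderiv_coord[OF c(1,2) v]) (use D in \<open>auto simp: differentiable_def\<close>)
    then have "tderiv A G m v e = 0" by (simp only: ddir_eq[OF D])
    then show ?thesis using False by (auto simp: coord_vec_def)
  qed
  then have "tderiv A G m v = coord_vec A c q (tderiv A G m v c)" by (rule ext)
  then show ?thesis using coord_vec_tangent[OF c(1,3)] by metis
qed

lemma lie_deriv_coord:
  assumes c: "c \<in> A" "m \<in> cdom c" and Y: "smooth_vector_field A Y"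
    and f: "(\<lambda>z. f (cinv c z)) differentiable (at (cmap c m))"
  shows "lie_deriv A Y f m = ddir (Y m c) (\<lambda>z. f (cinv c z)) (cmap c m)"
  using dirderiv_eq[OF A c, of "Y m" f] Y f
  by (simp add: lie_deriv_def smooth_vector_field_def o_def)

lemma Ck_on_vector_field:
  assumes "c \<in> A" "smooth_vector_field A Y"
  shows "Ck_on k (cmap c ` cdom c) (\<lambda>z. Y (cinv c z) c)"
  using assms by (auto simp: smooth_vector_field_def smooth_on_def)

text \<open>The product rule: differentiating the inner field gives the first summand,
  differentiating the derivative of \<open>f\<close> gives the second. The inner Lie derivative is
  identified on the whole chart, since it is differentiated again.\<close>

lemma lie_deriv_lie_deriv_coord:
  assumes c: "c \<in> A" "m \<in> cdom c" and Y: "smooth_vector_field A Y" and Y': "smooth_vector_field A Y'"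
    and f: "Ck_on (Suc (Suc 0)) (cmap c ` cdom c) (\<lambda>z. f (cinv c z))"
  shows "lie_deriv A Y (lie_deriv A Y' f) m =
    ddir (ddir (Y m c) (\<lambda>z. Y' (cinv c z) c) (cmap c m)) (\<lambda>z. f (cinv c z)) (cmap c m) +
    ddir (Y m c) (ddir (Y' m c) (\<lambda>z. f (cinv c z))) (cmap c m)"
proof -
  let ?f = "\<lambda>z. f (cinv c z)" and ?S = "cmap c ` cdom c" and ?z = "cmap c m"
  let ?V = "\<lambda>z. Y' (cinv c z) c"
  have z: "?z \<in> ?S" using c by simp
  have fd: "?f differentiable (at z)" if "z \<in> ?S" for z
    by (rule Ck_on_differentiable[OF f that])
  have D: "((\<lambda>z. ddir (?V z) ?f z) has_derivative
      (\<lambda>h. ddir (ddir h ?V ?z) ?f ?z + ddir h (ddir (?V ?z) ?f) ?z)) (at ?z)"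
    by (rule has_derivative_apply[OF open_cimage[OF c(1)] z linear_ddir[OF f]])
      (auto intro: Ck_on_differentiable[OF Ck_on_ddir[OF f] z]
        Ck_on_has_derivative[OF Ck_on_vector_field[OF c(1) Y'] z])
  then have D': "((\<lambda>z. lie_deriv A Y' f (cinv c z)) has_derivative
      (\<lambda>h. ddir (ddir h ?V ?z) ?f ?z + ddir h (ddir (?V ?z) ?f) ?z)) (at ?z)"
  proof (rule has_derivative_transform_within_open[OF _ open_cimage[OF c(1)] z])
    fix z assume zS: "z \<in> ?S"
    have "lie_deriv A Y' f (cinv c z) = ddir (Y' (cinv c z) c) ?f (cmap c (cinv c z))"
      by (rule lie_deriv_coord[OF c(1) cinv_in_cdom[OF c(1) zS] Y'])
        (use fd[OF zS] cmap_cinv[OF c(1) zS] in simp)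
    then show "ddir (?V z) ?f z = lie_deriv A Y' f (cinv c z)"
      using cmap_cinv[OF c(1) zS] by simp
  qed
  have "lie_deriv A Y (lie_deriv A Y' f) m = ddir (Y m c) (\<lambda>z. lie_deriv A Y' f (cinv c z)) ?z"
    by (rule lie_deriv_coord[OF c Y]) (use D' in \<open>auto simp: differentiable_def\<close>)
  then show ?thesis using ddir_eq[OF D', of "Y m c"] c by simp
qed

end

section \<open>Partial derivatives and the diagonal\<close>

lemma has_derivative_partial1:
  assumes "Ck_on (Suc k) (W \<times> W') f" "z \<in> W" "z' \<in> W'"
  shows "((\<lambda>z. f (z, z')) has_derivative (\<lambda>v. ddir (v, 0) f (z, z'))) (at z)"
proof (rule has_derivative_compose[of "\<lambda>z. (z, z')" "\<lambda>v. (v, 0)" z UNIV f])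
  show "(f has_derivative (\<lambda>v. ddir v f (z, z'))) (at (z, z'))"
    by (rule Ck_on_has_derivative[OF assms(1)]) (use assms in simp)
qed (intro has_derivative_Pair has_derivative_ident has_derivative_const)

lemma has_derivative_partial2:
  assumes "Ck_on (Suc k) (W \<times> W') f" "z \<in> W" "z' \<in> W'"
  shows "((\<lambda>z'. f (z, z')) has_derivative (\<lambda>v. ddir (0, v) f (z, z'))) (at z')"
proof (rule has_derivative_compose[of "\<lambda>z'. (z, z')" "\<lambda>v. (0, v)" z' UNIV f])
  show "(f has_derivative (\<lambda>v. ddir v f (z, z'))) (at (z, z'))"
    by (rule Ck_on_has_derivative[OF assms(1)]) (use assms in simp)
qed (intro has_derivative_Pair has_derivative_ident has_derivative_const)

text \<open>A function constant on the diagonal has derivative 0 in the direction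
  \<open>(v, v)\<close>. Applied to \<open>U\<close> and to the differential of \<psi> in its second
  argument, this trades derivatives in the first argument for derivatives in the second.\<close>

lemma ddir_diagonal_const:
  assumes "Ck_on (Suc k) (W \<times> W) f" "open W" "z \<in> W" "\<And>z. z \<in> W \<Longrightarrow> f (z, z) = e"
  shows "ddir (v, 0) f (z, z) + ddir (0, v) f (z, z) = 0"
proof -
  have f: "(f has_derivative (\<lambda>v. ddir v f (z, z))) (at (z, z))"
    by (rule Ck_on_has_derivative[OF assms(1)]) (use assms in simp)
  have "((\<lambda>z. f (z, z)) has_derivative (\<lambda>v. ddir (v, v) f (z, z))) (at z)"
    by (rule has_derivative_compose[of "\<lambda>z. (z, z)" "\<lambda>v. (v, v)" z UNIV f, OF _ f])
      (intro has_derivative_Pair has_derivative_ident)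
  then have "((\<lambda>z. e) has_derivative (\<lambda>v. ddir (v, v) f (z, z))) (at z)"
    by (rule has_derivative_transform_within_open[OF _ assms(2,3)]) (rule assms(4))
  from ddir_eq[OF this, of v] have "ddir (v, v) f (z, z) = 0" by simp
  moreover have "ddir (v, v) f (z, z) = ddir (v, 0) f (z, z) + ddir (0, v) f (z, z)"
    using linear_add[OF has_derivative_linear[OF f], of "(v, 0)" "(0, v)"] by simp
  ultimately show ?thesis by simp
qed

section \<open>Gauges in charts\<close>

text \<open>A single chart serves both arguments, and all pairs of points of \<open>W\<close> lie in
  \<open>D\<close>; there the gauge becomes a pair of smooth functions on
  \<open>W \<times> W\<close>.\<close>

locale gauge_chart =
  fixes A :: "('m::{t2_space, second_countable_topology}, 'e::euclidean_space) chart set"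
    and D :: "('m \<times> 'm) set"
    and \<psi> :: "'m \<Rightarrow> 'm \<Rightarrow> ('m, 'e) tvec"
    and U :: "'m \<Rightarrow> 'm \<Rightarrow> ('m, 'e) tvec \<Rightarrow> ('m, 'e) tvec"
    and c :: "('m, 'e) chart" and W :: "'e set"
  assumes A: "smooth_atlas A" and gauge: "gauge_on A D \<psi> U" and c: "c \<in> A"
    and open_W: "open W" and W_sub: "W \<subseteq> cmap c ` cdom c"
    and W_D: "\<And>z z'. z \<in> W \<Longrightarrow> z' \<in> W \<Longrightarrow> (cinv c z, cinv c z') \<in> D"
begin

definition Psi :: "'e \<times> 'e \<Rightarrow> 'e" where
  "Psi = (\<lambda>(z, z'). \<psi> (cinv c z) (cinv c z') c)"

text \<open>The vector comes first, so that each fixed \<open>e\<close> gives one smooth function of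
  the pair of points. The transport goes from the second point to the first.\<close>

definition Upar :: "'e \<Rightarrow> 'e \<times> 'e \<Rightarrow> 'e" where
  "Upar e = (\<lambda>(z, z'). U (cinv c z) (cinv c z') (coord_vec A c (cinv c z') e) c)"

lemma W_cdom: "z \<in> W \<Longrightarrow> cinv c z \<in> cdom c"
  using cinv_in_cdom[OF A c] W_sub by blast

lemma W_cmap: "z \<in> W \<Longrightarrow> cmap c (cinv c z) = z"
  using cmap_cinv[OF A c] W_sub by blast

lemma open_WW: "open (W \<times> W)"
  by (intro open_Times open_W)

lemma open_cinv_image:
  assumes "open N" "N \<subseteq> W"
  shows "open (cinv c ` N)"
proof -
  have "cinv c ` N = cdom c \<inter> cmap c -` N"
    using assms(2) W_cdom W_cmap cinv_cmap[OF A c] by force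
  then show ?thesis
    using continuous_open_preimage[OF continuous_cmap[OF A c] open_cdom[OF A c] assms(1)] by simp
qed

lemma open_cinv_W: "open (cinv c ` W)"
  by (rule open_cinv_image[OF open_W order_refl])

lemma WW_sub: "W \<times> W \<subseteq> chart_image2 D c c"
proof (clarify)
  fix z z' assume "z \<in> W" "z' \<in> W"
  then have "(cinv c z, cinv c z') \<in> D \<inter> cdom c \<times> cdom c" "(z, z') = map_prod (cmap c) (cmap c) (cinv c z, cinv c z')"
    using W_D W_cdom W_cmap by auto
  then show "(z, z') \<in> chart_image2 D c c"
    unfolding chart_image2_def by blast
qed

lemma logarithm: "logarithm A D \<psi>" and parallelism: "parallelism A D U"
  using gauge by (auto simp: gauge_on_def)

lemma Ck_on_Psi: "Ck_on k (W \<times> W) Psi"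
proof -
  have "smooth_on (chart_image2 D c c) Psi"
    using logarithm c unfolding logarithm_def Psi_def by blast
  then show ?thesis
    unfolding smooth_on_def using Ck_on_subset[OF _ WW_sub] by blast
qed

lemma Ck_on_Upar: "Ck_on k (W \<times> W) (Upar e)"
proof -
  have "smooth_on (chart_image2 D c c) (Upar e)"
    using parallelism c unfolding parallelism_def Upar_def by blast
  then show ?thesis
    unfolding smooth_on_def using Ck_on_subset[OF _ WW_sub] by blast
qed

lemma psi_tangent: "(m, n) \<in> D \<Longrightarrow> \<psi> m n \<in> tangent_space A m"
  using logarithm unfolding logarithm_def by blast

lemma U_tangent: "(n, m) \<in> D \<Longrightarrow> u \<in> tangent_space A m \<Longrightarrow> U n m u \<in> tangent_space A n"
  using parallelism unfolding parallelism_def by blast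

lemma U_lincomb:
  "(n, m) \<in> D \<Longrightarrow> u \<in> tangent_space A m \<Longrightarrow> v \<in> tangent_space A m \<Longrightarrow>
    U n m (lincomb a u b v) = lincomb a (U n m u) b (U n m v)"
  using parallelism unfolding parallelism_def by blast

lemma linear_Upar:
  assumes "z \<in> W" "z' \<in> W"
  shows "linear (\<lambda>e. Upar e (z, z'))"
proof -
  have lc: "Upar (a *\<^sub>R e + b *\<^sub>R e') (z, z') = a *\<^sub>R Upar e (z, z') + b *\<^sub>R Upar e' (z, z')" for a b e e'
    using U_lincomb[OF W_D[OF assms] coord_vec_tangent[OF A c W_cdom[OF assms(2)]]
        coord_vec_tangent[OF A c W_cdom[OF assms(2)]], of a e b e']
    by (simp add: Upar_def lincomb_coord_vec[OF A c W_cdom[OF assms(2)]]) (simp add: lincomb_def)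
  show ?thesis
    by (rule linearI) (use lc[of 1 _ 1] lc[of _ _ 0] in simp_all)
qed

lemma Upar_diag:
  assumes "z \<in> W"
  shows "Upar e (z, z) = e"
proof -
  have "coord_vec A c (cinv c z) e \<in> tangent_space A (cinv c z)"
    by (rule coord_vec_tangent[OF A c W_cdom[OF assms]])
  then have "U (cinv c z) (cinv c z) (coord_vec A c (cinv c z) e) = coord_vec A c (cinv c z) e"
    using parallelism unfolding parallelism_def by blast
  then show ?thesis
    by (simp add: Upar_def coord_vec_self[OF A c W_cdom[OF assms]])
qed

lemma Psi_diag: "Psi (z, z) = 0"
  using logarithm unfolding logarithm_def Psi_def by simp

lemma U_coord:
  assumes "z \<in> W" "z' \<in> W" "u \<in> tangent_space A (cinv c z')"
  shows "U (cinv c z) (cinv c z') u c = Upar (u c) (z, z')"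
  using tangent_eq_coord_vec[OF A c W_cdom[OF assms(2)] assms(3)] by (simp add: Upar_def)

lemma psi_tderiv:
  assumes "z \<in> W" "z' \<in> W" "u \<in> tangent_space A (cinv c z')"
  shows "tderiv A (\<psi> (cinv c z)) (cinv c z') u \<in> tangent_space A (cinv c z)"
    and "tderiv A (\<psi> (cinv c z)) (cinv c z') u c = ddir (0, u c) Psi (z, z')"
proof -
  have D: "((\<lambda>z'. \<psi> (cinv c z) (cinv c z') c) has_derivative (\<lambda>v. ddir (0, v) Psi (z, z')))
      (at (cmap c (cinv c z')))"
    using has_derivative_partial2[OF Ck_on_Psi assms(1,2)]
    by (simp add: Psi_def W_cmap[OF assms(2)])
  then have d: "(\<lambda>z'. \<psi> (cinv c z) (cinv c z') c) differentiable (at (cmap c (cinv c z')))"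
    unfolding differentiable_def by blast
  show "tderiv A (\<psi> (cinv c z)) (cinv c z') u \<in> tangent_space A (cinv c z)"
  proof (rule tderiv_tangent[where G="\<psi> (cinv c z)", OF A c W_cdom[OF assms(2)] W_cdom[OF assms(1)] assms(3) open_cinv_W _ _ d])
    show "cinv c z' \<in> cinv c ` W" using assms by simp
    show "\<psi> (cinv c z) n \<in> tangent_space A (cinv c z)" if "n \<in> cinv c ` W" for n
      using that psi_tangent W_D assms(1) by blast
  qed
  show "tderiv A (\<psi> (cinv c z)) (cinv c z') u c = ddir (0, u c) Psi (z, z')"
    using tderiv_coord[OF A c W_cdom[OF assms(2)] assms(3), of "\<psi> (cinv c z)" c, OF d]
    by (simp add: ddir_eq[OF D])
qed

lemma ddir_Psi_diag:
  assumes "z \<in> W"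
  shows "ddir (0, u) Psi (z, z) = u"
proof -
  let ?u = "coord_vec A c (cinv c z) u"
  have u: "?u \<in> tangent_space A (cinv c z)" by (rule coord_vec_tangent[OF A c W_cdom[OF assms]])
  then have "tderiv A (\<psi> (cinv c z)) (cinv c z) ?u = ?u"
    using logarithm unfolding logarithm_def by blast
  then show ?thesis
    using psi_tderiv(2)[OF assms assms u] by (simp add: coord_vec_self[OF A c W_cdom[OF assms]])
qed

text \<open>The inverse in the definition is a chosen preimage, meaningful only where one exists.
  Near \<open>m\<close> the matrix of \<open>U n m\<close> is close to the identity, hence
  bijective, and the preimage solves a linear equation whose right-hand side is the differential of
  \<open>\<psi> n\<close>. Differentiating the equation yields one term from the right-hand side
  and, with opposite sign, one from the matrix.\<close>

lemma compat_tensor_coord: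
  assumes z: "z \<in> W" and v: "v \<in> tangent_space A (cinv c z)" and u: "u \<in> tangent_space A (cinv c z)"
  shows "compat_tensor A \<psi> U (cinv c z) v u \<in> tangent_space A (cinv c z)"
    and "compat_tensor A \<psi> U (cinv c z) v u c =
      ddir (v c, 0) (ddir (0, u c) Psi) (z, z) - ddir (v c, 0) (Upar (u c)) (z, z)"
proof -
  let ?m = "cinv c z"
  define Q where "Q z' e = Upar e (z', z)" for z' e
  define B where "B z' = ddir (0, u c) Psi (z', z)" for z'
  define G where "G n = inv_into (tangent_space A ?m) (U n ?m) (tderiv A (\<psi> n) ?m u)" for n
  have Qd: "((\<lambda>z'. Q z' e) has_derivative (\<lambda>h. ddir (h, 0) (Upar e) (z, z))) (at z)" for e
    unfolding Q_def by (rule has_derivative_partial1[OF Ck_on_Upar z z])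
  have Bd: "(B has_derivative (\<lambda>h. ddir (h, 0) (ddir (0, u c) Psi) (z, z))) (at z)"
    unfolding B_def by (rule has_derivative_partial1[OF Ck_on_ddir[OF Ck_on_Psi] z z])
  have Qlin: "linear (Q z')" if "z' \<in> W" for z'
    unfolding Q_def by (rule linear_Upar[OF that z])
  have Qz: "Q z e = e" for e by (simp add: Q_def Upar_diag[OF z])
  \<comment> \<open>Any factor below 1 excludes a kernel.\<close>
  have "\<forall>\<^sub>F z' in nhds z. z' \<in> W \<and> (\<forall>e. norm (Q z' e - e) \<le> (1 / 2) * norm e)"
    by (rule near_identity[OF open_W z Qlin])
      (use Qz has_derivative_continuous[OF Qd] in auto)
  then obtain N where N: "open N" "z \<in> N" "\<And>z'. z' \<in> N \<Longrightarrow> z' \<in> W"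
    "\<And>z' e. z' \<in> N \<Longrightarrow> norm (Q z' e - e) \<le> (1 / 2) * norm e"
    unfolding eventually_nhds by blast
  have surj: "\<exists>e. Q z' e = b" if "z' \<in> N" for z' b
  proof -
    have "e = 0" if "Q z' e = 0" for e
      using N(4)[OF \<open>z' \<in> N\<close>, of e] that by simp
    then have "inj (Q z')"
      using linear_injective_0[OF Qlin[OF N(3)[OF that]]] by blast
    then have "surj (Q z')"
      using linear_injective_imp_surjective[OF Qlin[OF N(3)[OF that]]] by blast
    then show ?thesis by (metis surjD)
  qed
  have G: "G (cinv c z') \<in> tangent_space A ?m" "Q z' (G (cinv c z') c) = B z'" if zN: "z' \<in> N" for z'
  proof -
    let ?n = "cinv c z'"
    have z': "z' \<in> W" by (rule N(3)[OF zN])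
    let ?b = "tderiv A (\<psi> ?n) ?m u"
    obtain e where e: "Q z' e = ?b c" using surj[OF zN] by blast
    let ?e = "coord_vec A c ?m e"
    have e': "?e \<in> tangent_space A ?m" by (rule coord_vec_tangent[OF A c W_cdom[OF z]])
    have "U ?n ?m ?e c = ?b c"
      using e unfolding Q_def Upar_def by simp
    then have "U ?n ?m ?e = ?b"
      using tangent_eq_coord_vec[OF A c W_cdom[OF z'] U_tangent[OF W_D[OF z' z] e']]
        tangent_eq_coord_vec[OF A c W_cdom[OF z'] psi_tderiv(1)[OF z' z u]]
      by metis
    then have img: "?b \<in> U ?n ?m ` tangent_space A ?m" using e' by (metis image_eqI)
    show GT: "G ?n \<in> tangent_space A ?m"
      unfolding G_def by (rule inv_into_into[OF img])
    have "U ?n ?m (G ?n) = ?b"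
      unfolding G_def by (rule f_inv_into_f[OF img])
    then show "Q z' (G ?n c) = B z'"
      unfolding Q_def B_def using U_coord[OF z' z GT] psi_tderiv(2)[OF z' z u] by simp
  qed
  have D: "((\<lambda>z'. G (cinv c z') c) has_derivative
      (\<lambda>h. ddir (h, 0) (ddir (0, u c) Psi) (z, z) - ddir h (\<lambda>z'. Q z' (B z)) z)) (at z)"
    by (rule has_derivative_solution[OF N(1,2) Qlin _ Qz Bd G(2)])
      (use N(3) Qd in \<open>auto simp: differentiable_def\<close>)
  \<comment> \<open>On the diagonal the differential of \<psi> is the identity, so the derivative of
    the matrix is applied to \<open>u c\<close> itself.\<close>
  have Bz: "B z = u c" by (simp add: B_def ddir_Psi_diag[OF z])
  have d: "(\<lambda>z'. G (cinv c z') c) differentiable (at (cmap c ?m))"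
    using D unfolding differentiable_def W_cmap[OF z] by blast
  have ct: "compat_tensor A \<psi> U ?m v u = tderiv A G ?m v"
    unfolding compat_tensor_def G_def ..
  have "open (cinv c ` N)"
    by (rule open_cinv_image[OF N(1)]) (use N(3) in blast)
  then show "compat_tensor A \<psi> U ?m v u \<in> tangent_space A ?m"
    unfolding ct
    by (rule tderiv_tangent[where G=G, OF A c W_cdom[OF z] W_cdom[OF z] v _ _ _ d]) (use N(2) G(1) in auto)
  have "tderiv A G ?m v c = ddir (v c) (\<lambda>z'. G (cinv c z') c) z"
    using tderiv_coord[OF A c W_cdom[OF z] v, of G c, OF d] by (simp add: W_cmap[OF z])
  then show "compat_tensor A \<psi> U ?m v u c =
      ddir (v c, 0) (ddir (0, u c) Psi) (z, z) - ddir (v c, 0) (Upar (u c)) (z, z)"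
    unfolding ct by (simp add: ddir_eq[OF D] Bz ddir_eq[OF Qd])
qed

text \<open>The foot \<open>m\<close> stays fixed while the field moves, so all values lie in the
  tangent space at \<open>m\<close>. The product rule gives the derivative of the field, as
  \<open>U m m\<close> is the identity, plus that of the transport.\<close>

lemma transport_coord:
  assumes z: "z \<in> W" and v: "v \<in> tangent_space A (cinv c z)" and Y: "smooth_vector_field A Y"
  shows "tderiv A (\<lambda>n. U (cinv c z) n (Y n)) (cinv c z) v \<in> tangent_space A (cinv c z)"
    and "tderiv A (\<lambda>n. U (cinv c z) n (Y n)) (cinv c z) v c =
      ddir (v c) (\<lambda>z. Y (cinv c z) c) z + ddir (0, v c) (Upar (Y (cinv c z) c)) (z, z)"
proof -
  let ?m = "cinv c z" and ?V = "\<lambda>z. Y (cinv c z) c"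
  have YT: "Y n \<in> tangent_space A n" for n using Y by (simp add: smooth_vector_field_def)
  have Vd: "(?V has_derivative (\<lambda>h. ddir h ?V z)) (at z)"
    by (rule Ck_on_has_derivative[OF Ck_on_vector_field[OF A c Y] subsetD[OF W_sub z]])
  have Ud: "((\<lambda>z'. Upar e (z, z')) has_derivative (\<lambda>h. ddir (0, h) (Upar e) (z, z))) (at z)" for e
    by (rule has_derivative_partial2[OF Ck_on_Upar z z])
  have "((\<lambda>z'. Upar (?V z') (z, z')) has_derivative
      (\<lambda>h. Upar (ddir h ?V z) (z, z) + ddir h (\<lambda>z'. Upar (?V z) (z, z')) z)) (at z)"
    by (rule has_derivative_apply[OF open_W z linear_Upar[OF z] _ Vd])
      (use Ud in \<open>auto simp: differentiable_def\<close>)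
  then have "((\<lambda>z'. U ?m (cinv c z') (Y (cinv c z')) c) has_derivative
      (\<lambda>h. Upar (ddir h ?V z) (z, z) + ddir h (\<lambda>z'. Upar (?V z) (z, z')) z)) (at z)"
    by (rule has_derivative_transform_within_open[OF _ open_W z]) (simp add: U_coord[OF z _ YT])
  then have D: "((\<lambda>z'. U ?m (cinv c z') (Y (cinv c z')) c) has_derivative
      (\<lambda>h. ddir h ?V z + ddir (0, h) (Upar (?V z)) (z, z))) (at z)"
    by (simp add: Upar_diag[OF z] ddir_eq[OF Ud])
  have d: "(\<lambda>z'. U ?m (cinv c z') (Y (cinv c z')) c) differentiable (at (cmap c ?m))"
    using D unfolding differentiable_def W_cmap[OF z] by blast
  show "tderiv A (\<lambda>n. U ?m n (Y n)) ?m v \<in> tangent_space A ?m"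
    by (rule tderiv_tangent[where G="\<lambda>n. U ?m n (Y n)", OF A c W_cdom[OF z] W_cdom[OF z] v open_cinv_W _ _ d])
      (use z W_D U_tangent YT in auto)
  show "tderiv A (\<lambda>n. U ?m n (Y n)) ?m v c =
      ddir (v c) ?V z + ddir (0, v c) (Upar (?V z)) (z, z)"
    using tderiv_coord[OF A c W_cdom[OF z] v, of "\<lambda>n. U ?m n (Y n)" c, OF d]
    by (simp add: W_cmap[OF z] ddir_eq[OF D])
qed

text \<open>Both \<open>U\<close> terms cancel, so in coordinates the sum depends on the gauge only
  through the second derivative of \<psi> on the diagonal.\<close>

lemma gauge_term_coord:
  assumes z: "z \<in> W" and v: "v \<in> tangent_space A (cinv c z)" and Y: "smooth_vector_field A Y"
  shows "- compat_tensor A \<psi> U (cinv c z) v (Y (cinv c z)) c +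
      tderiv A (\<lambda>n. U (cinv c z) n (Y n)) (cinv c z) v c =
    ddir (v c) (\<lambda>z. Y (cinv c z) c) z + ddir (0, v c) (ddir (0, Y (cinv c z) c) Psi) (z, z)"
proof -
  have YT: "Y (cinv c z) \<in> tangent_space A (cinv c z)" using Y by (simp add: smooth_vector_field_def)
  let ?u = "Y (cinv c z) c"
  have "ddir (v c, 0) (Upar ?u) (z, z) + ddir (0, v c) (Upar ?u) (z, z) = 0"
    by (rule ddir_diagonal_const[OF Ck_on_Upar open_W z Upar_diag])
  moreover have "ddir (v c, 0) (ddir (0, ?u) Psi) (z, z) + ddir (0, v c) (ddir (0, ?u) Psi) (z, z) = 0"
    by (rule ddir_diagonal_const[OF Ck_on_ddir[OF Ck_on_Psi] open_W z ddir_Psi_diag])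
  ultimately show ?thesis
    unfolding compat_tensor_coord(2)[OF z v YT] transport_coord(2)[OF z v Y]
    by (simp add: algebra_simps add_eq_0_iff)
qed

end

section \<open>Comparison of Riemannian and coordinate norms\<close>

lemma metric_norm_equivalent:
  assumes A: "smooth_atlas A" and g: "riemannian_metric A g" and c: "c \<in> A"
    and K: "compact K" "K \<subseteq> cmap c ` cdom c"
  obtains \<alpha> \<beta> where "\<alpha> > 0" "\<beta> > 0"
    "\<And>z v. z \<in> K \<Longrightarrow> v \<in> tangent_space A (cinv c z) \<Longrightarrow>
      \<alpha> * norm (v c) \<le> metric_norm g (cinv c z) v \<and> metric_norm g (cinv c z) v \<le> \<beta> * norm (v c)"
proof -
  define h where "h z b b' = g (cinv c z) (coord_vec A c (cinv c z) b) (coord_vec A c (cinv c z) b')" for z b b'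
  define \<gamma> where "\<gamma> z e = h z e e" for z e
  have Kd: "cinv c z \<in> cdom c" if "z \<in> K" for z
    using cinv_in_cdom[OF A c] K(2) that by blast
  have T: "coord_vec A c (cinv c z) e \<in> tangent_space A (cinv c z)" if "z \<in> K" for z e
    by (rule coord_vec_tangent[OF A c Kd[OF that]])
  have sym: "h z e e' = h z e' e" and lc: "h z (a *\<^sub>R e + b *\<^sub>R e') e'' = a * h z e e'' + b * h z e' e''"
    if "z \<in> K" for z a b e e' e''
    using g T[OF that] unfolding riemannian_metric_def h_def lincomb_coord_vec[OF A c Kd[OF that], symmetric]
    by blast+
  have lin1: "linear (\<lambda>e. h z e e')" if "z \<in> K" for z e'
    by (rule linearI) (use lc[OF that, of 1 _ 1] lc[OF that, of _ _ 0] in simp_all)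
  have lin2: "linear (h z e)" if "z \<in> K" for z e
    using lin1[OF that, of e] sym[OF that, of _ e] by simp
  have \<gamma>_exp: "\<gamma> z e = (\<Sum>b\<in>Basis. \<Sum>b'\<in>Basis. (e \<bullet> b) * (e \<bullet> b') * h z b b')" if "z \<in> K" for z e
  proof -
    have "\<gamma> z e = (\<Sum>b\<in>Basis. (e \<bullet> b) * h z b e)"
      unfolding \<gamma>_def using linear_expand_Basis[OF lin1[OF that, of e], of e] by simp
    also have "\<dots> = (\<Sum>b\<in>Basis. (e \<bullet> b) * (\<Sum>b'\<in>Basis. (e \<bullet> b') * h z b b'))"
      using linear_expand_Basis[OF lin2[OF that], of _ e] by simp
    finally show ?thesis by (simp add: sum_distrib_left mult.assoc)
  qed
  have hc: "continuous_on K (\<lambda>z. h z b b')" for b b'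
  proof -
    have "smooth_fun_on A (cdom c) (\<lambda>m. g m (coord_vec A c m b) (coord_vec A c m b'))"
      using g c unfolding riemannian_metric_def by blast
    then have "smooth_on (cmap c ` (cdom c \<inter> cdom c)) ((\<lambda>m. g m (coord_vec A c m b) (coord_vec A c m b')) \<circ> cinv c)"
      using c unfolding smooth_fun_on_def by blast
    then have "Ck_on 0 (cmap c ` cdom c) ((\<lambda>m. g m (coord_vec A c m b) (coord_vec A c m b')) \<circ> cinv c)"
      unfolding smooth_on_def Int_absorb by blast
    then have "continuous_on (cmap c ` cdom c) (\<lambda>z. h z b b')"
      unfolding Ck_on.simps(1) h_def o_def .
    then show ?thesis by (rule continuous_on_subset[OF _ K(2)])
  qed
  \<comment> \<open>The expansion \<open>\<gamma>_exp\<close> reduces joint continuity in base point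
    and vector to continuity of the finitely many Gram coefficients in the base point.\<close>
  have "continuous_on (K \<times> sphere 0 1) (\<lambda>(z, e). \<Sum>b\<in>Basis. \<Sum>b'\<in>Basis. (e \<bullet> b) * (e \<bullet> b') * h z b b')"
    unfolding case_prod_beta
    by (intro continuous_intros continuous_on_compose2[OF hc]) auto
  then have cont: "continuous_on (K \<times> sphere 0 1) (\<lambda>(z, e). \<gamma> z e)"
    by (rule continuous_on_eq) (auto simp: \<gamma>_exp)
  have comp: "compact (K \<times> sphere (0::'b) 1)"
    by (intro compact_Times K compact_sphere)
  have pos: "\<gamma> z e > 0" if "z \<in> K" "e \<noteq> 0" for z e
  proof -
    have "coord_vec A c (cinv c z) e \<noteq> (\<lambda>_. 0)"
      using coord_vec_self[OF A c Kd[OF that(1)], of e] that(2) by auto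
    then show ?thesis
      using g T[OF that(1)] unfolding riemannian_metric_def \<gamma>_def h_def by blast
  qed
  obtain B where B0: "B \<ge> 0" "\<And>x. x \<in> K \<times> sphere 0 1 \<Longrightarrow> norm (case x of (z, e) \<Rightarrow> \<gamma> z e) \<le> B"
    using continuous_on_compact_bound[OF comp cont] by metis
  have B: "\<gamma> z e \<le> B" if "z \<in> K" "norm e = 1" for z e
    using B0(2)[of "(z, e)"] that by simp
  \<comment> \<open>A bound on the reciprocal over the compact set of unit vectors is a positive
    lower bound for the metric.\<close>
  have "continuous_on (K \<times> sphere 0 1) (\<lambda>x. inverse (case x of (z, e) \<Rightarrow> \<gamma> z e))"
  proof (rule continuous_on_inverse[OF cont], rule ballI)
    fix x assume x: "x \<in> K \<times> sphere (0::'b) 1"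
    then have "snd x \<noteq> 0" by auto
    then show "(case x of (z, e) \<Rightarrow> \<gamma> z e) \<noteq> 0"
      using pos[of "fst x" "snd x"] x by (simp add: case_prod_beta mem_Times_iff)
  qed
  from continuous_on_compact_bound[OF comp this]
  obtain B' where B0': "B' \<ge> 0"
    "\<And>x. x \<in> K \<times> sphere 0 1 \<Longrightarrow> norm (inverse (case x of (z, e) \<Rightarrow> \<gamma> z e)) \<le> B'"
    by metis
  have B': "inverse (\<gamma> z e) \<le> B'" if "z \<in> K" "norm e = 1" for z e
  proof -
    have "norm (inverse (\<gamma> z e)) \<le> B'" using B0'(2)[of "(z, e)"] that by simp
    then show ?thesis unfolding real_norm_def by linarith
  qed
  have hom: "\<gamma> z (r *\<^sub>R e) = r\<^sup>2 * \<gamma> z e" if "z \<in> K" for z r e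
    unfolding \<gamma>_exp[OF that] by (simp add: sum_distrib_left power2_eq_square mult_ac)
  \<comment> \<open>The added 1 makes both constants positive, as \<open>B\<close> and
    \<open>B'\<close> are only nonnegative.\<close>
  have bnd: "inverse (B' + 1) * (norm e)\<^sup>2 \<le> \<gamma> z e \<and> \<gamma> z e \<le> (B + 1) * (norm e)\<^sup>2" if "z \<in> K" for z e
  proof (cases "e = 0")
    case True
    then show ?thesis using hom[OF that, of 0 0] by simp
  next
    case False
    define e1 where "e1 = (1 / norm e) *\<^sub>R e"
    have e1: "norm e1 = 1" "e = norm e *\<^sub>R e1" using False by (auto simp: e1_def)
    have p: "\<gamma> z e1 > 0" using pos[OF that, of e1] e1(1) by force
    have "\<gamma> z e = (norm e)\<^sup>2 * \<gamma> z e1" using hom[OF that, of "norm e" e1] e1(2) by simp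
    moreover have "\<gamma> z e1 \<le> B + 1" using B[OF that e1(1)] by simp
    moreover have "inverse (B' + 1) \<le> \<gamma> z e1"
    proof -
      have "inverse (\<gamma> z e1) \<le> B' + 1" using B'[OF that e1(1)] by simp
      then have "inverse (B' + 1) \<le> inverse (inverse (\<gamma> z e1))"
        using p by (intro le_imp_inverse_le) auto
      then show ?thesis by simp
    qed
    ultimately show ?thesis
      by (metis mult.commute mult_left_mono zero_le_power2)
  qed
  show ?thesis
  proof (rule that[of "sqrt (inverse (B' + 1))" "sqrt (B + 1)"])
    fix z v assume z: "z \<in> K" and v: "v \<in> tangent_space A (cinv c z)"
    have "metric_norm g (cinv c z) v = sqrt (\<gamma> z (v c))"
      unfolding metric_norm_def \<gamma>_def h_def
      using tangent_eq_coord_vec[OF A c Kd[OF z] v] by simp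
    moreover have "sqrt (inverse (B' + 1) * (norm (v c))\<^sup>2) \<le> sqrt (\<gamma> z (v c))"
      "sqrt (\<gamma> z (v c)) \<le> sqrt ((B + 1) * (norm (v c))\<^sup>2)"
      using bnd[OF z, of "v c"] by simp_all
    ultimately show "sqrt (inverse (B' + 1)) * norm (v c) \<le> metric_norm g (cinv c z) v \<and>
        metric_norm g (cinv c z) v \<le> sqrt (B + 1) * norm (v c)"
      by (simp add: real_sqrt_mult)
  qed (use B0(1) B0'(1) in auto)
qed

text \<open>Test functions must be smooth on all of the manifold, so a coordinate is cut off inside
  the chart and extended by 0. The extension is smooth because the compact set \<open>Q\<close>
  containing the support is closed, the space being Hausdorff: every other chart domain is covered
  by its overlap with \<open>c\<close> and its part outside \<open>Q\<close>, both open. The radius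
  is fixed before \<open>b\<close>, so one ball works for all components.\<close>

lemma smooth_cutoff_coordinate:
  assumes A: "smooth_atlas A" and c: "c \<in> A" and z0: "z0 \<in> cmap c ` cdom c"
  obtains r where "r > 0" "ball z0 r \<subseteq> cmap c ` cdom c"
    "\<And>b. \<exists>f. smooth_fun_on A UNIV f \<and> (\<forall>z\<in>ball z0 r. f (cinv c z) = z \<bullet> b)"
proof -
  let ?S = "cmap c ` cdom c"
  obtain R where R: "R > 0" "cball z0 R \<subseteq> ?S"
    using open_contains_cball open_cimage[OF A c] z0 by blast
  define r where "r = R / 2"
  have r: "r > 0" "cball z0 (2 * r) \<subseteq> ?S" using R by (simp_all add: r_def)
  obtain \<beta> :: "_ \<Rightarrow> real" where \<beta>: "smooth_on UNIV \<beta>" "\<And>z. z \<in> ball z0 r \<Longrightarrow> \<beta> z = 1"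
    "\<And>z. z \<notin> cball z0 (2 * r) \<Longrightarrow> \<beta> z = 0"
    using smooth_bump[OF r(1)] by metis
  define Q where "Q = cinv c ` cball z0 (2 * r)"
  have "compact Q"
    unfolding Q_def
    by (intro compact_continuous_image continuous_on_subset[OF continuous_cinv[OF A c] r(2)] compact_cball)
  then have Qcl: "closed Q" by (rule compact_imp_closed)
  have Qsub: "Q \<subseteq> cdom c" using r(2) cinv_in_cdom[OF A c] by (auto simp: Q_def)
  have ex: "\<exists>f. smooth_fun_on A UNIV f \<and> (\<forall>z\<in>ball z0 r. f (cinv c z) = z \<bullet> b)" for b
  proof (intro exI conjI ballI)
    define \<phi> where "\<phi> z = \<beta> z *\<^sub>R (z \<bullet> b)" for z
    define f where "f n = (if n \<in> cdom c then \<phi> (cmap c n) else 0)" for n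
    show "f (cinv c z) = z \<bullet> b" if "z \<in> ball z0 r" for z
    proof -
      have "z \<in> ?S" using that r by (auto simp: subset_iff)
      then show ?thesis using \<beta>(2)[OF that] cmap_cinv[OF A c] cinv_in_cdom[OF A c]
        by (simp add: f_def \<phi>_def)
    qed
    have \<phi>: "Ck_on k UNIV \<phi>" for k
      unfolding \<phi>_def using \<beta>(1)
      by (intro Ck_on_scaleR Ck_on_linear[OF bounded_linear_inner_left] Ck_on_id open_UNIV)
        (simp add: smooth_on_def)
    show "smooth_fun_on A UNIV f"
      unfolding smooth_fun_on_def smooth_on_def
    proof (intro ballI allI)
      fix d k assume d: "d \<in> A"
      let ?S1 = "cmap d ` (cdom d \<inter> cdom c)" and ?S2 = "cmap d ` (cdom d - Q)"
      have o1: "open ?S1"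
        by (intro open_cmap_image[OF A d] open_Int open_cdom[OF A] d c) auto
      have o2: "open ?S2"
        by (intro open_cmap_image[OF A d] open_Diff open_cdom[OF A d] Qcl) auto
      have 1: "Ck_on k ?S1 (f \<circ> cinv d)"
      proof (rule Ck_on_cong[OF o1])
        show "Ck_on k ?S1 (\<lambda>z. \<phi> ((cmap c \<circ> cinv d) z))"
          by (rule Ck_on_compose[OF o1 subset_UNIV Ck_on_transition[OF A d c] \<phi>])
        show "\<phi> ((cmap c \<circ> cinv d) z) = (f \<circ> cinv d) z" if "z \<in> ?S1" for z
          using that cinv_cmap[OF A d] by (auto simp: f_def)
      qed
      have 2: "Ck_on k ?S2 (f \<circ> cinv d)"
      proof (rule Ck_on_cong[OF o2 _ Ck_on_const[of k ?S2 0]])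
        fix z assume "z \<in> ?S2"
        then obtain n where n: "n \<in> cdom d" "n \<notin> Q" "z = cmap d n" by blast
        have "f n = 0"
        proof (cases "n \<in> cdom c")
          case True
          then have "cmap c n \<notin> cball z0 (2 * r)"
            using n(2) cinv_cmap[OF A c True] unfolding Q_def by (metis imageI)
          then show ?thesis using \<beta>(3) by (simp add: f_def \<phi>_def)
        qed (simp add: f_def)
        then show "0 = (f \<circ> cinv d) z" using n cinv_cmap[OF A d n(1)] by simp
      qed
      have "cmap d ` (UNIV \<inter> cdom d) = ?S1 \<union> ?S2" using Qsub by blast
      then show "Ck_on k (cmap d ` (UNIV \<inter> cdom d)) (f \<circ> cinv d)"
        using Ck_on_Un[OF o1 o2 1 2] by simp
    qed
  qed
  show ?thesis
    by (rule that[OF r(1) _ ex]) (use r in \<open>auto simp: subset_iff\<close>)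
qed

section \<open>Estimates near the diagonal\<close>

lemma norm_diff_diff_le:
  fixes u v w :: "'a::real_normed_vector"
  shows "norm (u - v - w) \<le> norm u + norm v + norm w"
  using norm_triangle_ineq4[of "u - v" w] norm_triangle_ineq4[of u v] by linarith

text \<open>\<open>L\<close> and \<open>H\<close> stand for the first two derivatives at the base
  point. The hypotheses give |h - v| <= M2 q^2 and |h| <= M1 q; then \<open>H h h - H v v\<close>
  telescopes into two terms, each with a factor h - v, and is of order q^3. Surplus powers of
  \<open>q\<close> are traded for \<open>Q\<close>.\<close>

lemma forward_estimate:
  fixes h v n :: "'a::real_normed_vector" and \<Phi> :: "'b::real_normed_vector"
  assumes q: "0 \<le> q" "q \<le> Q"
    and v: "norm v \<le> C1 * q" and n: "norm n \<le> C2 * q\<^sup>2"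
    and h: "norm (h - v - n) \<le> C3 * q ^ 3"
    and L: "linear L" "\<And>e. norm (L e) \<le> l * norm e"
    and H: "\<And>u. linear (H u)" "\<And>w. linear (\<lambda>u. H u w)"
      "\<And>u w. norm (H u w) \<le> k * norm u * norm w"
    and \<Phi>: "norm (\<Phi> - L h - (1 / 2) *\<^sub>R H h h) \<le> B * norm h ^ 3"
    and nn: "0 \<le> C1" "0 \<le> C2" "0 \<le> C3" "0 \<le> l" "0 \<le> k" "0 \<le> B"
  defines "M2 \<equiv> C2 + C3 * Q"
  defines "M1 \<equiv> C1 + M2 * Q"
  shows "norm (\<Phi> - L v - L n - (1 / 2) *\<^sub>R H v v) \<le>
    (B * M1 ^ 3 + l * C3 + (k * M1 * M2 + k * M2 * C1) / 2) * q ^ 3"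
proof -
  have Q: "0 \<le> Q" using q by simp
  have M2: "0 \<le> M2" using nn Q by (simp add: M2_def)
  have M1: "0 \<le> M1" using nn Q M2 by (simp add: M1_def)
  have q3: "q ^ 3 \<le> Q * q\<^sup>2" and q2: "q\<^sup>2 \<le> Q * q"
    using q mult_right_mono[OF q(2), of "q * q"] mult_right_mono[OF q(2), of q]
    by (simp_all add: power3_eq_cube power2_eq_square mult.assoc)
  have "norm (h - v) \<le> norm (h - v - n) + norm n"
    using norm_triangle_ineq[of "h - v - n" n] by simp
  also have "\<dots> \<le> C3 * (Q * q\<^sup>2) + C2 * q\<^sup>2"
    using h n mult_left_mono[OF q3 nn(3)] by linarith
  finally have hv: "norm (h - v) \<le> M2 * q\<^sup>2" by (simp add: M2_def algebra_simps)
  have "norm h \<le> norm (h - v) + norm v"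
    using norm_triangle_ineq[of "h - v" v] by simp
  also have "\<dots> \<le> M2 * (Q * q) + C1 * q"
    using hv v mult_left_mono[OF q2 M2] by linarith
  finally have hq: "norm h \<le> M1 * q" by (simp add: M1_def algebra_simps)
  have "B * norm h ^ 3 \<le> B * (M1 * q) ^ 3"
    using hq nn by (intro mult_left_mono power_mono) auto
  then have 1: "norm (\<Phi> - L h - (1 / 2) *\<^sub>R H h h) \<le> B * M1 ^ 3 * q ^ 3"
    using \<Phi> by (simp add: power_mult_distrib)
  have 2: "norm (L (h - v - n)) \<le> l * C3 * q ^ 3"
    using L(2)[of "h - v - n"] mult_left_mono[OF h nn(4)] by simp
  have Hd: "H h h - H v v = H h (h - v) + H (h - v) v"
    using linear_diff[OF H(1), of h h v] linear_diff[OF H(2), of h v v] by simp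
  have a: "norm (H h (h - v)) \<le> k * (M1 * q) * (M2 * q\<^sup>2)"
    using H(3)[of h "h - v"] hq hv nn M1 M2 q
    by (meson mult_left_mono mult_mono mult_nonneg_nonneg norm_ge_zero order_trans)
  have b: "norm (H (h - v) v) \<le> k * (M2 * q\<^sup>2) * (C1 * q)"
    using H(3)[of "h - v" v] hv v nn M1 M2 q
    by (meson mult_left_mono mult_mono mult_nonneg_nonneg norm_ge_zero order_trans zero_le_power)
  have 3: "norm ((1 / 2) *\<^sub>R (H h h - H v v)) \<le> (k * M1 * M2 + k * M2 * C1) / 2 * q ^ 3"
  proof -
    have "norm (H h h - H v v) \<le> k * (M1 * q) * (M2 * q\<^sup>2) + k * (M2 * q\<^sup>2) * (C1 * q)"
      unfolding Hd using norm_triangle_ineq[of "H h (h - v)" "H (h - v) v"] a b by linarith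
    also have "\<dots> = (k * M1 * M2 + k * M2 * C1) * q ^ 3"
      by (simp add: power3_eq_cube power2_eq_square algebra_simps)
    finally show ?thesis by simp
  qed
  have "\<Phi> - L v - L n - (1 / 2) *\<^sub>R H v v =
      (\<Phi> - L h - (1 / 2) *\<^sub>R H h h) + L (h - v - n) + (1 / 2) *\<^sub>R (H h h - H v v)"
    by (simp add: linear_diff[OF L(1)] linear_add[OF L(1)] algebra_simps)
  also have "norm \<dots> \<le> norm (\<Phi> - L h - (1 / 2) *\<^sub>R H h h) + norm (L (h - v - n))
      + norm ((1 / 2) *\<^sub>R (H h h - H v v))"
    by (meson add_right_mono norm_triangle_ineq order_trans)
  also have "\<dots> \<le> B * M1 ^ 3 * q ^ 3 + l * C3 * q ^ 3 + (k * M1 * M2 + k * M2 * C1) / 2 * q ^ 3"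
    using 1 2 3 by linarith
  finally show ?thesis by (simp add: algebra_simps)
qed

text \<open>Here \<open>h\<close> is the unknown and \<open>\<Phi>\<close> is controlled up to order
  q^3. The hypothesis \<open>small\<close> breaks the circle: it bounds \<open>h\<close> by order q
  before the remainder, cubic in \<open>h\<close>, is used. The constants belong to |\<Phi> - v| <=
  M q^2, |h| <= M1 q and |h - v| <= M2 q^2, obtained in this order.\<close>

lemma backward_estimate:
  fixes h v n \<Phi> :: "'a::real_normed_vector"
  assumes q: "0 \<le> q" "q \<le> Q"
    and v: "norm v \<le> C1 * q" and n: "norm n \<le> C2 * q\<^sup>2"
    and \<Phi>q: "norm (\<Phi> - v - n - (1 / 2) *\<^sub>R H v v) \<le> C3 * q ^ 3"
    and H: "\<And>u. linear (H u)" "\<And>w. linear (\<lambda>u. H u w)"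
      "\<And>u w. norm (H u w) \<le> k * norm u * norm w"
    and \<Phi>: "norm (\<Phi> - h - (1 / 2) *\<^sub>R H h h) \<le> B * norm h ^ 3"
    and small: "norm h \<le> 2 * norm \<Phi>"
    and nn: "0 \<le> C1" "0 \<le> C2" "0 \<le> C3" "0 \<le> k" "0 \<le> B"
  defines "M \<equiv> C2 + k * C1 * C1 / 2 + C3 * Q"
  defines "M1 \<equiv> 2 * (C1 + M * Q)"
  defines "M2 \<equiv> M + k * M1 * M1 / 2 + B * M1 ^ 3 * Q"
  shows "norm (h - v - n) \<le> (B * M1 ^ 3 + C3 + (k * M1 * M2 + k * M2 * C1) / 2) * q ^ 3"
proof -
  have Q: "0 \<le> Q" using q by simp
  have M: "0 \<le> M" using nn Q by (simp add: M_def)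
  have M1: "0 \<le> M1" using nn Q M by (simp add: M1_def)
  have M2: "0 \<le> M2" using nn Q M M1 by (simp add: M2_def)
  have q3: "q ^ 3 \<le> Q * q\<^sup>2" and q2: "q\<^sup>2 \<le> Q * q"
    using q mult_right_mono[OF q(2), of "q * q"] mult_right_mono[OF q(2), of q]
    by (simp_all add: power3_eq_cube power2_eq_square mult.assoc)
  have Hb: "norm (H u w) \<le> k * a * b" if "norm u \<le> a" "norm w \<le> b" for u w a b
  proof -
    have "0 \<le> a" using that(1) norm_ge_zero[of u] by linarith
    then have "k * norm u * norm w \<le> k * a * b"
      using that nn by (intro mult_mono) auto
    then show ?thesis using H(3)[of u w] by linarith
  qed
  have Hvv: "norm ((1 / 2) *\<^sub>R H v v) \<le> k * C1 * C1 / 2 * q\<^sup>2"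
    using Hb[OF v v] by (simp add: power2_eq_square algebra_simps)
  have "\<Phi> - v = (\<Phi> - v - n - (1 / 2) *\<^sub>R H v v) + n + (1 / 2) *\<^sub>R H v v" by simp
  also have "norm \<dots> \<le> norm (\<Phi> - v - n - (1 / 2) *\<^sub>R H v v) + norm n + norm ((1 / 2) *\<^sub>R H v v)"
    by (meson add_right_mono norm_triangle_ineq order_trans)
  also have "\<dots> \<le> C3 * (Q * q\<^sup>2) + C2 * q\<^sup>2 + k * C1 * C1 / 2 * q\<^sup>2"
    using \<Phi>q n Hvv mult_left_mono[OF q3 nn(3)] by linarith
  finally have \<Phi>v: "norm (\<Phi> - v) \<le> M * q\<^sup>2" by (simp add: M_def algebra_simps)
  have "norm \<Phi> \<le> norm (\<Phi> - v) + norm v"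
    using norm_triangle_ineq[of "\<Phi> - v" v] by simp
  also have "\<dots> \<le> M * (Q * q) + C1 * q"
    using \<Phi>v v mult_left_mono[OF q2 M] by linarith
  finally have hq: "norm h \<le> M1 * q" using small by (simp add: M1_def algebra_simps)
  have Hhh: "norm ((1 / 2) *\<^sub>R H h h) \<le> k * M1 * M1 / 2 * q\<^sup>2"
    using Hb[OF hq hq] by (simp add: power2_eq_square algebra_simps)
  have "B * norm h ^ 3 \<le> B * (M1 * q) ^ 3"
    using hq nn by (intro mult_left_mono power_mono) auto
  then have 1: "norm (\<Phi> - h - (1 / 2) *\<^sub>R H h h) \<le> B * M1 ^ 3 * q ^ 3"
    using \<Phi> by (simp add: power_mult_distrib)
  have BM: "0 \<le> B * M1 ^ 3" using nn M1 by simp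
  have "h - v = (\<Phi> - v) - (\<Phi> - h - (1 / 2) *\<^sub>R H h h) - (1 / 2) *\<^sub>R H h h" by simp
  also have "norm \<dots> \<le> norm (\<Phi> - v) + norm (\<Phi> - h - (1 / 2) *\<^sub>R H h h) + norm ((1 / 2) *\<^sub>R H h h)"
    by (rule norm_diff_diff_le)
  also have "\<dots> \<le> M * q\<^sup>2 + B * M1 ^ 3 * (Q * q\<^sup>2) + k * M1 * M1 / 2 * q\<^sup>2"
    using \<Phi>v 1 Hhh mult_left_mono[OF q3 BM] by linarith
  finally have hv: "norm (h - v) \<le> M2 * q\<^sup>2" by (simp add: M2_def algebra_simps)
  have Hd: "H h h - H v v = H h (h - v) + H (h - v) v"
    using linear_diff[OF H(1), of h h v] linear_diff[OF H(2), of h v v] by simp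
  have 3: "norm ((1 / 2) *\<^sub>R (H h h - H v v)) \<le> (k * M1 * M2 + k * M2 * C1) / 2 * q ^ 3"
  proof -
    have "norm (H h h - H v v) \<le> k * (M1 * q) * (M2 * q\<^sup>2) + k * (M2 * q\<^sup>2) * (C1 * q)"
      unfolding Hd using norm_triangle_ineq[of "H h (h - v)" "H (h - v) v"] Hb[OF hq hv] Hb[OF hv v]
      by linarith
    also have "\<dots> = (k * M1 * M2 + k * M2 * C1) * q ^ 3"
      by (simp add: power3_eq_cube power2_eq_square algebra_simps)
    finally show ?thesis by simp
  qed
  have "h - v - n = (\<Phi> - v - n - (1 / 2) *\<^sub>R H v v) - (\<Phi> - h - (1 / 2) *\<^sub>R H h h)
      - (1 / 2) *\<^sub>R (H h h - H v v)"
    by (simp add: algebra_simps)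
  also have "norm \<dots> \<le> norm (\<Phi> - v - n - (1 / 2) *\<^sub>R H v v) + norm (\<Phi> - h - (1 / 2) *\<^sub>R H h h)
      + norm ((1 / 2) *\<^sub>R (H h h - H v v))"
    by (rule norm_diff_diff_le)
  also have "\<dots> \<le> C3 * q ^ 3 + B * M1 ^ 3 * q ^ 3 + (k * M1 * M2 + k * M2 * C1) / 2 * q ^ 3"
    using \<Phi>q 1 3 by linarith
  finally show ?thesis by (simp add: algebra_simps)
qed

section \<open>Contraction against the second level of the path\<close>

lemma contract_add: "contract (\<lambda>w w'. \<Xi> w w' + \<Xi>' w w') Z = contract \<Xi> Z + contract \<Xi>' Z"
  by (simp add: contract_def scaleR_add_right sum.distrib)

lemma linear_contract:
  assumes "linear L"
  shows "L (contract \<Xi> Z) = contract (\<lambda>w w'. L (\<Xi> w w')) Z"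
  by (simp add: contract_def linear_sum[OF assms] linear_scale[OF assms])

text \<open>A symmetric form takes the same value on a matrix and on its transpose, so it sees only
  the symmetric part, which is half of \<open>tensor x x\<close>. This is how weak geometricity
  enters.\<close>

lemma contract_symmetric:
  fixes \<Xi> :: "real^'k \<Rightarrow> real^'k \<Rightarrow> 'b::real_vector"
  assumes lin: "\<And>u. linear (\<Xi> u)" and sym: "\<And>u v. \<Xi> u v = \<Xi> v u"
    and X: "(1 / 2) *\<^sub>R (X + transpose X) = (1 / 2) *\<^sub>R tensor x x"
  shows "contract \<Xi> X = (1 / 2) *\<^sub>R \<Xi> x x"
proof -
  have lin': "linear (\<lambda>u. \<Xi> u v)" for v using lin[of v] sym[of _ v] by simp
  have "contract \<Xi> (transpose X) = contract \<Xi> X"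
    unfolding contract_def transpose_def
    by (subst sum.swap) (simp add: sym[of "axis _ 1" "axis _ 1"])
  moreover have "contract \<Xi> (X + transpose X) = contract \<Xi> X + contract \<Xi> (transpose X)"
    by (simp add: contract_def scaleR_add_left sum.distrib)
  moreover have "contract \<Xi> (tensor x x) = \<Xi> x x"
    using contract_sum_tensor[OF lin' lin, of "\<lambda>_. x" "\<lambda>_. x" "{()}"] by simp
  moreover have "X + transpose X = tensor x x" using X by simp
  ultimately have "\<Xi> x x = contract \<Xi> X + contract \<Xi> X" by simp
  then show ?thesis by (simp add: scaleR_2[symmetric])
qed

lemma norm_contract_le:
  fixes \<Xi> :: "real^'k \<Rightarrow> real^'k \<Rightarrow> 'b::real_normed_vector"
  assumes "\<And>i j. norm (\<Xi> (axis i 1) (axis j 1)) \<le> C i j"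
  shows "norm (contract \<Xi> Z) \<le> (\<Sum>i\<in>UNIV. \<Sum>j\<in>UNIV. C i j) * norm Z"
proof -
  have Z: "\<bar>Z $ i $ j\<bar> \<le> norm Z" for i j
    using Finite_Cartesian_Product.norm_nth_le[of "Z $ i" j] Finite_Cartesian_Product.norm_nth_le[of Z i] by simp
  have "norm (contract \<Xi> Z) \<le> (\<Sum>i\<in>UNIV. \<Sum>j\<in>UNIV. C i j * norm Z)"
    unfolding contract_def
  proof (intro sum_norm_le)
    fix i j
    have "norm ((Z $ i $ j) *\<^sub>R \<Xi> (axis i 1) (axis j 1)) \<le> norm Z * C i j"
      unfolding norm_scaleR using Z[of i j] assms[of i j] by (intro mult_mono) auto
    then show "norm ((Z $ i $ j) *\<^sub>R \<Xi> (axis i 1) (axis j 1)) \<le> C i j * norm Z"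
      by (simp add: mult.commute)
  qed
  then show ?thesis by (simp add: sum_distrib_right)
qed

section \<open>Localisation at a time\<close>

definition near_diag :: "real \<Rightarrow> real \<Rightarrow> real \<Rightarrow> (real \<times> real) filter" where
  "near_diag a b \<tau> = inf (nhds (\<tau>, \<tau>)) (principal {(s, t). a \<le> s \<and> s \<le> t \<and> t \<le> b})"

text \<open>The filter lets finitely many local requirements be combined without tracking radii;
  this is its concrete form, with boxes in place of discs around
  \<open>(\<tau>, \<tau>)\<close>.\<close>

lemma eventually_near_diag:
  "eventually P (near_diag a b \<tau>) \<longleftrightarrow>
    (\<exists>\<epsilon>>0. \<forall>s t. a \<le> s \<and> s \<le> t \<and> t \<le> b \<and> \<bar>s - \<tau>\<bar> < \<epsilon> \<and> \<bar>t - \<tau>\<bar> < \<epsilon> \<longrightarrow> P (s, t))"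
proof
  assume "eventually P (near_diag a b \<tau>)"
  then obtain d where d: "d > 0"
    "\<And>s t. dist (s, t) (\<tau>, \<tau>) < d \<Longrightarrow> a \<le> s \<and> s \<le> t \<and> t \<le> b \<Longrightarrow> P (s, t)"
    unfolding near_diag_def eventually_inf_principal eventually_nhds_metric by auto
  show "\<exists>\<epsilon>>0. \<forall>s t. a \<le> s \<and> s \<le> t \<and> t \<le> b \<and> \<bar>s - \<tau>\<bar> < \<epsilon> \<and> \<bar>t - \<tau>\<bar> < \<epsilon> \<longrightarrow> P (s, t)"
  proof (intro exI[of _ "d / 2"] conjI allI impI)
    fix s t assume st: "a \<le> s \<and> s \<le> t \<and> t \<le> b \<and> \<bar>s - \<tau>\<bar> < d / 2 \<and> \<bar>t - \<tau>\<bar> < d / 2"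
    have "dist (s, t) (\<tau>, \<tau>) \<le> \<bar>s - \<tau>\<bar> + \<bar>t - \<tau>\<bar>"
      unfolding dist_Pair_Pair dist_real_def using sqrt_sum_squares_le_sum_abs[of "\<bar>s - \<tau>\<bar>" "\<bar>t - \<tau>\<bar>"] by simp
    then show "P (s, t)" using st by (intro d(2)) auto
  qed (use d in simp)
next
  assume "\<exists>\<epsilon>>0. \<forall>s t. a \<le> s \<and> s \<le> t \<and> t \<le> b \<and> \<bar>s - \<tau>\<bar> < \<epsilon> \<and> \<bar>t - \<tau>\<bar> < \<epsilon> \<longrightarrow> P (s, t)"
  then obtain \<epsilon> where e: "\<epsilon> > 0"
    "\<And>s t. a \<le> s \<and> s \<le> t \<and> t \<le> b \<and> \<bar>s - \<tau>\<bar> < \<epsilon> \<and> \<bar>t - \<tau>\<bar> < \<epsilon> \<Longrightarrow> P (s, t)" by metis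
  show "eventually P (near_diag a b \<tau>)"
    unfolding near_diag_def eventually_inf_principal eventually_nhds_metric
  proof (intro exI[of _ \<epsilon>] conjI allI impI e(1))
    fix x assume x: "dist x (\<tau>, \<tau>) < \<epsilon>" "x \<in> {(s, t). a \<le> s \<and> s \<le> t \<and> t \<le> b}"
    obtain s t where st: "x = (s, t)" by (cases x)
    have "\<bar>s - \<tau>\<bar> < \<epsilon>" "\<bar>t - \<tau>\<bar> < \<epsilon>"
      using x(1) dist_fst_le[of x "(\<tau>, \<tau>)"] dist_snd_le[of x "(\<tau>, \<tau>)"] unfolding st dist_real_def by simp_all
    then show "P x" using x(2) e(2)[of s t] by (simp add: st)
  qed
qed

lemma near_diag_simplex: "\<forall>\<^sub>F (s, t) in near_diag a b \<tau>. a \<le> s \<and> s \<le> t \<and> t \<le> b"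
  unfolding eventually_near_diag by (auto intro!: exI[of _ 1])

lemma near_diag_of_uniform:
  assumes "\<delta> > 0" "\<And>s t. a \<le> s \<and> s \<le> t \<and> t \<le> b \<and> t - s \<le> \<delta> \<Longrightarrow> P s t"
  shows "\<forall>\<^sub>F (s, t) in near_diag a b \<tau>. P s t"
  unfolding eventually_near_diag
proof (intro exI[of _ "\<delta> / 2"] conjI allI impI)
  fix s t assume "a \<le> s \<and> s \<le> t \<and> t \<le> b \<and> \<bar>s - \<tau>\<bar> < \<delta> / 2 \<and> \<bar>t - \<tau>\<bar> < \<delta> / 2"
  then have "a \<le> s \<and> s \<le> t \<and> t \<le> b \<and> t - s \<le> \<delta>" by arith
  then show "case (s, t) of (s, t) \<Rightarrow> P s t" using assms(2) by simp
qed (use assms in simp)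

lemma near_diag_continuous:
  fixes y :: "real \<Rightarrow> 'a::topological_space"
  assumes "continuous_on {a..b} y" "\<tau> \<in> {a..b}" "open N" "y \<tau> \<in> N"
  shows "\<forall>\<^sub>F (s, t) in near_diag a b \<tau>. y s \<in> N \<and> y t \<in> N"
proof -
  obtain Z where Z: "open Z" "\<tau> \<in> Z" "\<And>t. t \<in> {a..b} \<Longrightarrow> t \<in> Z \<Longrightarrow> y t \<in> N"
    using assms unfolding continuous_on_topological by metis
  obtain e where e: "e > 0" "\<And>t. \<bar>t - \<tau>\<bar> < e \<Longrightarrow> t \<in> Z"
    using Z(1,2) unfolding open_dist dist_real_def by blast
  show ?thesis
    unfolding eventually_near_diag using e Z(3) by (intro exI[of _ e]) auto
qed

text \<open>Compactness of the interval leaves finitely many centres, and half a Lebesgue number of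
  the cover becomes \<open>\<delta>\<close>: two times that close lie in a common ball. Monotonicity
  lets one constant dominate the finitely many local ones; it is the sum of their absolute values,
  as they may be negative.\<close>

lemma uniform_of_near_diag:
  fixes P :: "real \<Rightarrow> real \<Rightarrow> real \<Rightarrow> bool"
  assumes local: "\<And>\<tau>. \<tau> \<in> {a..b} \<Longrightarrow> \<exists>C. \<forall>\<^sub>F (s, t) in near_diag a b \<tau>. P C s t"
    and mono: "\<And>C C' s t. a \<le> s \<Longrightarrow> s \<le> t \<Longrightarrow> t \<le> b \<Longrightarrow> C \<le> C' \<Longrightarrow> P C s t \<Longrightarrow> P C' s t"
  shows "\<exists>C. \<exists>\<delta>>0. \<forall>s t. a \<le> s \<and> s \<le> t \<and> t \<le> b \<and> t - s \<le> \<delta> \<longrightarrow> P C s t"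
proof -
  have "\<forall>\<tau>\<in>{a..b}. \<exists>C \<epsilon>. \<epsilon> > 0 \<and>
      (\<forall>s t. a \<le> s \<and> s \<le> t \<and> t \<le> b \<and> \<bar>s - \<tau>\<bar> < \<epsilon> \<and> \<bar>t - \<tau>\<bar> < \<epsilon> \<longrightarrow> P C s t)"
    using local unfolding eventually_near_diag by fastforce
  then obtain C \<epsilon> where C: "\<And>\<tau>. \<tau> \<in> {a..b} \<Longrightarrow> \<epsilon> \<tau> > 0"
    "\<And>\<tau> s t. \<tau> \<in> {a..b} \<Longrightarrow> a \<le> s \<Longrightarrow> s \<le> t \<Longrightarrow> t \<le> b \<Longrightarrow> \<bar>s - \<tau>\<bar> < \<epsilon> \<tau> \<Longrightarrow> \<bar>t - \<tau>\<bar> < \<epsilon> \<tau> \<Longrightarrow> P (C \<tau>) s t"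
    by metis
  have "{a..b} \<subseteq> (\<Union>\<tau>\<in>{a..b}. ball \<tau> (\<epsilon> \<tau>))" using C(1) by force
  then obtain J where J: "J \<subseteq> {a..b}" "finite J" "{a..b} \<subseteq> (\<Union>\<tau>\<in>J. ball \<tau> (\<epsilon> \<tau>))"
    by (rule compactE_image[OF compact_Icc, rotated]) auto
  obtain e where e: "e > 0" "\<And>s. s \<in> {a..b} \<Longrightarrow> \<exists>G\<in>(\<lambda>\<tau>. ball \<tau> (\<epsilon> \<tau>)) ` J. ball s e \<subseteq> G"
    by (rule Heine_Borel_lemma[OF compact_Icc, of a b "(\<lambda>\<tau>. ball \<tau> (\<epsilon> \<tau>)) ` J"]) (use J in auto)
  show ?thesis
  proof (rule exI[of _ "\<Sum>\<tau>\<in>J. \<bar>C \<tau>\<bar>"], rule exI[of _ "e / 2"], intro conjI allI impI)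
    fix s t assume st: "a \<le> s \<and> s \<le> t \<and> t \<le> b \<and> t - s \<le> e / 2"
    then obtain \<tau> where \<tau>: "\<tau> \<in> J" "ball s e \<subseteq> ball \<tau> (\<epsilon> \<tau>)" using e(2)[of s] by auto
    have "s \<in> ball s e" "t \<in> ball s e" using st e(1) by (auto simp: dist_real_def)
    then have "s \<in> ball \<tau> (\<epsilon> \<tau>)" "t \<in> ball \<tau> (\<epsilon> \<tau>)" using \<tau>(2) by blast+
    then have "\<bar>s - \<tau>\<bar> < \<epsilon> \<tau>" "\<bar>t - \<tau>\<bar> < \<epsilon> \<tau>" by (simp_all add: dist_real_def abs_minus_commute)
    then have "P (C \<tau>) s t" using C(2)[of \<tau> s t] st \<tau>(1) J(1) by auto
    moreover have "C \<tau> \<le> (\<Sum>\<tau>\<in>J. \<bar>C \<tau>\<bar>)"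
      using member_le_sum[of \<tau> J "\<lambda>\<tau>. \<bar>C \<tau>\<bar>"] \<tau>(1) J(2) by force
    ultimately show "P (\<Sum>\<tau>\<in>J. \<bar>C \<tau>\<bar>) s t" using mono st by blast
  qed (use e in simp)
qed

text \<open>This form fixes the constant before the data: \<open>L\<close>, \<open>H\<close> and the
  vectors depend on the pair of times, but the constant must not.\<close>

lemma forward_estimate_uniform:
  assumes "0 \<le> Q" "0 \<le> C1" "0 \<le> C2" "0 \<le> C3" "0 \<le> l" "0 \<le> k" "0 \<le> B"
  obtains M where "\<And>q h v n (\<Phi>::'b::real_normed_vector) (L::'a::real_normed_vector \<Rightarrow> 'b) H.
    0 \<le> q \<Longrightarrow> q \<le> Q \<Longrightarrow> norm v \<le> C1 * q \<Longrightarrow> norm n \<le> C2 * q\<^sup>2 \<Longrightarrow>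
    norm (h - v - n) \<le> C3 * q ^ 3 \<Longrightarrow>
    linear L \<Longrightarrow> (\<And>e. norm (L e) \<le> l * norm e) \<Longrightarrow>
    (\<And>u. linear (H u)) \<Longrightarrow> (\<And>w. linear (\<lambda>u. H u w)) \<Longrightarrow>
    (\<And>u w. norm (H u w) \<le> k * norm u * norm w) \<Longrightarrow>
    norm (\<Phi> - L h - (1 / 2) *\<^sub>R H h h) \<le> B * norm h ^ 3 \<Longrightarrow>
    norm (\<Phi> - L v - L n - (1 / 2) *\<^sub>R H v v) \<le> M * q ^ 3"
proof (rule that)
  fix q h v n and \<Phi> :: 'b and L :: "'a \<Rightarrow> 'b" and H
  assume prems: "0 \<le> q" "q \<le> Q" "norm v \<le> C1 * q" "norm n \<le> C2 * q\<^sup>2"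
    "norm (h - v - n) \<le> C3 * q ^ 3" "linear L" "\<And>e. norm (L e) \<le> l * norm e"
    "\<And>u. linear (H u)" "\<And>w. linear (\<lambda>u. H u w)" "\<And>u w. norm (H u w) \<le> k * norm u * norm w"
    "norm (\<Phi> - L h - (1 / 2) *\<^sub>R H h h) \<le> B * norm h ^ 3"
  show "norm (\<Phi> - L v - L n - (1 / 2) *\<^sub>R H v v) \<le>
    (B * (C1 + (C2 + C3 * Q) * Q) ^ 3 + l * C3 +
      (k * (C1 + (C2 + C3 * Q) * Q) * (C2 + C3 * Q) + k * (C2 + C3 * Q) * C1) / 2) * q ^ 3"
    by (rule forward_estimate[OF prems assms(2-)])
qed

lemma backward_estimate_uniform:
  assumes "0 \<le> Q" "0 \<le> C1" "0 \<le> C2" "0 \<le> C3" "0 \<le> k" "0 \<le> B"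
  obtains M where "\<And>q h v n (\<Phi>::'a::real_normed_vector) H.
    0 \<le> q \<Longrightarrow> q \<le> Q \<Longrightarrow> norm v \<le> C1 * q \<Longrightarrow> norm n \<le> C2 * q\<^sup>2 \<Longrightarrow>
    norm (\<Phi> - v - n - (1 / 2) *\<^sub>R H v v) \<le> C3 * q ^ 3 \<Longrightarrow>
    (\<And>u. linear (H u)) \<Longrightarrow> (\<And>w. linear (\<lambda>u. H u w)) \<Longrightarrow>
    (\<And>u w. norm (H u w) \<le> k * norm u * norm w) \<Longrightarrow>
    norm (\<Phi> - h - (1 / 2) *\<^sub>R H h h) \<le> B * norm h ^ 3 \<Longrightarrow> norm h \<le> 2 * norm \<Phi> \<Longrightarrow>
    norm (h - v - n) \<le> M * q ^ 3"
proof -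
  define N where "N = C2 + k * C1 * C1 / 2 + C3 * Q"
  define N1 where "N1 = 2 * (C1 + N * Q)"
  define N2 where "N2 = N + k * N1 * N1 / 2 + B * N1 ^ 3 * Q"
  show ?thesis
  proof (rule that)
    fix q :: real and h v n \<Phi> :: 'a and H
    assume prems: "0 \<le> q" "q \<le> Q" "norm v \<le> C1 * q" "norm n \<le> C2 * q\<^sup>2"
      "norm (\<Phi> - v - n - (1 / 2) *\<^sub>R H v v) \<le> C3 * q ^ 3"
      "\<And>u. linear (H u)" "\<And>w. linear (\<lambda>u. H u w)" "\<And>u w. norm (H u w) \<le> k * norm u * norm w"
      "norm (\<Phi> - h - (1 / 2) *\<^sub>R H h h) \<le> B * norm h ^ 3" "norm h \<le> 2 * norm \<Phi>"
    show "norm (h - v - n) \<le> (B * N1 ^ 3 + C3 + (k * N1 * N2 + k * N2 * C1) / 2) * q ^ 3"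
      unfolding N2_def N1_def N_def by (rule backward_estimate[OF prems assms(2-)])
  qed
qed

section \<open>The setting around one time\<close>

lemma Ck_on_smooth_fun:
  assumes "smooth_fun_on A UNIV f" "c \<in> A"
  shows "Ck_on k (cmap c ` cdom c) (\<lambda>z. f (cinv c z))"
  using assms by (simp add: smooth_fun_on_def smooth_on_def o_def)

text \<open>The time \<open>\<tau>\<close> is the point of localisation. The closed ball of radius
  \<open>\<rho>\<close> is compact, so that derivatives are uniformly bounded on it, and convex, as
  Taylor's formula along segments requires.\<close>

locale rde_chart = gauge_chart A D \<psi> U c W
  for A :: "('m::{t2_space, second_countable_topology}, 'e::euclidean_space) chart set"
    and D :: "('m \<times> 'm) set"
    and \<psi> :: "'m \<Rightarrow> 'm \<Rightarrow> ('m, 'e) tvec"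
    and U :: "'m \<Rightarrow> 'm \<Rightarrow> ('m, 'e) tvec \<Rightarrow> ('m, 'e) tvec"
    and c :: "('m, 'e) chart" and W :: "'e set" +
  fixes g :: "'m \<Rightarrow> ('m, 'e) tvec \<Rightarrow> ('m, 'e) tvec \<Rightarrow> real"
    and p T :: real
    and \<omega> :: "real \<Rightarrow> real \<Rightarrow> real"
    and x :: "real \<Rightarrow> real^'k"
    and X :: "real \<Rightarrow> real \<Rightarrow> real^'k^'k"
    and F :: "real^'k \<Rightarrow> 'm \<Rightarrow> ('m, 'e) tvec"
    and y :: "real \<Rightarrow> 'm" and a b \<tau> \<rho> :: real
  assumes g: "riemannian_metric A g" and p: "1 \<le> p"
    and control: "rp_control T \<omega>" and rough: "weak_geometric_rough_path p T \<omega> x X"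
    and F: "linear_vector_fields A F"
    and ab: "0 \<le> a" "b \<le> T" and y: "continuous_on {a..b} y"
    and \<tau>: "\<tau> \<in> {a..b}" "y \<tau> \<in> cdom c"
    and \<rho>: "\<rho> > 0" "cball (cmap c (y \<tau>)) \<rho> \<subseteq> W"
begin

abbreviation K where "K \<equiv> cball (cmap c (y \<tau>)) \<rho>"
abbreviation V where "V w z \<equiv> F w (cinv c z) c"
abbreviation z where "z t \<equiv> cmap c (y t)"
abbreviation q where "q s t \<equiv> \<omega> s t powr (1 / p)"

text \<open>The second-order term of the Davie (Milstein) expansion in coordinates. The field of the
  second index is differentiated along that of the first, as in the iterated Lie derivative.\<close>

definition correction :: "'e \<Rightarrow> real^'k^'k \<Rightarrow> 'e" where
  "correction \<zeta> Z = contract (\<lambda>w w'. ddir (V w \<zeta>) (V w') \<zeta>) Z"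

definition chart_estimate :: bool where
  "chart_estimate \<longleftrightarrow> (\<exists>C. \<forall>\<^sub>F (s, t) in near_diag a b \<tau>.
     norm (z t - z s - V (x t - x s) (z s) - correction (z s) (X s t)) \<le> C * \<omega> s t powr (3 / p))"

definition test_estimate :: "('m \<Rightarrow> real) \<Rightarrow> bool" where
  "test_estimate f \<longleftrightarrow> (\<exists>C. \<forall>\<^sub>F (s, t) in near_diag a b \<tau>.
     \<bar>f (y t) - f (y s) - lie_deriv A (F (x t - x s)) f (y s)
       - contract (\<lambda>w w'. lie_deriv A (F w) (lie_deriv A (F w') f) (y s)) (X s t)\<bar>
     \<le> C * \<omega> s t powr (3 / p))"

text \<open>The bound \<open>c\<close> ranges over all charts and hides the fixed chart of the
  locale, so this is a whole tangent vector.\<close>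

definition gauge_increment :: "real \<Rightarrow> real \<Rightarrow> ('m, 'e) tvec" where
  "gauge_increment s t = (\<lambda>c. F (x t - x s) (y s) c +
     contract (\<lambda>w w'.
         - compat_tensor A \<psi> U (y s) (F w (y s)) (F w' (y s)) c
         + tderiv A (\<lambda>n. U (y s) n (F w' n)) (y s) (F w (y s)) c)
       (X s t))"

text \<open>Membership in \<open>D\<close> is part of the estimate, because outside \<open>D\<close>
  the values of \<psi> mean nothing.\<close>

definition gauge_estimate :: bool where
  "gauge_estimate \<longleftrightarrow> (\<exists>C. \<forall>\<^sub>F (s, t) in near_diag a b \<tau>. (y s, y t) \<in> D \<and>
     metric_norm g (y s) (lincomb 1 (\<psi> (y s) (y t)) (-1) (gauge_increment s t)) \<le> C * \<omega> s t powr (3 / p))"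

lemma field: "smooth_vector_field A (F w)"
  using F by (simp add: linear_vector_fields_def)

lemma F_tangent: "F w m \<in> tangent_space A m"
  using field by (simp add: smooth_vector_field_def)

lemma linear_V: "linear (\<lambda>w. V w \<zeta>)"
proof -
  have lc: "V (r *\<^sub>R w + r' *\<^sub>R w') \<zeta> = r *\<^sub>R V w \<zeta> + r' *\<^sub>R V w' \<zeta>" for r r' w w'
    using F by (simp add: linear_vector_fields_def lincomb_def)
  show ?thesis
    by (rule linearI) (use lc[of 1 _ 1] lc[of _ _ 0] in simp_all)
qed

lemma K_sub: "K \<subseteq> W" "K \<subseteq> cmap c ` cdom c"
  using \<rho> W_sub by auto

lemma Ck_on_V: "Ck_on k (cmap c ` cdom c) (V w)"
  by (rule Ck_on_vector_field[OF A c field])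

lemma V_bound:
  obtains C where "C \<ge> 0" "\<And>\<zeta> w. \<zeta> \<in> K \<Longrightarrow> norm (V w \<zeta>) \<le> C * norm w"
proof -
  have "\<exists>B\<ge>0. \<forall>\<zeta>\<in>K. norm (V w \<zeta>) \<le> B" for w
    using continuous_on_compact_bound[OF compact_cball
        continuous_on_subset[OF Ck_on_continuous[OF Ck_on_V] K_sub(2)]] by metis
  then obtain B where B: "\<And>w. B w \<ge> 0" "\<And>w \<zeta>. \<zeta> \<in> K \<Longrightarrow> norm (V w \<zeta>) \<le> B w" by metis
  show ?thesis
  proof (rule that[of "sum B Basis"])
    show "norm (V w \<zeta>) \<le> sum B Basis * norm w" if "\<zeta> \<in> K" for \<zeta> w
    proof -
      have "norm (\<Sum>e\<in>Basis. (w \<bullet> e) *\<^sub>R V e \<zeta>) \<le> sum B Basis * norm w"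
        by (rule norm_sum_Basis_le) (rule B(2)[OF that])
      then show ?thesis by (simp only: linear_expand_Basis[OF linear_V, of w, symmetric])
    qed
  qed (simp add: B sum_nonneg)
qed

lemma correction_bound:
  obtains C where "C \<ge> 0" "\<And>\<zeta> Z. \<zeta> \<in> K \<Longrightarrow> norm (correction \<zeta> Z) \<le> C * norm Z"
proof -
  obtain C1 where C1: "C1 \<ge> 0" "\<And>\<zeta> w. \<zeta> \<in> K \<Longrightarrow> norm (V w \<zeta>) \<le> C1 * norm w"
    using V_bound by metis
  have "\<exists>B\<ge>0. \<forall>\<zeta>\<in>K. \<forall>v. norm (ddir v (V w) \<zeta>) \<le> B * norm v" for w
    using ddir_bound[OF Ck_on_V compact_cball K_sub(2)] by metis
  then obtain B where B: "\<And>w. B w \<ge> 0" "\<And>w \<zeta> v. \<zeta> \<in> K \<Longrightarrow> norm (ddir v (V w) \<zeta>) \<le> B w * norm v"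
    by metis
  define C where "C i j = B (axis j 1) * C1" for i j :: 'k
  show ?thesis
  proof (rule that)
    show "0 \<le> (\<Sum>i\<in>UNIV. \<Sum>j\<in>UNIV. C i j)"
      using B C1 by (intro sum_nonneg) (simp add: C_def)
    fix \<zeta> Z assume \<zeta>: "\<zeta> \<in> K"
    show "norm (correction \<zeta> Z) \<le> (\<Sum>i\<in>UNIV. \<Sum>j\<in>UNIV. C i j) * norm Z"
      unfolding correction_def
    proof (rule norm_contract_le)
      fix i j :: 'k
      have "norm (V (axis i 1) \<zeta>) \<le> C1" using C1(2)[OF \<zeta>, of "axis i 1"] by simp
      then show "norm (ddir (V (axis i 1) \<zeta>) (V (axis j 1)) \<zeta>) \<le> C i j"
        unfolding C_def using B(2)[OF \<zeta>, where v="V (axis i 1) \<zeta>" and w="axis j 1"] B(1)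
        by (meson mult_left_mono order_trans)
    qed
  qed
qed

text \<open>Continuity of \<open>y\<close> enters here. The free radius \<open>\<eta>\<close> serves
  two purposes: to stay where a cutoff coordinate agrees with the coordinate, and to make the
  increment small enough to absorb a Taylor error.\<close>

lemma near_chart:
  assumes "\<eta> > 0"
  shows "\<forall>\<^sub>F (s, t) in near_diag a b \<tau>. (0 \<le> s \<and> s \<le> t \<and> t \<le> T) \<and> y s \<in> cdom c \<and> y t \<in> cdom c \<and>
    z s \<in> K \<and> z t \<in> K \<and> z s \<in> ball (z \<tau>) \<eta> \<and> z t \<in> ball (z \<tau>) \<eta> \<and> norm (z t - z s) \<le> \<eta>"
proof -
  define r where "r = min \<rho> (\<eta> / 2)"
  let ?B = "ball (z \<tau>) r"
  have r: "r > 0" using assms \<rho> by (simp add: r_def)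
  have sub: "?B \<subseteq> K" by (auto simp: r_def)
  have cz: "cinv c (z \<tau>) = y \<tau>" using cinv_cmap[OF A c] \<tau> by simp
  have "open (cinv c ` ?B)" by (rule open_cinv_image) (use sub K_sub in auto)
  moreover have "y \<tau> \<in> cinv c ` ?B" using cz r by (metis centre_in_ball image_eqI)
  ultimately have "\<forall>\<^sub>F (s, t) in near_diag a b \<tau>. y s \<in> cinv c ` ?B \<and> y t \<in> cinv c ` ?B"
    by (rule near_diag_continuous[OF y \<tau>(1)])
  with near_diag_simplex[of a b \<tau>] show ?thesis
  proof eventually_elim
    case (elim st)
    obtain s t where st: "st = (s, t)" by (cases st)
    have *: "y r' \<in> cdom c \<and> z r' \<in> ?B" if "y r' \<in> cinv c ` ?B" for r'
      using that sub K_sub W_cdom W_cmap by auto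
    have s: "y s \<in> cdom c" "z s \<in> ?B" and t: "y t \<in> cdom c" "z t \<in> ?B"
      using elim(2) * by (simp_all add: st)
    have "dist (z \<tau>) (z s) < \<eta> / 2" "dist (z \<tau>) (z t) < \<eta> / 2"
      using s(2) t(2) by (simp_all add: r_def)
    then have "dist (z t) (z s) < \<eta>" using dist_triangle_half_r by blast
    then have "norm (z t - z s) \<le> \<eta>" by (simp add: dist_norm)
    moreover have "?B \<subseteq> ball (z \<tau>) \<eta>" using assms by (auto simp: r_def)
    ultimately show ?case using elim(1) s t sub ab by (auto simp: st)
  qed
qed

text \<open>Superadditivity of the control bounds \<open>q s t\<close> by \<open>q 0 T\<close>,
  which plays the role of \<open>Q\<close> in the perturbation estimates.\<close>

lemma rough_bounds:
  assumes "0 \<le> s \<and> s \<le> t \<and> t \<le> T"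
  shows "0 \<le> q s t" "q s t \<le> q 0 T" "norm (x t - x s) \<le> q s t" "norm (X s t) \<le> (q s t)\<^sup>2"
    "\<omega> s t powr (3 / p) = q s t ^ 3"
    "(1 / 2) *\<^sub>R (X s t + transpose (X s t)) = (1 / 2) *\<^sub>R tensor (x t - x s) (x t - x s)"
proof -
  have st: "(s, t) \<in> simplex2 T" using assms by (simp add: simplex2_def)
  have nn: "0 \<le> \<omega> u v" if "0 \<le> u" "u \<le> v" "v \<le> T" for u v
    using control that unfolding rp_control_def simplex2_def by auto
  have add: "\<omega> u v + \<omega> v w \<le> \<omega> u w" if "0 \<le> u" "u \<le> v" "v \<le> w" "w \<le> T" for u v w
    using control that unfolding rp_control_def by blast
  have "\<omega> s t \<le> \<omega> 0 T"
    using add[of 0 s t] add[of 0 t T] nn[of 0 s] nn[of t T] assms by linarith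
  then show "q s t \<le> q 0 T"
    using nn[of s t] assms p by (intro powr_mono2) auto
  show "0 \<le> q s t" by simp
  \<comment> \<open>The exponent must be positive: \<open>q s t\<close> may be 0, and
    \<open>0 powr 0 = 0\<close> whereas \<open>0 ^ 0 = 1\<close>.\<close>
  have pow: "(q s t) ^ n = \<omega> s t powr (n / p)" if "n > 0" for n :: nat
  proof -
    have "(q s t) ^ n = (q s t) powr real n" using that by (simp add: powr_realpow')
    then show ?thesis by (simp add: powr_powr)
  qed
  show "norm (x t - x s) \<le> q s t"
    using rough st unfolding weak_geometric_rough_path_def by blast
  have "norm (X s t) \<le> \<omega> s t powr (2 / p)"
    using rough st unfolding weak_geometric_rough_path_def by blast
  then show "norm (X s t) \<le> (q s t)\<^sup>2" using pow[of 2] by simp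
  show "\<omega> s t powr (3 / p) = q s t ^ 3" using pow[of 3] by simp
  show "(1 / 2) *\<^sub>R (X s t + transpose (X s t)) = (1 / 2) *\<^sub>R tensor (x t - x s) (x t - x s)"
    using rough st unfolding weak_geometric_rough_path_def by blast
qed

lemma contract_second_order:
  assumes H: "\<And>u. linear (H u)" "\<And>u v. H u v = H v u" and st: "0 \<le> s \<and> s \<le> t \<and> t \<le> T"
  shows "contract (\<lambda>w w'. H (V w \<zeta>) (V w' \<zeta>)) (X s t) =
    (1 / 2) *\<^sub>R H (V (x t - x s) \<zeta>) (V (x t - x s) \<zeta>)"
proof (rule contract_symmetric[OF _ _ rough_bounds(6)[OF st]])
  show "linear (\<lambda>w'. H (V w \<zeta>) (V w' \<zeta>))" for w
    using linear_compose[OF linear_V H(1)] by (simp add: o_def)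
qed (rule H(2))

section \<open>Test functions in the chart\<close>

lemma lie_deriv_chart:
  assumes f: "smooth_fun_on A UNIV f" and m: "m \<in> cdom c"
  shows "lie_deriv A (F w) f m = ddir (V w (cmap c m)) (\<lambda>z. f (cinv c z)) (cmap c m)"
    and "lie_deriv A (F w) (lie_deriv A (F w') f) m =
      ddir (ddir (V w (cmap c m)) (V w') (cmap c m)) (\<lambda>z. f (cinv c z)) (cmap c m) +
      ddir (V w (cmap c m)) (ddir (V w' (cmap c m)) (\<lambda>z. f (cinv c z))) (cmap c m)"
proof -
  have "(\<lambda>z. f (cinv c z)) differentiable (at (cmap c m))"
    by (rule Ck_on_differentiable[OF Ck_on_smooth_fun[OF f c]]) (use m in simp)
  then show "lie_deriv A (F w) f m = ddir (V w (cmap c m)) (\<lambda>z. f (cinv c z)) (cmap c m)"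
    using lie_deriv_coord[OF A c m field] cinv_cmap[OF A c m] by simp
  show "lie_deriv A (F w) (lie_deriv A (F w') f) m =
      ddir (ddir (V w (cmap c m)) (V w') (cmap c m)) (\<lambda>z. f (cinv c z)) (cmap c m) +
      ddir (V w (cmap c m)) (ddir (V w' (cmap c m)) (\<lambda>z. f (cinv c z))) (cmap c m)"
    using lie_deriv_lie_deriv_coord[OF A c m field field Ck_on_smooth_fun[OF f c]] cinv_cmap[OF A c m]
    by simp
qed

text \<open>The derivative of \<open>f\<close> is linear, so it can be pulled out of the contraction
  of the first summand; the vector it is then applied to is the correction.\<close>

lemma test_expansion_chart:
  assumes f: "smooth_fun_on A UNIV f" and m: "m \<in> cdom c"
  defines "f' \<equiv> \<lambda>z. f (cinv c z)"
  shows "contract (\<lambda>w w'. lie_deriv A (F w) (lie_deriv A (F w') f) m) Z =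
    ddir (correction (cmap c m) Z) f' (cmap c m) +
    contract (\<lambda>w w'. ddir (V w (cmap c m)) (ddir (V w' (cmap c m)) f') (cmap c m)) Z"
proof -
  have "linear (\<lambda>v. ddir v f' (cmap c m))"
    unfolding f'_def by (rule linear_ddir[OF Ck_on_smooth_fun[OF f c]]) (use m in simp)
  then show ?thesis
    unfolding lie_deriv_chart(2)[OF f m] contract_add correction_def f'_def
    by (simp add: linear_contract)
qed

lemma chart_estimate_imp_test_estimate:
  assumes est: chart_estimate and f: "smooth_fun_on A UNIV f"
  shows "test_estimate f"
proof -
  let ?S = "cmap c ` cdom c" and ?f = "\<lambda>z. f (cinv c z)"
  note Cf = Ck_on_smooth_fun[OF f c]
  note oS = open_cimage[OF A c]
  obtain C where C: "\<forall>\<^sub>F (s, t) in near_diag a b \<tau>.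
     norm (z t - z s - V (x t - x s) (z s) - correction (z s) (X s t)) \<le> C * \<omega> s t powr (3 / p)"
    using est unfolding chart_estimate_def by blast
  obtain C1 where C1: "C1 \<ge> 0" "\<And>\<zeta> w. \<zeta> \<in> K \<Longrightarrow> norm (V w \<zeta>) \<le> C1 * norm w"
    using V_bound by metis
  obtain C2 where C2: "C2 \<ge> 0" "\<And>\<zeta> Z. \<zeta> \<in> K \<Longrightarrow> norm (correction \<zeta> Z) \<le> C2 * norm Z"
    using correction_bound by metis
  obtain B where B: "B \<ge> 0" "\<And>z0 z1. z0 \<in> K \<Longrightarrow> z1 \<in> K \<Longrightarrow>
    norm (?f z1 - ?f z0 - ddir (z1 - z0) ?f z0 - (1 / 2) *\<^sub>R ddir (z1 - z0) (ddir (z1 - z0) ?f) z0)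
      \<le> B * norm (z1 - z0) ^ 3"
    using taylor3[OF oS Cf compact_cball convex_cball K_sub(2)] by metis
  obtain l where l: "l \<ge> 0" "\<And>\<zeta> v. \<zeta> \<in> K \<Longrightarrow> norm (ddir v ?f \<zeta>) \<le> l * norm v"
    using ddir_bound[OF Cf compact_cball K_sub(2)] by metis
  obtain k where k: "k \<ge> 0" "\<And>\<zeta> v w. \<zeta> \<in> K \<Longrightarrow> norm (ddir w (ddir v ?f) \<zeta>) \<le> k * norm v * norm w"
    using ddir2_bound[OF oS Cf compact_cball K_sub(2)] by metis
  \<comment> \<open>\<open>M\<close> is fixed here, before any pair of times. The given
    \<open>C\<close> may be negative, hence its absolute value.\<close>
  obtain M where M: "\<And>r h v n \<Phi> (L::'e \<Rightarrow> real) H.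
    0 \<le> r \<Longrightarrow> r \<le> q 0 T \<Longrightarrow> norm v \<le> C1 * r \<Longrightarrow> norm n \<le> C2 * r\<^sup>2 \<Longrightarrow>
    norm (h - v - n) \<le> \<bar>C\<bar> * r ^ 3 \<Longrightarrow>
    linear L \<Longrightarrow> (\<And>e. norm (L e) \<le> l * norm e) \<Longrightarrow>
    (\<And>u. linear (H u)) \<Longrightarrow> (\<And>w. linear (\<lambda>u. H u w)) \<Longrightarrow>
    (\<And>u w. norm (H u w) \<le> k * norm u * norm w) \<Longrightarrow>
    norm (\<Phi> - L h - (1 / 2) *\<^sub>R H h h) \<le> B * norm h ^ 3 \<Longrightarrow>
    norm (\<Phi> - L v - L n - (1 / 2) *\<^sub>R H v v) \<le> M * r ^ 3"
    by (rule forward_estimate_uniform[OF powr_ge_zero C1(1) C2(1) abs_ge_zero[of C] l(1) k(1) B(1)]) blast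
  have "\<forall>\<^sub>F (s, t) in near_diag a b \<tau>.
     \<bar>f (y t) - f (y s) - lie_deriv A (F (x t - x s)) f (y s)
       - contract (\<lambda>w w'. lie_deriv A (F w) (lie_deriv A (F w') f) (y s)) (X s t)\<bar>
     \<le> M * \<omega> s t powr (3 / p)"
    using C near_chart[OF zero_less_one]
  proof eventually_elim
    case (elim st)
    obtain s t where st: "st = (s, t)" by (cases st)
    have tr: "0 \<le> s \<and> s \<le> t \<and> t \<le> T" and ys: "y s \<in> cdom c" and yt: "y t \<in> cdom c"
      and zK: "z s \<in> K" "z t \<in> K"
      using elim(2) by (auto simp: st)
    have zS: "z s \<in> ?S" using ys by simp
    note rb = rough_bounds[OF tr]
    define H where "H u w = ddir w (ddir u ?f) (z s)" for u w
    have H1: "linear (H u)" for u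
      unfolding H_def by (rule linear_ddir[OF Ck_on_ddir[OF Cf] zS])
    have H2: "linear (\<lambda>u. H u w)" for w
      unfolding H_def by (rule linear_ddir_ddir[OF oS Cf zS])
    have Hsym: "H u w = H w u" for u w
      unfolding H_def by (rule ddir_commute[OF oS Cf zS])
    let ?v = "V (x t - x s) (z s)" and ?n = "correction (z s) (X s t)"
    have "norm (z t - z s - ?v - ?n) \<le> C * q s t ^ 3"
      using elim(1) by (simp add: st rb(5))
    also have "\<dots> \<le> \<bar>C\<bar> * q s t ^ 3" using rb(1) by (intro mult_right_mono) auto
    finally have h: "norm (z t - z s - ?v - ?n) \<le> \<bar>C\<bar> * q s t ^ 3" .
    have v: "norm ?v \<le> C1 * q s t"
      using C1(2)[OF zK(1)] mult_left_mono[OF rb(3) C1(1)] by (rule order_trans)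
    have n: "norm ?n \<le> C2 * (q s t)\<^sup>2"
      using C2(2)[OF zK(1)] mult_left_mono[OF rb(4) C2(1)] by (rule order_trans)
    have M': "norm (?f (z t) - ?f (z s) - ddir ?v ?f (z s) - ddir ?n ?f (z s) - (1 / 2) *\<^sub>R H ?v ?v) \<le> M * q s t ^ 3"
    proof (rule M[where L="\<lambda>v. ddir v ?f (z s)" and H=H, OF rb(1,2) v n h])
      show "linear (\<lambda>v. ddir v ?f (z s))" by (rule linear_ddir[OF Cf zS])
      show "norm (ddir e ?f (z s)) \<le> l * norm e" for e by (rule l(2)[OF zK(1)])
      show "norm (H u w) \<le> k * norm u * norm w" for u w
        unfolding H_def by (rule k(2)[OF zK(1)])
      show "norm (?f (z t) - ?f (z s) - ddir (z t - z s) ?f (z s) - (1 / 2) *\<^sub>R H (z t - z s) (z t - z s))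
          \<le> B * norm (z t - z s) ^ 3"
        unfolding H_def by (rule B(2)[OF zK])
    qed (rule H1 H2)+
    have "contract (\<lambda>w w'. ddir (V w (z s)) (ddir (V w' (z s)) ?f) (z s)) (X s t) = (1 / 2) *\<^sub>R H ?v ?v"
    proof -
      \<comment> \<open>\<open>H\<close> differentiates along its first argument first, the iterated
        Lie derivative along the field of \<open>w'\<close> first; symmetry of second derivatives
        reconciles the two.\<close>
      have "(\<lambda>w w'. ddir (V w (z s)) (ddir (V w' (z s)) ?f) (z s)) = (\<lambda>w w'. H (V w (z s)) (V w' (z s)))"
        unfolding H_def by (intro ext) (rule ddir_commute[OF oS Cf zS])
      then show ?thesis using contract_second_order[OF H1 Hsym tr, of "z s"] by (simp only:)
    qed
    then have e2: "contract (\<lambda>w w'. lie_deriv A (F w) (lie_deriv A (F w') f) (y s)) (X s t) =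
        ddir ?n ?f (z s) + (1 / 2) *\<^sub>R H ?v ?v"
      by (simp only: test_expansion_chart[OF f ys])
    have fz: "?f (z s) = f (y s)" "?f (z t) = f (y t)"
      using cinv_cmap[OF A c ys] cinv_cmap[OF A c yt] by simp_all
    have "f (y t) - f (y s) - lie_deriv A (F (x t - x s)) f (y s)
       - contract (\<lambda>w w'. lie_deriv A (F w) (lie_deriv A (F w') f) (y s)) (X s t) =
      ?f (z t) - ?f (z s) - ddir ?v ?f (z s) - ddir ?n ?f (z s) - (1 / 2) *\<^sub>R H ?v ?v"
      unfolding e2 fz lie_deriv_chart(1)[OF f ys] by simp
    with M' show ?case
      unfolding st prod.case rb(5) real_norm_def by (simp only:)
  qed
  then show ?thesis unfolding test_estimate_def by blast
qed

text \<open>Near \<open>y \<tau>\<close> a cutoff coordinate is linear in the chart. Its second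
  derivative vanishes and its first picks out a component, so its test estimate is exactly that
  component of the chart estimate.\<close>

lemma chart_estimate_of_test_estimates:
  assumes test: "\<And>f. smooth_fun_on A UNIV f \<Longrightarrow> test_estimate f"
  shows chart_estimate
proof -
  have "z \<tau> \<in> cmap c ` cdom c" using \<tau> by simp
  then obtain r where r: "r > 0" "ball (z \<tau>) r \<subseteq> cmap c ` cdom c"
    "\<And>b. \<exists>f. smooth_fun_on A UNIV f \<and> (\<forall>\<zeta>\<in>ball (z \<tau>) r. f (cinv c \<zeta>) = \<zeta> \<bullet> b)"
    using smooth_cutoff_coordinate[OF A c] by metis
  let ?E = "\<lambda>s t. z t - z s - V (x t - x s) (z s) - correction (z s) (X s t)"
  have "\<exists>C. \<forall>\<^sub>F (s, t) in near_diag a b \<tau>. \<bar>?E s t \<bullet> e\<bar> \<le> C * \<omega> s t powr (3 / p)" for e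
  proof -
    obtain f where f: "smooth_fun_on A UNIV f" "\<And>\<zeta>. \<zeta> \<in> ball (z \<tau>) r \<Longrightarrow> f (cinv c \<zeta>) = \<zeta> \<bullet> e"
      using r(3) by blast
    let ?f = "\<lambda>\<zeta>. f (cinv c \<zeta>)"
    have D1: "ddir v ?f \<zeta> = v \<bullet> e" if "\<zeta> \<in> ball (z \<tau>) r" for \<zeta> v
    proof (rule ddir_eq)
      show "(?f has_derivative (\<lambda>v. v \<bullet> e)) (at \<zeta>)"
        by (rule has_derivative_transform_within_open[OF _ open_ball that])
          (auto intro!: derivative_eq_intros simp: f(2))
    qed
    have D2: "ddir w (ddir v ?f) \<zeta> = 0" if "\<zeta> \<in> ball (z \<tau>) r" for \<zeta> v w
    proof (rule ddir_eq)
      show "((\<lambda>\<zeta>. ddir v ?f \<zeta>) has_derivative (\<lambda>w. 0)) (at \<zeta>)"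
        by (rule has_derivative_transform_within_open[OF has_derivative_const open_ball that])
          (simp only: D1)
    qed
    obtain C where C: "\<forall>\<^sub>F (s, t) in near_diag a b \<tau>.
      \<bar>f (y t) - f (y s) - lie_deriv A (F (x t - x s)) f (y s)
        - contract (\<lambda>w w'. lie_deriv A (F w) (lie_deriv A (F w') f) (y s)) (X s t)\<bar>
      \<le> C * \<omega> s t powr (3 / p)"
      using test[OF f(1)] unfolding test_estimate_def by blast
    have "\<forall>\<^sub>F (s, t) in near_diag a b \<tau>. \<bar>?E s t \<bullet> e\<bar> \<le> C * \<omega> s t powr (3 / p)"
      using C near_chart[OF r(1)]
    proof eventually_elim
      case (elim st)
      obtain s t where st: "st = (s, t)" by (cases st)
      have ys: "y s \<in> cdom c" "y t \<in> cdom c" and zs: "z s \<in> ball (z \<tau>) r" "z t \<in> ball (z \<tau>) r"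
        using elim(2) by (auto simp: st)
      have fy: "f (y s) = z s \<bullet> e" "f (y t) = z t \<bullet> e"
        using f(2)[OF zs(1)] f(2)[OF zs(2)] cinv_cmap[OF A c] ys by simp_all
      have "contract (\<lambda>w w'. lie_deriv A (F w) (lie_deriv A (F w') f) (y s)) (X s t) =
          correction (z s) (X s t) \<bullet> e"
        unfolding test_expansion_chart[OF f(1) ys(1)] D1[OF zs(1)] D2[OF zs(1)]
        by (simp add: contract_def)
      moreover have "lie_deriv A (F (x t - x s)) f (y s) = V (x t - x s) (z s) \<bullet> e"
        unfolding lie_deriv_chart(1)[OF f(1) ys(1)] by (rule D1[OF zs(1)])
      ultimately show ?case
        using elim(1) unfolding st prod.case fy inner_diff_left by (simp only:)
    qed
    then show ?thesis by blast
  qed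
  \<comment> \<open>One constant per direction, chosen for all \<open>e\<close> at once; the
    estimates are then intersected over the finitely many basis directions.\<close>
  then have "\<exists>C. \<forall>e. \<forall>\<^sub>F (s, t) in near_diag a b \<tau>. \<bar>?E s t \<bullet> e\<bar> \<le> C e * \<omega> s t powr (3 / p)"
    by (intro choice allI)
  then obtain C where C: "\<And>e. \<forall>\<^sub>F (s, t) in near_diag a b \<tau>. \<bar>?E s t \<bullet> e\<bar> \<le> C e * \<omega> s t powr (3 / p)"
    by (elim exE) (rule that, erule spec)
  have "\<forall>\<^sub>F st in near_diag a b \<tau>. \<forall>e\<in>Basis.
      case st of (s, t) \<Rightarrow> \<bar>?E s t \<bullet> e\<bar> \<le> C e * \<omega> s t powr (3 / p)"
    by (rule eventually_ball_finite[OF finite_Basis]) (rule ballI, rule C)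
  then have "\<forall>\<^sub>F (s, t) in near_diag a b \<tau>. norm (?E s t) \<le> (\<Sum>e\<in>Basis. C e) * \<omega> s t powr (3 / p)"
  proof eventually_elim
    case (elim st)
    obtain s t where st: "st = (s, t)" by (cases st)
    have "norm (?E s t) \<le> (\<Sum>e\<in>Basis. \<bar>?E s t \<bullet> e\<bar>)" by (rule norm_le_l1)
    also have "\<dots> \<le> (\<Sum>e\<in>Basis. C e * \<omega> s t powr (3 / p))"
      by (rule sum_mono) (use elim in \<open>simp add: st\<close>)
    finally show ?case by (simp add: st sum_distrib_right)
  qed
  then show ?thesis unfolding chart_estimate_def by blast
qed

section \<open>The gauge in the chart\<close>

definition hess :: "'e \<Rightarrow> 'e \<Rightarrow> 'e \<Rightarrow> 'e" where
  "hess \<zeta> u w = ddir (0, w) (ddir (0, u) Psi) (\<zeta>, \<zeta>)"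

text \<open>Linearity in the outer direction is that of a derivative. Symmetry is that of the second
  derivatives of \<open>Psi\<close> on the product, for directions in the second slot, and carries
  linearity over to the other argument.\<close>

lemma hess_linear: "\<zeta> \<in> W \<Longrightarrow> linear (hess \<zeta> u)"
  and hess_sym: "\<zeta> \<in> W \<Longrightarrow> hess \<zeta> u w = hess \<zeta> w u"
proof -
  assume \<zeta>: "\<zeta> \<in> W"
  then have \<zeta>\<zeta>: "(\<zeta>, \<zeta>) \<in> W \<times> W" by simp
  have lin: "linear (\<lambda>v. ddir v (ddir (0, u) Psi) (\<zeta>, \<zeta>))"
    by (rule linear_ddir[OF Ck_on_ddir[OF Ck_on_Psi] \<zeta>\<zeta>])
  have "linear (\<lambda>w. (0::'e, w))"
    by (rule linearI) auto
  from linear_compose[OF this lin] show "linear (hess \<zeta> u)"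
    by (simp add: o_def hess_def[abs_def])
  show "hess \<zeta> u w = hess \<zeta> w u"
    unfolding hess_def by (rule ddir_commute[OF open_WW Ck_on_Psi \<zeta>\<zeta>])
qed

lemma hess_linear_left: "\<zeta> \<in> W \<Longrightarrow> linear (\<lambda>u. hess \<zeta> u w)"
  using hess_linear[of \<zeta> w] hess_sym[of \<zeta> _ w] by simp

lemma KK_sub: "K \<times> K \<subseteq> W \<times> W"
  using K_sub(1) by blast

lemma hess_bound:
  obtains k where "k \<ge> 0" "\<And>\<zeta> u w. \<zeta> \<in> K \<Longrightarrow> norm (hess \<zeta> u w) \<le> k * norm u * norm w"
proof -
  obtain k where k: "k \<ge> 0"
    "\<And>\<xi> v w. \<xi> \<in> K \<times> K \<Longrightarrow> norm (ddir w (ddir v Psi) \<xi>) \<le> k * norm v * norm w"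
    using ddir2_bound[OF open_WW Ck_on_Psi compact_Times[OF compact_cball compact_cball] KK_sub] by metis
  show ?thesis
  proof (rule that[OF k(1)])
    show "norm (hess \<zeta> u w) \<le> k * norm u * norm w" if "\<zeta> \<in> K" for \<zeta> u w
      using k(2)[of "(\<zeta>, \<zeta>)" "(0, u)" "(0, w)"] that by (simp add: hess_def norm_Pair)
  qed
qed

text \<open>Taylor's formula for \<open>Psi\<close> at a diagonal point with an increment in the
  second slot only: the value there is 0 and the first derivative is the identity.\<close>

lemma Psi_remainder:
  obtains B where "B \<ge> 0" "\<And>\<zeta> \<zeta>'. \<zeta> \<in> K \<Longrightarrow> \<zeta>' \<in> K \<Longrightarrow>
    norm (Psi (\<zeta>, \<zeta>') - (\<zeta>' - \<zeta>) - (1 / 2) *\<^sub>R hess \<zeta> (\<zeta>' - \<zeta>) (\<zeta>' - \<zeta>)) \<le> B * norm (\<zeta>' - \<zeta>) ^ 3"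
proof -
  obtain B where B: "B \<ge> 0" "\<And>\<xi> \<xi>'. \<xi> \<in> K \<times> K \<Longrightarrow> \<xi>' \<in> K \<times> K \<Longrightarrow>
    norm (Psi \<xi>' - Psi \<xi> - ddir (\<xi>' - \<xi>) Psi \<xi> - (1 / 2) *\<^sub>R ddir (\<xi>' - \<xi>) (ddir (\<xi>' - \<xi>) Psi) \<xi>)
      \<le> B * norm (\<xi>' - \<xi>) ^ 3"
    using taylor3[OF open_WW Ck_on_Psi compact_Times[OF compact_cball compact_cball]
        convex_Times[OF convex_cball convex_cball] KK_sub] by metis
  show ?thesis
  proof (rule that[OF B(1)])
    fix \<zeta> \<zeta>' assume K: "\<zeta> \<in> K" "\<zeta>' \<in> K"
    then have W: "\<zeta> \<in> W" using K_sub by blast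
    show "norm (Psi (\<zeta>, \<zeta>') - (\<zeta>' - \<zeta>) - (1 / 2) *\<^sub>R hess \<zeta> (\<zeta>' - \<zeta>) (\<zeta>' - \<zeta>)) \<le> B * norm (\<zeta>' - \<zeta>) ^ 3"
      using B(2)[of "(\<zeta>, \<zeta>)" "(\<zeta>, \<zeta>')"] K
      by (simp add: hess_def Psi_diag ddir_Psi_diag[OF W] norm_Pair)
  qed
qed

text \<open>The comparison of norms speaks only about tangent vectors. The contraction is a double
  sum of tangent vectors, which takes one use of \<open>tangent_sum\<close> for each index.\<close>

lemma gauge_increment_tangent:
  assumes "y s \<in> cdom c" "z s \<in> W"
  shows "gauge_increment s t \<in> tangent_space A (y s)"
proof -
  define P where "P w w' = lincomb (-1) (compat_tensor A \<psi> U (y s) (F w (y s)) (F w' (y s)))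
     1 (tderiv A (\<lambda>n. U (y s) n (F w' n)) (y s) (F w (y s)))" for w w'
  have cz: "cinv c (z s) = y s" by (rule cinv_cmap[OF A c assms(1)])
  have PT: "P w w' \<in> tangent_space A (y s)" for w w'
    unfolding P_def
    using compat_tensor_coord(1)[OF assms(2), unfolded cz, OF F_tangent F_tangent]
      transport_coord(1)[OF assms(2), unfolded cz, OF F_tangent field]
    by (rule tangent_lincomb[OF A])
  have "(\<lambda>c. \<Sum>i\<in>UNIV. 1 *\<^sub>R (\<Sum>j\<in>UNIV. X s t $ i $ j *\<^sub>R P (axis i 1) (axis j 1) c)) \<in> tangent_space A (y s)"
    by (intro tangent_sum[OF A] finite_UNIV PT finite)
  from tangent_lincomb[OF A F_tangent this, of 1 "x t - x s" 1]
  show ?thesis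
    by (simp add: gauge_increment_def contract_def lincomb_def P_def)
qed

lemma gauge_increment_chart:
  assumes "y s \<in> cdom c" "z s \<in> W" "0 \<le> s \<and> s \<le> t \<and> t \<le> T"
  shows "gauge_increment s t c = V (x t - x s) (z s) + correction (z s) (X s t) +
    (1 / 2) *\<^sub>R hess (z s) (V (x t - x s) (z s)) (V (x t - x s) (z s))"
proof -
  have cz: "cinv c (z s) = y s" by (rule cinv_cmap[OF A c assms(1)])
  have "- compat_tensor A \<psi> U (y s) (F w (y s)) (F w' (y s)) c
         + tderiv A (\<lambda>n. U (y s) n (F w' n)) (y s) (F w (y s)) c =
      ddir (V w (z s)) (V w') (z s) + hess (z s) (V w (z s)) (V w' (z s))" for w w'
    using gauge_term_coord[OF assms(2), unfolded cz, OF F_tangent[of w] field[of w']]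
    unfolding hess_sym[OF assms(2), of "V w (z s)"] by (simp add: hess_def cz)
  then have "gauge_increment s t c = F (x t - x s) (y s) c +
      contract (\<lambda>w w'. ddir (V w (z s)) (V w') (z s) + hess (z s) (V w (z s)) (V w' (z s))) (X s t)"
    unfolding gauge_increment_def by (simp only:)
  then show ?thesis
    unfolding contract_add
      contract_second_order[OF hess_linear[OF assms(2)] hess_sym[OF assms(2)] assms(3)]
      correction_def[symmetric] by (simp add: cz)
qed

lemma gauge_difference_chart:
  assumes "y s \<in> cdom c" "y t \<in> cdom c" "z s \<in> W" "z t \<in> W" "0 \<le> s \<and> s \<le> t \<and> t \<le> T"
  defines "R \<equiv> lincomb 1 (\<psi> (y s) (y t)) (-1) (gauge_increment s t)"
  shows "R \<in> tangent_space A (y s)"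
    and "R c = Psi (z s, z t) - V (x t - x s) (z s) - correction (z s) (X s t) -
      (1 / 2) *\<^sub>R hess (z s) (V (x t - x s) (z s)) (V (x t - x s) (z s))"
proof -
  have cz: "cinv c (z s) = y s" "cinv c (z t) = y t"
    using cinv_cmap[OF A c] assms(1,2) by simp_all
  then have "(y s, y t) \<in> D" using W_D[OF assms(3,4)] by simp
  then show "R \<in> tangent_space A (y s)"
    unfolding R_def by (intro tangent_lincomb[OF A] psi_tangent gauge_increment_tangent assms)
  have "R c = Psi (z s, z t) - gauge_increment s t c"
    by (simp add: R_def lincomb_def Psi_def cz)
  then show "R c = Psi (z s, z t) - V (x t - x s) (z s) - correction (z s) (X s t) -
      (1 / 2) *\<^sub>R hess (z s) (V (x t - x s) (z s)) (V (x t - x s) (z s))"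
    unfolding gauge_increment_chart[OF assms(1,3,5)] by (simp add: algebra_simps)
qed

text \<open>The forward estimate with \<open>L\<close> the identity and \<open>l = 1\<close>, since
  the first derivative of \<open>Psi\<close> in its second slot is the identity on the diagonal;
  passing to the metric norm only changes the constant.\<close>

lemma chart_estimate_imp_gauge_estimate:
  assumes est: chart_estimate
  shows gauge_estimate
proof -
  obtain C where C: "\<forall>\<^sub>F (s, t) in near_diag a b \<tau>.
     norm (z t - z s - V (x t - x s) (z s) - correction (z s) (X s t)) \<le> C * \<omega> s t powr (3 / p)"
    using est unfolding chart_estimate_def by blast
  obtain C1 where C1: "C1 \<ge> 0" "\<And>\<zeta> w. \<zeta> \<in> K \<Longrightarrow> norm (V w \<zeta>) \<le> C1 * norm w"
    using V_bound by metis
  obtain C2 where C2: "C2 \<ge> 0" "\<And>\<zeta> Z. \<zeta> \<in> K \<Longrightarrow> norm (correction \<zeta> Z) \<le> C2 * norm Z"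
    using correction_bound by metis
  obtain B where B: "B \<ge> 0" "\<And>\<zeta> \<zeta>'. \<zeta> \<in> K \<Longrightarrow> \<zeta>' \<in> K \<Longrightarrow>
    norm (Psi (\<zeta>, \<zeta>') - (\<zeta>' - \<zeta>) - (1 / 2) *\<^sub>R hess \<zeta> (\<zeta>' - \<zeta>) (\<zeta>' - \<zeta>)) \<le> B * norm (\<zeta>' - \<zeta>) ^ 3"
    using Psi_remainder by metis
  obtain k where k: "k \<ge> 0" "\<And>\<zeta> u w. \<zeta> \<in> K \<Longrightarrow> norm (hess \<zeta> u w) \<le> k * norm u * norm w"
    using hess_bound by metis
  obtain \<alpha> \<beta> where g\<alpha>\<beta>: "\<alpha> > 0" "\<beta> > 0" "\<And>\<zeta> v. \<zeta> \<in> K \<Longrightarrow> v \<in> tangent_space A (cinv c \<zeta>) \<Longrightarrow>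
      \<alpha> * norm (v c) \<le> metric_norm g (cinv c \<zeta>) v \<and> metric_norm g (cinv c \<zeta>) v \<le> \<beta> * norm (v c)"
    using metric_norm_equivalent[OF A g c compact_cball K_sub(2)] by metis
  obtain M where M: "\<And>r h v n \<Phi> (L::'e \<Rightarrow> 'e) H.
    0 \<le> r \<Longrightarrow> r \<le> q 0 T \<Longrightarrow> norm v \<le> C1 * r \<Longrightarrow> norm n \<le> C2 * r\<^sup>2 \<Longrightarrow>
    norm (h - v - n) \<le> \<bar>C\<bar> * r ^ 3 \<Longrightarrow>
    linear L \<Longrightarrow> (\<And>e. norm (L e) \<le> 1 * norm e) \<Longrightarrow>
    (\<And>u. linear (H u)) \<Longrightarrow> (\<And>w. linear (\<lambda>u. H u w)) \<Longrightarrow>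
    (\<And>u w. norm (H u w) \<le> k * norm u * norm w) \<Longrightarrow>
    norm (\<Phi> - L h - (1 / 2) *\<^sub>R H h h) \<le> B * norm h ^ 3 \<Longrightarrow>
    norm (\<Phi> - L v - L n - (1 / 2) *\<^sub>R H v v) \<le> M * r ^ 3"
    by (rule forward_estimate_uniform[OF powr_ge_zero C1(1) C2(1) abs_ge_zero[of C] zero_le_one k(1) B(1)])
      blast
  have "\<forall>\<^sub>F (s, t) in near_diag a b \<tau>. (y s, y t) \<in> D \<and>
     metric_norm g (y s) (lincomb 1 (\<psi> (y s) (y t)) (-1) (gauge_increment s t)) \<le> (\<beta> * M) * \<omega> s t powr (3 / p)"
    using C near_chart[OF zero_less_one]
  proof eventually_elim
    case (elim st)
    obtain s t where st: "st = (s, t)" by (cases st)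
    have tr: "0 \<le> s \<and> s \<le> t \<and> t \<le> T" and ys: "y s \<in> cdom c" "y t \<in> cdom c"
      and zK: "z s \<in> K" "z t \<in> K"
      using elim(2) by (auto simp: st)
    have zW: "z s \<in> W" "z t \<in> W" using zK K_sub by blast+
    have cz: "cinv c (z s) = y s" "cinv c (z t) = y t"
      using cinv_cmap[OF A c] ys by simp_all
    note rb = rough_bounds[OF tr]
    let ?v = "V (x t - x s) (z s)" and ?n = "correction (z s) (X s t)"
    let ?R = "lincomb 1 (\<psi> (y s) (y t)) (-1) (gauge_increment s t)"
    have "norm (z t - z s - ?v - ?n) \<le> C * q s t ^ 3"
      using elim(1) by (simp add: st rb(5))
    also have "\<dots> \<le> \<bar>C\<bar> * q s t ^ 3" using rb(1) by (intro mult_right_mono) auto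
    finally have h: "norm (z t - z s - ?v - ?n) \<le> \<bar>C\<bar> * q s t ^ 3" .
    have v: "norm ?v \<le> C1 * q s t"
      using C1(2)[OF zK(1)] mult_left_mono[OF rb(3) C1(1)] by (rule order_trans)
    have n: "norm ?n \<le> C2 * (q s t)\<^sup>2"
      using C2(2)[OF zK(1)] mult_left_mono[OF rb(4) C2(1)] by (rule order_trans)
    have "norm (Psi (z s, z t) - ?v - ?n - (1 / 2) *\<^sub>R hess (z s) ?v ?v) \<le> M * q s t ^ 3"
      by (rule M[where L="\<lambda>e. e" and H="hess (z s)", OF rb(1,2) v n h linear_ident _
            hess_linear[OF zW(1)] hess_linear_left[OF zW(1)] k(2)[OF zK(1)] B(2)[OF zK]]) simp
    then have "norm (?R c) \<le> M * q s t ^ 3"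
      unfolding gauge_difference_chart(2)[OF ys zW tr] .
    then have "\<beta> * norm (?R c) \<le> \<beta> * (M * q s t ^ 3)"
      using g\<alpha>\<beta>(2) by (intro mult_left_mono) auto
    moreover have "metric_norm g (y s) ?R \<le> \<beta> * norm (?R c)"
      using g\<alpha>\<beta>(3)[OF zK(1), unfolded cz, OF gauge_difference_chart(1)[OF ys zW tr]] by blast
    moreover have "(y s, y t) \<in> D" using W_D[OF zW] by (simp add: cz)
    ultimately show ?case by (simp add: st rb(5) mult.assoc)
  qed
  then show ?thesis unfolding gauge_estimate_def by blast
qed

lemma gauge_estimate_imp_chart_estimate:
  assumes est: gauge_estimate
  shows chart_estimate
proof -
  obtain C where C: "\<forall>\<^sub>F (s, t) in near_diag a b \<tau>. (y s, y t) \<in> D \<and>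
     metric_norm g (y s) (lincomb 1 (\<psi> (y s) (y t)) (-1) (gauge_increment s t)) \<le> C * \<omega> s t powr (3 / p)"
    using est unfolding gauge_estimate_def by blast
  obtain C1 where C1: "C1 \<ge> 0" "\<And>\<zeta> w. \<zeta> \<in> K \<Longrightarrow> norm (V w \<zeta>) \<le> C1 * norm w"
    using V_bound by metis
  obtain C2 where C2: "C2 \<ge> 0" "\<And>\<zeta> Z. \<zeta> \<in> K \<Longrightarrow> norm (correction \<zeta> Z) \<le> C2 * norm Z"
    using correction_bound by metis
  obtain B where B: "B \<ge> 0" "\<And>\<zeta> \<zeta>'. \<zeta> \<in> K \<Longrightarrow> \<zeta>' \<in> K \<Longrightarrow>
    norm (Psi (\<zeta>, \<zeta>') - (\<zeta>' - \<zeta>) - (1 / 2) *\<^sub>R hess \<zeta> (\<zeta>' - \<zeta>) (\<zeta>' - \<zeta>)) \<le> B * norm (\<zeta>' - \<zeta>) ^ 3"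
    using Psi_remainder by metis
  obtain k where k: "k \<ge> 0" "\<And>\<zeta> u w. \<zeta> \<in> K \<Longrightarrow> norm (hess \<zeta> u w) \<le> k * norm u * norm w"
    using hess_bound by metis
  obtain \<alpha> \<beta> where g\<alpha>\<beta>: "\<alpha> > 0" "\<beta> > 0" "\<And>\<zeta> v. \<zeta> \<in> K \<Longrightarrow> v \<in> tangent_space A (cinv c \<zeta>) \<Longrightarrow>
      \<alpha> * norm (v c) \<le> metric_norm g (cinv c \<zeta>) v \<and> metric_norm g (cinv c \<zeta>) v \<le> \<beta> * norm (v c)"
    using metric_norm_equivalent[OF A g c compact_cball K_sub(2)] by metis
  define C3 where "C3 = \<bar>C\<bar> / \<alpha>"
  have C3: "C3 \<ge> 0" using g\<alpha>\<beta>(1) by (simp add: C3_def)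
  obtain M where M: "\<And>r h v n (\<Phi>::'e) H.
    0 \<le> r \<Longrightarrow> r \<le> q 0 T \<Longrightarrow> norm v \<le> C1 * r \<Longrightarrow> norm n \<le> C2 * r\<^sup>2 \<Longrightarrow>
    norm (\<Phi> - v - n - (1 / 2) *\<^sub>R H v v) \<le> C3 * r ^ 3 \<Longrightarrow>
    (\<And>u. linear (H u)) \<Longrightarrow> (\<And>w. linear (\<lambda>u. H u w)) \<Longrightarrow>
    (\<And>u w. norm (H u w) \<le> k * norm u * norm w) \<Longrightarrow>
    norm (\<Phi> - h - (1 / 2) *\<^sub>R H h h) \<le> B * norm h ^ 3 \<Longrightarrow> norm h \<le> 2 * norm \<Phi> \<Longrightarrow>
    norm (h - v - n) \<le> M * r ^ 3"
    by (rule backward_estimate_uniform[OF powr_ge_zero C1(1) C2(1) C3 k(1) B(1)]) blast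
  \<comment> \<open>Chosen so that \<open>(k + 2 * B) * \<eta> \<le> 1\<close>: for increments of
    size at most \<open>\<eta>\<close> the quadratic and cubic Taylor terms together are at most
    half of |h|, whence |h| <= 2 |\<Phi>|. Also \<open>\<eta> \<le> 1\<close>, which bounds the cube
    by the square.\<close>
  define \<eta> where "\<eta> = 1 / (k + 2 * B + 1)"
  have kB: "k + 2 * B + 1 > 0" using k(1) B(1) by simp
  have \<eta>: "\<eta> > 0" "\<eta> \<le> 1" using kB k(1) B(1) by (simp_all add: \<eta>_def)
  have "\<forall>\<^sub>F (s, t) in near_diag a b \<tau>.
     norm (z t - z s - V (x t - x s) (z s) - correction (z s) (X s t)) \<le> M * \<omega> s t powr (3 / p)"
    using C near_chart[OF \<eta>(1)]
  proof eventually_elim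
    case (elim st)
    obtain s t where st: "st = (s, t)" by (cases st)
    have tr: "0 \<le> s \<and> s \<le> t \<and> t \<le> T" and ys: "y s \<in> cdom c" "y t \<in> cdom c"
      and zK: "z s \<in> K" "z t \<in> K" and small: "norm (z t - z s) \<le> \<eta>"
      using elim(2) by (auto simp: st)
    have zW: "z s \<in> W" "z t \<in> W" using zK K_sub by blast+
    have cz: "cinv c (z s) = y s" "cinv c (z t) = y t"
      using cinv_cmap[OF A c] ys by simp_all
    note rb = rough_bounds[OF tr]
    let ?v = "V (x t - x s) (z s)" and ?n = "correction (z s) (X s t)"
    let ?R = "lincomb 1 (\<psi> (y s) (y t)) (-1) (gauge_increment s t)"
    let ?h = "z t - z s" and ?\<Phi> = "Psi (z s, z t)"
    have "\<alpha> * norm (?R c) \<le> metric_norm g (y s) ?R"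
      using g\<alpha>\<beta>(3)[OF zK(1), unfolded cz, OF gauge_difference_chart(1)[OF ys zW tr]] by blast
    also have "\<dots> \<le> C * q s t ^ 3" using elim(1) by (simp add: st rb(5))
    also have "\<dots> \<le> \<bar>C\<bar> * q s t ^ 3" using rb(1) by (intro mult_right_mono) auto
    finally have "norm (?R c) \<le> C3 * q s t ^ 3"
      using g\<alpha>\<beta>(1) by (simp add: C3_def field_simps)
    then have \<Phi>: "norm (?\<Phi> - ?v - ?n - (1 / 2) *\<^sub>R hess (z s) ?v ?v) \<le> C3 * q s t ^ 3"
      unfolding gauge_difference_chart(2)[OF ys zW tr] .
    have v: "norm ?v \<le> C1 * q s t"
      using C1(2)[OF zK(1)] mult_left_mono[OF rb(3) C1(1)] by (rule order_trans)
    have n: "norm ?n \<le> C2 * (q s t)\<^sup>2"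
      using C2(2)[OF zK(1)] mult_left_mono[OF rb(4) C2(1)] by (rule order_trans)
    have h2: "norm ?h \<le> 2 * norm ?\<Phi>"
    proof -
      let ?r = "norm ?h"
      have "?r\<^sup>2 \<le> \<eta> * ?r" using small by (simp add: power2_eq_square mult_right_mono)
      have "?r ^ 3 = ?r * ?r\<^sup>2" by (simp add: power3_eq_cube power2_eq_square)
      also have "\<dots> \<le> 1 * ?r\<^sup>2" using small \<eta>(2) by (intro mult_right_mono) auto
      finally have r3: "?r ^ 3 \<le> ?r\<^sup>2" by simp
      have "?r = norm (?\<Phi> - (?\<Phi> - ?h - (1 / 2) *\<^sub>R hess (z s) ?h ?h) - (1 / 2) *\<^sub>R hess (z s) ?h ?h)"
        by simp
      also have "\<dots> \<le> norm ?\<Phi> + norm (?\<Phi> - ?h - (1 / 2) *\<^sub>R hess (z s) ?h ?h)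
          + norm ((1 / 2) *\<^sub>R hess (z s) ?h ?h)"
        by (rule norm_diff_diff_le)
      also have "\<dots> \<le> norm ?\<Phi> + B * ?r\<^sup>2 + k / 2 * ?r\<^sup>2"
        using B(2)[OF zK] mult_left_mono[OF r3 B(1)] k(2)[OF zK(1), of ?h ?h]
        by (simp add: power2_eq_square mult.assoc)
      also have "\<dots> = norm ?\<Phi> + (k + 2 * B) / 2 * ?r\<^sup>2" by (simp add: field_simps)
      also have "(k + 2 * B) / 2 * ?r\<^sup>2 \<le> (k + 2 * B) / 2 * (\<eta> * ?r)"
        using \<open>?r\<^sup>2 \<le> \<eta> * ?r\<close> k(1) B(1) by (intro mult_left_mono) auto
      also have "(k + 2 * B) / 2 * (\<eta> * ?r) = ((k + 2 * B) * \<eta>) * (?r / 2)" by simp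
      also have "\<dots> \<le> 1 * (?r / 2)"
        using kB k(1) B(1) by (intro mult_right_mono) (auto simp: \<eta>_def)
      finally show ?thesis by simp
    qed
    have "norm (?h - ?v - ?n) \<le> M * q s t ^ 3"
      by (rule M[where H="hess (z s)", OF rb(1,2) v n \<Phi> hess_linear[OF zW(1)]
            hess_linear_left[OF zW(1)] k(2)[OF zK(1)] B(2)[OF zK] h2])
    then show ?case by (simp add: st rb(5))
  qed
  then show ?thesis unfolding chart_estimate_def by blast
qed

lemma test_estimates_iff_gauge_estimate:
  "(\<forall>f. smooth_fun_on A UNIV f \<longrightarrow> test_estimate f) \<longleftrightarrow> gauge_estimate"
  using chart_estimate_of_test_estimates chart_estimate_imp_test_estimate
    chart_estimate_imp_gauge_estimate gauge_estimate_imp_chart_estimate by blast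

end

section \<open>From local to uniform statements\<close>

lemma gauge_chart_exists:
  fixes A :: "('m::{t2_space, second_countable_topology}, 'e::euclidean_space) chart set"
  assumes A: "smooth_atlas A" and gauge: "gauge_on A D \<psi> U"
  obtains c W \<rho> where "gauge_chart A D \<psi> U c W" "m \<in> cdom c" "\<rho> > 0" "cball (cmap c m) \<rho> \<subseteq> W"
proof -
  obtain c where c: "c \<in> A" "m \<in> cdom c" using atlas_cover[OF A] by blast
  have "open D" "(m, m) \<in> D" using gauge by (auto simp: gauge_on_def diagonal_domain_def)
  then obtain N1 N2 where N: "open N1" "open N2" "(m, m) \<in> N1 \<times> N2" "N1 \<times> N2 \<subseteq> D"
    by (rule open_prod_elim)
  \<comment> \<open>One neighbourhood for both arguments: points of \<open>N\<close> can stand on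
    either side of a pair in \<open>D\<close>.\<close>
  define N where "N = N1 \<inter> N2 \<inter> cdom c"
  define W where "W = cmap c ` N"
  have oW: "open W"
    unfolding W_def N_def by (intro open_cmap_image[OF A c(1)] open_Int N open_cdom[OF A c(1)]) auto
  have mW: "cmap c m \<in> W" using N c by (auto simp: W_def N_def)
  then obtain \<rho> where \<rho>: "\<rho> > 0" "cball (cmap c m) \<rho> \<subseteq> W"
    using oW open_contains_cball by blast
  have "gauge_chart A D \<psi> U c W"
  proof
    show "W \<subseteq> cmap c ` cdom c" by (auto simp: W_def N_def)
    fix z z' assume "z \<in> W" "z' \<in> W"
    then have "cinv c z \<in> N" "cinv c z' \<in> N"
      using cinv_cmap[OF A c(1)] by (auto simp: W_def N_def)
    then show "(cinv c z, cinv c z') \<in> D" using N(4) by (auto simp: N_def)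
  qed (rule A gauge c oW)+
  then show ?thesis using that c(2) \<rho> by blast
qed

text \<open>The theorem asks for a step size that ensures definedness and then, inside
  \<open>approx3\<close>, for a constant; the localised form has the constant first and both
  properties together. They agree because the same \<open>\<delta>\<close> governs both.\<close>

lemma ex_bound_conj_swap:
  fixes \<Delta> :: "real \<Rightarrow> 'a \<Rightarrow> 'b \<Rightarrow> bool"
  shows "(\<exists>C. \<exists>\<delta>>0. \<forall>s t. \<Delta> \<delta> s t \<longrightarrow> Q s t \<and> R C s t) \<longleftrightarrow>
    (\<exists>\<delta>>0. (\<forall>s t. \<Delta> \<delta> s t \<longrightarrow> Q s t) \<and> (\<exists>C. \<forall>s t. \<Delta> \<delta> s t \<longrightarrow> R C s t))"
  by blast

text \<open>The solution notion quantifies over test functions before intervals, and the constants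
  may depend on both; only universal quantifiers change places.\<close>

lemma all_imp_swap:
  assumes "\<And>a b. I a b \<Longrightarrow> (\<forall>f. S f \<longrightarrow> P f a b) \<longleftrightarrow> Q a b"
  shows "(\<forall>f. S f \<longrightarrow> (\<forall>a b. I a b \<longrightarrow> P f a b)) \<longleftrightarrow> (\<forall>a b. I a b \<longrightarrow> Q a b)"
  using assms by blast

theorem theorem5p9:
  fixes A :: "('m::{t2_space, second_countable_topology}, 'e::euclidean_space) chart set"
    and D :: "('m \<times> 'm) set"
    and \<psi> :: "'m \<Rightarrow> 'm \<Rightarrow> ('m, 'e) tvec"
    and U :: "'m \<Rightarrow> 'm \<Rightarrow> ('m, 'e) tvec \<Rightarrow> ('m, 'e) tvec"
    and g :: "'m \<Rightarrow> ('m, 'e) tvec \<Rightarrow> ('m, 'e) tvec \<Rightarrow> real"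
    and p T :: real
    and \<omega> :: "real \<Rightarrow> real \<Rightarrow> real"
    and x :: "real \<Rightarrow> real^'k"
    and X :: "real \<Rightarrow> real \<Rightarrow> real^'k^'k"
    and F :: "real^'k \<Rightarrow> 'm \<Rightarrow> ('m, 'e) tvec"
    and I\<^sub>0 :: "real set"
    and y :: "real \<Rightarrow> 'm"
    and yd :: "real \<Rightarrow> real^'k \<Rightarrow> ('m, 'e) tvec"
  assumes "smooth_atlas A"
    and "gauge_on A D \<psi> U"
    and "riemannian_metric A g"
    and "1 \<le> p" and "p < 3" and "T > 0"
    and "rp_control T \<omega>"
    and "weak_geometric_rough_path p T \<omega> x X"
    and "linear_vector_fields A F"
    and "I\<^sub>0 = {0..T} \<or> I\<^sub>0 = {0..<T}"
    and "continuous_pair A I\<^sub>0 y yd"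
  shows "rde_solution A p \<omega> x X F I\<^sub>0 y yd \<longleftrightarrow>
    (\<forall>s\<in>I\<^sub>0. \<forall>w. yd s w = F w (y s)) \<and>
    (\<forall>a b. {a..b} \<subseteq> I\<^sub>0 \<longrightarrow>
      (\<exists>\<delta>>0. (\<forall>s t. a \<le> s \<and> s \<le> t \<and> t \<le> b \<and> t - s \<le> \<delta> \<longrightarrow> (y s, y t) \<in> D) \<and>
        approx3 g p \<omega> y a b \<delta>
          (\<lambda>s t. \<psi> (y s) (y t))
          (\<lambda>s t c. F (x t - x s) (y s) c +
            contract (\<lambda>w w'.
                - compat_tensor A \<psi> U (y s) (F w (y s)) (F w' (y s)) c
                + tderiv A (\<lambda>n. U (y s) n (F w' n)) (y s) (F w (y s)) c)
              (X s t))))"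
proof -
  let ?G = "\<lambda>s t c. F (x t - x s) (y s) c +
    contract (\<lambda>w w'. - compat_tensor A \<psi> U (y s) (F w (y s)) (F w' (y s)) c
       + tderiv A (\<lambda>n. U (y s) n (F w' n)) (y s) (F w (y s)) c) (X s t)"
  let ?test = "\<lambda>f C s t. \<bar>f (y t) - f (y s) - lie_deriv A (F (x t - x s)) f (y s)
       - contract (\<lambda>w w'. lie_deriv A (F w) (lie_deriv A (F w') f) (y s)) (X s t)\<bar>
     \<le> C * \<omega> s t powr (3 / p)"
  let ?gauge = "\<lambda>C s t. (y s, y t) \<in> D \<and>
     metric_norm g (y s) (lincomb 1 (\<psi> (y s) (y t)) (-1) (?G s t)) \<le> C * \<omega> s t powr (3 / p)"
  let ?unif = "\<lambda>a b P. \<exists>C. \<exists>\<delta>>0. \<forall>s t. a \<le> s \<and> s \<le> t \<and> t \<le> b \<and> t - s \<le> \<delta> \<longrightarrow> P C s t"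
  let ?loc = "\<lambda>a b P. \<forall>\<tau>\<in>{a..b}. \<exists>C. \<forall>\<^sub>F (s, t) in near_diag a b \<tau>. P C s t"
  \<comment> \<open>From uniform to local is a restriction to a neighbourhood; monotonicity in
    \<open>C\<close> permits the return by compactness.\<close>
  have unif_iff: "?unif a b P \<longleftrightarrow> ?loc a b P"
    if "\<And>C C' s t. C \<le> C' \<Longrightarrow> P C s t \<Longrightarrow> P C' s t" for a b and P :: "real \<Rightarrow> real \<Rightarrow> real \<Rightarrow> bool"
  proof
    assume "?unif a b P"
    then obtain C \<delta> where "\<delta> > 0" "\<And>s t. a \<le> s \<and> s \<le> t \<and> t \<le> b \<and> t - s \<le> \<delta> \<Longrightarrow> P C s t" by blast
    then show "?loc a b P" using near_diag_of_uniform[of \<delta> a b "P C"] by blast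
  next
    assume "?loc a b P"
    then show "?unif a b P" using that by (intro uniform_of_near_diag) auto
  qed
  have mono: "C * \<omega> s t powr (3 / p) \<le> C' * \<omega> s t powr (3 / p)" if "C \<le> C'" for C C' s t
    using that by (intro mult_right_mono) auto
  have test_iff: "?unif a b (?test f) \<longleftrightarrow> ?loc a b (?test f)" for a b f
    by (rule unif_iff) (use mono order_trans in blast)
  have gauge_iff: "?unif a b ?gauge \<longleftrightarrow> ?loc a b ?gauge" for a b
    by (rule unif_iff) (use mono order_trans in blast)
  have "(\<forall>f. smooth_fun_on A UNIV f \<longrightarrow> ?unif a b (?test f)) \<longleftrightarrow> ?unif a b ?gauge"
    if ab: "{a..b} \<subseteq> I\<^sub>0" for a b
  proof -
    have "(\<forall>f. smooth_fun_on A UNIV f \<longrightarrow> (\<exists>C. \<forall>\<^sub>F (s, t) in near_diag a b \<tau>. ?test f C s t)) \<longleftrightarrow>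
        (\<exists>C. \<forall>\<^sub>F (s, t) in near_diag a b \<tau>. ?gauge C s t)" if \<tau>: "\<tau> \<in> {a..b}" for \<tau>
    proof -
      obtain c W \<rho> where cW: "gauge_chart A D \<psi> U c W" "y \<tau> \<in> cdom c" "\<rho> > 0" "cball (cmap c (y \<tau>)) \<rho> \<subseteq> W"
        by (rule gauge_chart_exists[OF assms(1,2)])
      \<comment> \<open>The point \<open>\<tau>\<close> makes the interval nonempty, and this puts
        its end points into the time interval. For an empty interval both localised statements hold
        trivially.\<close>
      have "a \<in> I\<^sub>0" "b \<in> I\<^sub>0" using ab \<tau> by auto
      then have "0 \<le> a" "b \<le> T" using assms(10) by auto
      moreover have "continuous_on {a..b} y"
        using assms(11) ab continuous_on_subset unfolding continuous_pair_def by blast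
      ultimately have "rde_chart A D \<psi> U c W g p T \<omega> x X F y a b \<tau> \<rho>"
        using cW \<tau> assms by (intro rde_chart.intro rde_chart_axioms.intro)
      then interpret rde_chart A D \<psi> U c W g p T \<omega> x X F y a b \<tau> \<rho> .
      show ?thesis
        using test_estimates_iff_gauge_estimate
        unfolding test_estimate_def gauge_estimate_def gauge_increment_def .
    qed
    then show ?thesis unfolding test_iff gauge_iff by blast
  qed
  then have "(\<forall>f. smooth_fun_on A UNIV f \<longrightarrow> ?unif a b (?test f)) \<longleftrightarrow>
      (\<exists>\<delta>>0. (\<forall>s t. a \<le> s \<and> s \<le> t \<and> t \<le> b \<and> t - s \<le> \<delta> \<longrightarrow> (y s, y t) \<in> D) \<and>
        approx3 g p \<omega> y a b \<delta> (\<lambda>s t. \<psi> (y s) (y t)) ?G)" if "{a..b} \<subseteq> I\<^sub>0" for a b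
    unfolding approx3_def ex_bound_conj_swap[symmetric] using that .
  then show ?thesis
    unfolding rde_solution_def by (intro conj_cong refl all_imp_swap)
qed

end
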